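(* $$\int_0^{2\pi}(1-\cos^2\theta)\log w(\theta)\frac{d\theta}{2\pi}>-\infty\iff\sum_{n=0}^{\infty}\left(|\alpha_{n+2}-\alpha_n|^2+|\alpha_n|^4\right)<\infty.$$ More precisely, for any sequence $\alpha$ of Verblunsky coefficients, $$\int_0^{2\pi}(1-\cos^2\theta)\log w(\theta)\frac{d\theta}{2\pi}=\frac38+\frac12\sum_{j=0}^{\infty}\Big[\log(1-|\alpha_j|^2)+|\alpha_j|^2+\frac12|\alpha_j|^4\Big]-\frac12\sum_{j=0}^{\infty}|\alpha_j\alpha_{j-1}|^2-\frac14\sum_{j=0}^{\infty}\rho_j^2|\alpha_{j+1}-\alpha_{j-1}|^2$$ $$-\frac1{16}\sum_{j=0}^{\infty}\left[\big(2|\alpha_j|^2-|\alpha_j-\alpha_{j-1}|^2\big)^2+\big(2|\alpha_{j-1}|^2-|\alpha_j-\alpha_{j-1}|^2\big)^2\right].$$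
   Context: $\mu$ is a probability measure with infinite support on the unit circle (identified with $[0,2\pi]$ via $e^{i\theta}\mapsto\theta$), with Lebesgue decomposition $d\mu(\theta)=w(\theta)\frac{d\theta}{2\pi}+d\mu_s(\theta)$. $\Phi_n$ are its monic orthogonal polynomials, and its Verblunsky coefficients are $\alpha_n=-\overline{\Phi_{n+1}(0)}\in\mathbb{D}$, $n\ge0$, with the convention $\alpha_{-1}=-1$; $\rho_j=(1-|\alpha_j|^2)^{1/2}$. The integral is well defined in $[-\infty,\infty)$, and the sums on the right side of the identity have terms of constant sign, so that the right side is well defined in $[-\infty,\infty)$; the identity allows both sides to be $-\infty$. *)

theory Defs
  imports "HOL-Probability.Probability" "HOL-Computational_Algebra.Polynomial"
begin

abbreviation circle_borel :: "complex measure" where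
  "circle_borel \<equiv> restrict_space borel (sphere 0 1)"

(* d\<theta> / (2 pi) on [0, 2 pi] *)
definition angle_measure :: "real measure" where
  "angle_measure = uniform_measure lborel {0..2 * pi}"

definition measure_support :: "complex measure \<Rightarrow> complex set" where
  "measure_support \<mu> =
     {z \<in> space \<mu>. \<forall>U. open U \<and> z \<in> U \<longrightarrow> emeasure \<mu> (U \<inter> space \<mu>) > 0}"

definition circle_prob_measure :: "complex measure \<Rightarrow> bool" where
  "circle_prob_measure \<mu> \<longleftrightarrow> prob_space \<mu> \<and> sets \<mu> = sets circle_borel"

(* d\<mu> = w(\<theta>) d\<theta>/(2 pi) + d\<mu>s, transported to the circle by \<theta> \<mapsto> exp(i \<theta>);
   values of w outside [0, 2 pi] play no role *)
definition lebesgue_decomposition ::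
    "complex measure \<Rightarrow> (real \<Rightarrow> real) \<Rightarrow> complex measure \<Rightarrow> bool" where
  "lebesgue_decomposition \<mu> w \<mu>s \<longleftrightarrow>
     w \<in> borel_measurable borel \<and> (\<forall>\<theta>\<in>{0..2 * pi}. 0 \<le> w \<theta>) \<and>
     sets \<mu>s = sets circle_borel \<and>
     (\<forall>A \<in> sets circle_borel.
        emeasure \<mu> A =
          emeasure (distr (density angle_measure (\<lambda>\<theta>. ennreal (w \<theta>))) circle_borel cis) A
          + emeasure \<mu>s A) \<and>
     (\<exists>N \<in> sets circle_borel.
        emeasure (distr angle_measure circle_borel cis) N = 0 \<and>
        emeasure \<mu>s (sphere 0 1 - N) = 0)"

(* well defined when the support of \<mu> is infinite *)
definition monic_orthogonal_poly :: "complex measure \<Rightarrow> nat \<Rightarrow> complex poly" where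
  "monic_orthogonal_poly \<mu> n =
     (THE p. degree p = n \<and> lead_coeff p = 1 \<and>
             (\<forall>k<n. (\<integral>z. cnj (z ^ k) * poly p z \<partial>\<mu>) = 0))"

(* Indices below -1 are junk; at -1 the value is the usual boundary convention. *)
definition verblunsky :: "complex measure \<Rightarrow> int \<Rightarrow> complex" where
  "verblunsky \<mu> n =
     (if n < 0 then -1 else - cnj (poly (monic_orthogonal_poly \<mu> (nat n + 1)) 0))"

(* logarithm of a nonnegative real with log 0 = -\<infinity> (the library has ln 0 = 0) *)
definition ereal_log :: "real \<Rightarrow> ereal" where
  "ereal_log x = (if x > 0 then ereal (ln x) else -\<infinity>)"

(* integral of the positive part minus that of the negative part;
   meaningful when at most one of them is infinite *)
definition ereal_integral :: "'a measure \<Rightarrow> ('a \<Rightarrow> ereal) \<Rightarrow> ereal" where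
  "ereal_integral M f =
     enn2ereal (\<integral>\<^sup>+x. e2ennreal (f x) \<partial>M) - enn2ereal (\<integral>\<^sup>+x. e2ennreal (- f x) \<partial>M)"

end

(* Let w_N be the Bernstein-Szego weight with the same first N Verblunsky coefficients as the measure,
   S the left-hand side of the sum rule and F_N its value for w_N. Since w_N is the inverse square
   modulus of a polynomial without zeros in the closed disc, F_N is read off from the first three
   Taylor coefficients of the logarithm of that polynomial, and the Szego recursion turns it into the
   partial sums of the right-hand side up to a boundary term that vanishes with the coefficients.

   The inequality log x <= x - 1 for x = w / w_N, together with the bound
   |<Phi_N, z^2 Phi_N>| <= (|alpha_N| + |alpha_{N+1}|) ||Phi_N||^2, gives
   S <= F_N + (|alpha_N| + |alpha_{N+1}|) / 2. Conversely w_N has the same moments as the measure up to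
   order N, so log x <= x - 1 for x = t w_N with a positive trigonometric polynomial t bounds F_N
   for large N by a functional of t; letting t approximate 1 / (w + d) off the singular support and a
   small constant on it gives limsup F_N <= S. *)
theory Submission
  imports Defs "HOL-Complex_Analysis.Complex_Analysis"
begin

section \<open>Integrals over the unit circle\<close>

text \<open>The weight 1 - cos^2 is (1 - cos 2 theta) / 2. Hence the entropy of a Bernstein-Szego
  weight sees only the Taylor coefficients of orders 0 and 2 of a logarithm, and the error of the
  upper bound comes from a single matrix element of z^2, halved. The two bounds differ in strength.
  The upper one holds for every N and allows S = -infinity. The lower one has two obstacles: log w
  may be unbounded below, hence the shift by d; and the singular part contributes to the moments but
  not to S, hence the separate treatment of a null set that carries it. The summands on the right
  have constant signs, so a single nonnegative series, \<open>defect\<close>, decides the case. If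
  it diverges, F_N tends to -infinity while the errors stay bounded, and the upper bound alone gives
  S = -infinity, without any decay of the coefficients. If it converges, a leftover |alpha_j|^6 / 3
  in the logarithmic bracket forces the coefficients to 0, and both bounds are used.\<close>

definition unif :: "complex measure" where "unif = distr angle_measure circle_borel cis"

lemma sets_angle_measure [simp, measurable_cong]: "sets angle_measure = sets borel"
  by (simp add: angle_measure_def)

lemma space_angle_measure [simp]: "space angle_measure = UNIV"
  by (simp add: angle_measure_def)

interpretation angle: prob_space angle_measure
  unfolding angle_measure_def by (rule prob_space_uniform_measure) auto

lemma AE_angle_measure: "AE \<theta> in angle_measure. \<theta> \<in> {0..2*pi}"
  unfolding angle_measure_def by (rule AE_uniform_measureI) auto

lemma lborel_AE_angle: "AE \<theta> in lborel. P \<theta> \<Longrightarrow> AE \<theta> in angle_measure. P \<theta>"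
  unfolding angle_measure_def by (rule AE_uniform_measureI) auto

lemma cis_measurable [measurable]: "cis \<in> measurable borel circle_borel"
proof (rule measurable_restrict_space2)
  show "cis \<in> borel_measurable borel"
    by (intro borel_measurable_continuous_onI continuous_intros)
qed auto

lemma space_circle: "sets M = sets circle_borel \<Longrightarrow> space M = sphere 0 1"
  by (drule sets_eq_imp_space_eq) (simp add: space_restrict_space)

lemma circle_prob_measure_unif: "circle_prob_measure unif"
  unfolding circle_prob_measure_def unif_def
  by (auto intro!: angle.prob_space_distr)

lemma continuous_on_circle_measurable:
  fixes f :: "complex \<Rightarrow> 'b::topological_space"
  assumes "sets M = sets circle_borel" "continuous_on (sphere 0 1) f"
  shows "f \<in> borel_measurable M"
proof -
  have "f \<in> borel_measurable circle_borel"
    using assms(2) by (rule borel_measurable_continuous_on_restrict)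
  then show ?thesis using assms(1) by (simp cong: measurable_cong_sets)
qed

lemma integrable_circle:
  fixes f :: "complex \<Rightarrow> 'b::{banach, second_countable_topology}"
  assumes "finite_measure M" "sets M = sets circle_borel" "continuous_on (sphere 0 1) f"
  shows "integrable M f"
proof -
  interpret finite_measure M by fact
  have "compact (f ` sphere 0 1)" by (intro compact_continuous_image assms) auto
  then obtain B where B: "\<And>z. z \<in> sphere 0 1 \<Longrightarrow> norm (f z) \<le> B"
    by (meson bounded_iff compact_imp_bounded image_eqI)
  show ?thesis
    by (rule integrable_const_bound[where B=B])
       (use B assms in \<open>auto simp: space_circle intro: continuous_on_circle_measurable\<close>)
qed

lemma integral_unif:
  fixes f :: "complex \<Rightarrow> 'b::{banach, second_countable_topology}"
  assumes "continuous_on (sphere 0 1) f"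
  shows "(\<integral>z. f z \<partial>unif) = (\<integral>\<theta>. f (cis \<theta>) \<partial>angle_measure)"
  unfolding unif_def
  by (rule integral_distr) (use assms in \<open>auto intro: continuous_on_circle_measurable\<close>)

text \<open>The rescaling to [0,1] matches the parametrisation of \<open>circlepath\<close>, so that
  Cauchy's formulas can be read as means over the circle.\<close>

lemma integral_angle:
  fixes f :: "real \<Rightarrow> complex"
  assumes "continuous_on UNIV f"
  shows "((\<lambda>x. f (2 * pi * x)) has_integral (\<integral>\<theta>. f \<theta> \<partial>angle_measure)) {0..1}"
proof -
  have [measurable]: "f \<in> borel_measurable borel" using assms by (rule borel_measurable_continuous_onI)
  have int: "set_integrable lborel {0..2*pi} f"
    by (intro borel_integrable_atLeastAtMost' continuous_on_subset[OF assms]) auto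
  have "angle_measure = density lborel (\<lambda>x. ennreal (indicator {0..2*pi} x / (2*pi)))"
    unfolding angle_measure_def uniform_measure_def
    by (intro density_cong) (auto simp: divide_ennreal[symmetric] ennreal_indicator indicator_def simp flip: divide_ennreal)
  then have "(\<integral>\<theta>. f \<theta> \<partial>angle_measure) = (\<integral>x. f x \<partial>density lborel (\<lambda>x. ennreal (indicator {0..2*pi} x / (2*pi))))"
    by simp
  also have "\<dots> = (\<integral>x. (indicator {0..2*pi} x / (2*pi)) *\<^sub>R f x \<partial>lborel)"
    by (rule integral_density) auto
  also have "\<dots> = (\<integral>x. (1/(2*pi)) *\<^sub>R (indicator {0..2*pi} x *\<^sub>R f x) \<partial>lborel)"
    by (intro Bochner_Integration.integral_cong) (auto simp: indicator_def)
  also have "\<dots> = (1/(2*pi)) *\<^sub>R (\<integral>x. indicator {0..2*pi} x *\<^sub>R f x \<partial>lborel)"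
    using int unfolding set_integrable_def by (intro integral_scaleR_right)
  finally have 1: "(\<integral>\<theta>. f \<theta> \<partial>angle_measure) = (1/(2*pi)) *\<^sub>R (LINT x:{0..2*pi}|lborel. f x)"
    by (simp add: set_lebesgue_integral_def)
  have "(f has_integral (LINT x:{0..2*pi}|lborel. f x)) {0..2*pi}"
    using int set_borel_integral_eq_integral[of "{0..2*pi}" f] by (simp add: has_integral_iff)
  then have "((\<lambda>x. f (2*pi*x)) has_integral (1 / \<bar>2*pi\<bar>) *\<^sub>R (LINT x:{0..2*pi}|lborel. f x))
      ((\<lambda>x. x / (2*pi)) ` {0..2*pi})"
    by (rule has_integral_stretch_real) auto
  moreover have "(\<lambda>x. x / (2*pi)) ` {0..2*pi} = {0..1}"
    using image_divide_atLeastAtMost[of "2*pi" 0 "2*pi"] by simp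
  ultimately show ?thesis using 1 by simp
qed

lemma unit_mult_cnj: "cmod z = 1 \<Longrightarrow> z * cnj z = 1"
  by (simp flip: complex_norm_square)

text \<open>Along the unit circle du = 2 pi i u dx, so the division by u cancels and the contour
  integral is 2 pi i times the mean.\<close>

lemma has_contour_integral_unit_circle:
  assumes "continuous_on (sphere 0 1) f"
    and "((\<lambda>u. f u / u) has_contour_integral (2 * pi * \<i> * c)) (circlepath 0 1)"
  shows "(\<integral>z. f z \<partial>unif) = c"
proof -
  have "continuous_on UNIV (\<lambda>\<theta>. f (cis \<theta>))"
    by (rule continuous_on_compose2[OF assms(1)]) (auto intro!: continuous_intros)
  then have 1: "((\<lambda>x. f (cis (2 * pi * x))) has_integral (\<integral>z. f z \<partial>unif)) {0..1}"
    using integral_angle integral_unif[OF assms(1)] by simp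
  have cp: "circlepath 0 1 x = cis (2 * pi * x)" for x
    by (simp add: circlepath cis_conv_exp mult_ac)
  have vd: "vector_derivative (circlepath 0 1) (at x within {0..1}) = 2 * pi * \<i> * cis (2 * pi * x)"
    if "x \<in> {0..1}" for x
    using that by (simp add: vector_derivative_circlepath01 cis_conv_exp mult_ac)
  have "((\<lambda>x. f (cis (2*pi*x)) / cis (2*pi*x) * vector_derivative (circlepath 0 1) (at x within {0..1}))
      has_integral (2 * pi * \<i> * c)) {0..1}"
    using assms(2) unfolding has_contour_integral_def cp .
  then have "((\<lambda>x. (2 * pi * \<i>) * f (cis (2 * pi * x))) has_integral (2 * pi * \<i>) * c) {0..1}"
    by (rule has_integral_eq[rotated]) (simp add: vd)
  then have "((\<lambda>x. f (cis (2 * pi * x))) has_integral c) {0..1}"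
    by (subst (asm) has_integral_mult_right_iff) auto
  with 1 show ?thesis by (rule has_integral_unique)
qed

text \<open>On the circle \<open>cnj u\<close> is 1/u, so the mean against \<open>cnj z ^ k\<close>
  is Cauchy's integral for the Taylor coefficient of order k.\<close>

lemma circle_mean_coeff:
  assumes f: "continuous_on (cball 0 1) f" "f holomorphic_on ball 0 1"
  shows "(\<integral>z. f z * cnj z ^ k \<partial>unif) = (deriv ^^ k) f 0 / fact k"
proof (rule has_contour_integral_unit_circle)
  show c: "continuous_on (sphere 0 1) (\<lambda>z. f z * cnj z ^ k)"
    by (intro continuous_intros continuous_on_subset[OF f(1)]) auto
  have "((\<lambda>u. f u / (u-0) ^ (Suc k)) has_contour_integral ((2 * pi * \<i>) / (fact k) * (deriv ^^ k) f 0)) (circlepath 0 1)"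
    by (rule Cauchy_has_contour_integral_higher_derivative_circlepath[OF f]) auto
  moreover have "f u / u ^ Suc k = f u * cnj u ^ k / u" if "u \<in> path_image (circlepath 0 1)" for u
  proof -
    have "cmod u = 1" using that by simp
    then have "u * cnj u = 1" "u \<noteq> 0" by (auto intro: unit_mult_cnj)
    then have "cnj u = 1 / u" by (simp add: field_simps)
    then show ?thesis by (simp add: field_simps)
  qed
  ultimately show "((\<lambda>u. f u * cnj u ^ k / u) has_contour_integral (2 * pi * \<i> * ((deriv ^^ k) f 0 / fact k))) (circlepath 0 1)"
    by (auto intro: has_contour_integral_eq)
qed

lemma circle_mean_value:
  assumes "continuous_on (cball 0 1) f" "f holomorphic_on ball 0 1"
  shows "(\<integral>z. f z \<partial>unif) = f 0"
  using circle_mean_coeff[OF assms, of 0] by simp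

section \<open>The Szego recursion\<close>

text \<open>The recursion is run for an arbitrary sequence \<open>a\<close>, because the same
  algebra serves the Verblunsky coefficients and a trial sequence with one altered entry. The
  reversed polynomial is carried along instead of being obtained by reversing coefficients; the link
  between the two is needed on the circle only.\<close>

primrec szego_pair :: "(nat \<Rightarrow> complex) \<Rightarrow> nat \<Rightarrow> complex poly \<times> complex poly" where
  "szego_pair a 0 = (1, 1)"
| "szego_pair a (Suc n) =
     (pCons 0 (fst (szego_pair a n)) - smult (cnj (a n)) (snd (szego_pair a n)),
      snd (szego_pair a n) - smult (a n) (pCons 0 (fst (szego_pair a n))))"

definition Phi :: "(nat \<Rightarrow> complex) \<Rightarrow> nat \<Rightarrow> complex poly" where
  "Phi a n = fst (szego_pair a n)"

text \<open>The reversed polynomials, usually written \<open>Phi_n^*\<close>; see \<open>Phis_circle\<close>.\<close>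
definition Phis :: "(nat \<Rightarrow> complex) \<Rightarrow> nat \<Rightarrow> complex poly" where
  "Phis a n = snd (szego_pair a n)"

lemma Phi_0 [simp]: "Phi a 0 = 1" and Phis_0 [simp]: "Phis a 0 = 1"
  by (simp_all add: Phi_def Phis_def)

lemma Phi_Suc: "Phi a (Suc n) = pCons 0 (Phi a n) - smult (cnj (a n)) (Phis a n)"
  and Phis_Suc: "Phis a (Suc n) = Phis a n - smult (a n) (pCons 0 (Phi a n))"
  by (simp_all add: Phi_def Phis_def)

lemma poly_Phi_Suc: "poly (Phi a (Suc n)) z = z * poly (Phi a n) z - cnj (a n) * poly (Phis a n) z"
  and poly_Phis_Suc: "poly (Phis a (Suc n)) z = poly (Phis a n) z - a n * (z * poly (Phi a n) z)"
  by (simp_all add: Phi_Suc Phis_Suc algebra_simps)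

lemma degree_Phis: "degree (Phis a n) \<le> n"
  and Phi_monic: "degree (Phi a n) = n \<and> lead_coeff (Phi a n) = 1"
proof (induction n)
  case (Suc n)
  have nz: "Phi a n \<noteq> 0" using Suc by auto
  have d: "degree (pCons 0 (Phi a n)) = Suc n" using Suc nz by simp
  have e: "degree (smult c (Phis a n)) < Suc n" for c
    using Suc degree_smult_le[of c "Phis a n"] by linarith
  { case 1
    have "degree (smult (a n) (pCons 0 (Phi a n))) \<le> Suc n" using d degree_smult_le by metis
    then show ?case unfolding Phis_Suc using Suc by (intro degree_diff_le) auto }
  { case 2
    have c: "coeff (Phi a n) n = 1" using Suc by metis
    have "degree (Phi a (Suc n)) = Suc n"
      unfolding Phi_Suc diff_conv_add_uminus using d e by (subst degree_add_eq_left) auto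
    moreover have "coeff (Phi a (Suc n)) (Suc n) = 1"
      using c e[of "cnj (a n)"] coeff_eq_0[of "smult (cnj (a n)) (Phis a n)" "Suc n"]
      by (auto simp: Phi_Suc)
    ultimately show ?case by simp }
qed auto

lemma degree_Phi [simp]: "degree (Phi a n) = n" and coeff_Phi [simp]: "coeff (Phi a n) n = 1"
  using Phi_monic[of a n] by auto

lemma Phi_nonzero [simp]: "Phi a n \<noteq> 0"
  using coeff_Phi[of a n] by (metis coeff_0 zero_neq_one)

lemma coeff_0_Phis: "coeff (Phis a n) 0 = 1"
  by (induction n) (auto simp: Phis_Suc)

lemma poly_Phis_0 [simp]: "poly (Phis a n) 0 = 1"
  by (simp add: poly_0_coeff_0 coeff_0_Phis)

lemma Phis_circle:
  assumes "cmod z = 1"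
  shows "poly (Phis a n) z = z ^ n * cnj (poly (Phi a n) z)"
    and "poly (Phi a n) z = z ^ n * cnj (poly (Phis a n) z)"
proof -
  have z: "z * cnj z = 1" using unit_mult_cnj assms by blast
  have "poly (Phis a n) z = z ^ n * cnj (poly (Phi a n) z) \<and> poly (Phi a n) z = z ^ n * cnj (poly (Phis a n) z)"
  proof (induction n)
    case (Suc n)
    define P Q where "P = poly (Phi a n) z" "Q = poly (Phis a n) z"
    have P: "P = z ^ n * cnj Q" and Q: "Q = z ^ n * cnj P" using Suc unfolding P_Q_def by blast+
    have zz: "z ^ Suc n * (cnj z * x) = z ^ n * x" for x
    proof -
      have "z ^ Suc n * (cnj z * x) = z ^ n * (z * cnj z) * x" by (simp add: mult_ac)
      then show ?thesis using z by simp
    qed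
    have "z ^ Suc n * cnj (z * P - cnj (a n) * Q) = z ^ Suc n * (cnj z * cnj P) - a n * (z * (z ^ n * cnj Q))"
      by (simp add: algebra_simps)
    also have "\<dots> = Q - a n * (z * P)" by (simp only: zz P[symmetric] Q[symmetric])
    finally have 1: "Q - a n * (z * P) = z ^ Suc n * cnj (z * P - cnj (a n) * Q)" by simp
    have "z ^ Suc n * cnj (Q - a n * (z * P)) = z * (z ^ n * cnj Q) - cnj (a n) * (z ^ Suc n * (cnj z * cnj P))"
      by (simp add: algebra_simps)
    also have "\<dots> = z * P - cnj (a n) * Q" by (simp only: zz P[symmetric] Q[symmetric])
    finally have 2: "z * P - cnj (a n) * Q = z ^ Suc n * cnj (Q - a n * (z * P))" by simp
    show ?case using 1 2 unfolding poly_Phi_Suc poly_Phis_Suc P_Q_def by blast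
  qed auto
  then show "poly (Phis a n) z = z ^ n * cnj (poly (Phi a n) z)"
    and "poly (Phi a n) z = z ^ n * cnj (poly (Phis a n) z)" by blast+
qed

text \<open>Reversal exchanges the moments k and n - k up to conjugation. Since this is pointwise on
  the circle, it applies to \<mu> as well as to the Bernstein-Szego weights.\<close>

lemma Phis_circle_shift:
  assumes z: "cmod z = 1" and "k \<le> n"
  shows "cnj (z ^ k) * poly (Phis a n) z = cnj (cnj (z ^ (n - k)) * poly (Phi a n) z)"
proof -
  have "z ^ n = z ^ k * z ^ (n - k)" using assms by (simp flip: power_add)
  moreover have "cnj z ^ k * (z ^ k * x) = x" for x
  proof -
    have "cnj z ^ k * (z ^ k * x) = (z * cnj z) ^ k * x" by (simp only: power_mult_distrib mult_ac)
    then show ?thesis using unit_mult_cnj[OF z] by simp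
  qed
  ultimately show ?thesis using Phis_circle(1)[OF z, of a n] by (simp add: mult.assoc)
qed

lemma cmod_Phis_circle: "cmod z = 1 \<Longrightarrow> cmod (poly (Phis a n) z) = cmod (poly (Phi a n) z)"
  by (subst Phis_circle(1)) (auto simp: norm_mult norm_power)

text \<open>One Szego step multiplies |Q|^2 - |P|^2 by 1 - |a|^2, where P = z Phi and Q is the
  reversed polynomial. So |P| <= |Q| persists, and Q - a P cannot vanish because |a P| <
  |Q|.\<close>

lemma Phis_nonzero_disc:
  assumes a: "\<And>n. cmod (a n) < 1" and z: "cmod z \<le> 1"
  shows "cmod (poly (Phi a n) z) \<le> cmod (poly (Phis a n) z) \<and> poly (Phis a n) z \<noteq> 0"
proof (induction n)
  case (Suc n)
  define P Q where "P = z * poly (Phi a n) z" "Q = poly (Phis a n) z"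
  have le: "cmod P \<le> cmod Q" and nz: "Q \<noteq> 0"
    using Suc z mult_mono[of "cmod z" 1 "cmod (poly (Phi a n) z)" "cmod (poly (Phis a n) z)"]
    by (auto simp: P_Q_def norm_mult)
  have "(cmod (Q - a n * P))\<^sup>2 - (cmod (P - cnj (a n) * Q))\<^sup>2
      = (1 - (cmod (a n))\<^sup>2) * ((cmod Q)\<^sup>2 - (cmod P)\<^sup>2)"
    unfolding cmod_power2 by (simp add: power2_eq_square) (simp add: algebra_simps)
  also have "\<dots> \<ge> 0" using a[of n] le by (intro mult_nonneg_nonneg) (auto simp: abs_square_le_1 less_imp_le)
  finally have "cmod (P - cnj (a n) * Q) \<le> cmod (Q - a n * P)"
    by (intro power2_le_imp_le[of "cmod (P - cnj (a n) * Q)"]) auto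
  moreover have "Q - a n * P \<noteq> 0"
  proof
    assume "Q - a n * P = 0"
    then have "cmod Q = cmod (a n) * cmod P" by (metis eq_iff_diff_eq_0 norm_mult)
    also have "\<dots> \<le> cmod (a n) * cmod Q" using le by (intro mult_left_mono) auto
    also have "\<dots> < 1 * cmod Q" using a[of n] nz by (intro mult_strict_right_mono) auto
    finally show False by simp
  qed
  ultimately show ?case by (simp add: poly_Phi_Suc poly_Phis_Suc flip: P_Q_def)
qed auto

section \<open>Orthogonal polynomials of a measure\<close>

locale circle_measure =
  fixes \<mu> :: "complex measure"
  assumes circle_prob: "circle_prob_measure \<mu>"
    and infinite_support: "infinite (measure_support \<mu>)"
begin

sublocale prob_space \<mu> using circle_prob by (simp add: circle_prob_measure_def)

lemma sets_mu [simp, measurable_cong]: "sets \<mu> = sets circle_borel"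
  using circle_prob by (simp add: circle_prob_measure_def)

lemma space_mu [simp]: "space \<mu> = sphere 0 1"
  by (rule space_circle) simp

lemma integrable_mu [intro]:
  fixes f :: "complex \<Rightarrow> 'b::{banach, second_countable_topology}"
  assumes "continuous_on (sphere 0 1) f"
  shows "integrable \<mu> f"
  by (rule integrable_circle) (use assms in \<open>auto simp: finite_measure_axioms\<close>)

text \<open>Infinite support enters here: a polynomial vanishing almost everywhere vanishes on the
  whole support, since the set where it is nonzero is open, and a nonzero polynomial has finitely
  many roots.\<close>

lemma poly_norm_zero:
  assumes "(\<integral>z. (cmod (poly p z))\<^sup>2 \<partial>\<mu>) = 0"
  shows "p = 0"
proof (rule ccontr)
  assume "p \<noteq> 0"
  have "integrable \<mu> (\<lambda>z. (cmod (poly p z))\<^sup>2)" by (intro integrable_mu continuous_intros)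
  then have "AE z in \<mu>. (cmod (poly p z))\<^sup>2 = 0"
    using assms by (subst (asm) integral_nonneg_eq_0_iff_AE) auto
  then have ae: "AE z in \<mu>. poly p z = 0" by simp
  have "measure_support \<mu> \<subseteq> {z. poly p z = 0}"
  proof
    fix z assume z: "z \<in> measure_support \<mu>"
    show "z \<in> {z. poly p z = 0}"
    proof (rule ccontr)
      assume nz: "z \<notin> {z. poly p z = 0}"
      define U where "U = {z. poly p z \<noteq> 0}"
      have "open U" unfolding U_def by (intro open_Collect_neq continuous_intros)
      then have pos: "emeasure \<mu> (U \<inter> space \<mu>) > 0" using z nz by (auto simp: measure_support_def U_def)
      have "U \<inter> space \<mu> \<in> sets \<mu>"
        using \<open>open U\<close> by (auto simp: sets_restrict_space Int_commute)
      moreover have "AE z in \<mu>. z \<notin> U \<inter> space \<mu>" using ae by (auto simp: U_def)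
      ultimately have "emeasure \<mu> (U \<inter> space \<mu>) = 0" by (subst (asm) AE_iff_measurable[OF _ refl]) (auto simp: Int_def conj_commute cong: conj_cong)
      with pos show False by simp
    qed
  qed
  then show False using infinite_support poly_roots_finite[OF \<open>p \<noteq> 0\<close>] finite_subset by blast
qed

lemma orthogonal_lower_degree:
  assumes p: "\<And>k. k < n \<Longrightarrow> (\<integral>z. cnj (z ^ k) * poly p z \<partial>\<mu>) = 0" and q: "degree q < n"
  shows "(\<integral>z. cnj (poly q z) * poly p z \<partial>\<mu>) = 0"
proof -
  have "(\<integral>z. cnj (poly q z) * poly p z \<partial>\<mu>)
      = (\<integral>z. (\<Sum>i\<le>degree q. cnj (coeff q i) * (cnj (z ^ i) * poly p z)) \<partial>\<mu>)"
    by (simp add: poly_altdef sum_distrib_right mult.assoc)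
  also have "\<dots> = (\<Sum>i\<le>degree q. cnj (coeff q i) * (\<integral>z. cnj (z ^ i) * poly p z \<partial>\<mu>))"
    by (subst Bochner_Integration.integral_sum) (auto intro!: integrable_mu continuous_intros)
  also have "\<dots> = 0" using p q by (intro sum.neutral) auto
  finally show ?thesis .
qed

lemma cnj_mult_self_integral:
  "(\<integral>z. cnj (poly p z) * poly p z \<partial>\<mu>) = of_real (\<integral>z. (cmod (poly p z))\<^sup>2 \<partial>\<mu>)"
  by (simp add: complex_norm_square mult.commute del: of_real_power flip: integral_complex_of_real)

text \<open>The difference of the two has degree below n, so it is orthogonal to itself.\<close>

lemma monic_orthogonal_unique:
  assumes "degree p = n" "lead_coeff p = 1" "\<And>k. k < n \<Longrightarrow> (\<integral>z. cnj (z ^ k) * poly p z \<partial>\<mu>) = 0"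
    and "degree q = n" "lead_coeff q = 1" "\<And>k. k < n \<Longrightarrow> (\<integral>z. cnj (z ^ k) * poly q z \<partial>\<mu>) = 0"
  shows "p = q"
proof (cases "n = 0")
  case True
  then show ?thesis using assms by (metis degree_0_id)
next
  case False
  have "degree (p - q) < n"
  proof -
    have "degree (p - q) \<le> n" using assms by (intro degree_diff_le) auto
    moreover have "coeff (p - q) n = 0" using assms by auto
    ultimately show ?thesis using False eq_zero_or_degree_less by fastforce
  qed
  moreover have "(\<integral>z. cnj (z ^ k) * poly (p - q) z \<partial>\<mu>) = 0" if "k < n" for k
    using assms(3,6)[OF that]
    by (simp add: right_diff_distrib) (subst Bochner_Integration.integral_diff; (intro integrable_mu continuous_intros)?; simp)
  ultimately have "(\<integral>z. cnj (poly (p - q) z) * poly (p - q) z \<partial>\<mu>) = 0"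
    by (rule orthogonal_lower_degree[rotated])
  then have "p - q = 0" unfolding cnj_mult_self_integral by (intro poly_norm_zero) simp
  then show ?thesis by simp
qed

definition alpha_seq :: "nat \<Rightarrow> complex" where "alpha_seq n = verblunsky \<mu> (int n)"

lemma monic_orthogonal_polyI:
  assumes "degree p = n" "lead_coeff p = 1" "\<And>k. k < n \<Longrightarrow> (\<integral>z. cnj (z ^ k) * poly p z \<partial>\<mu>) = 0"
  shows "monic_orthogonal_poly \<mu> n = p"
  unfolding monic_orthogonal_poly_def using assms
  by (intro the_equality) (auto intro!: monic_orthogonal_unique)

lemma Phis_orthogonal:
  assumes "\<And>k. k < n \<Longrightarrow> (\<integral>z. cnj (z ^ k) * poly (Phi a n) z \<partial>\<mu>) = 0"
  shows "1 \<le> k \<Longrightarrow> k \<le> n \<Longrightarrow> (\<integral>z. cnj (z ^ k) * poly (Phis a n) z \<partial>\<mu>) = 0"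
    and "(\<integral>z. poly (Phis a n) z \<partial>\<mu>) = of_real (\<integral>z. (cmod (poly (Phi a n) z))\<^sup>2 \<partial>\<mu>)"
proof -
  have star: "(\<integral>z. cnj (z ^ k) * poly (Phis a n) z \<partial>\<mu>) = cnj (\<integral>z. cnj (z ^ (n - k)) * poly (Phi a n) z \<partial>\<mu>)"
    if "k \<le> n" for k
    unfolding Bochner_Integration.integral_cnj[symmetric] using that
    by (intro Bochner_Integration.integral_cong refl Phis_circle_shift) auto
  show "1 \<le> k \<Longrightarrow> k \<le> n \<Longrightarrow> (\<integral>z. cnj (z ^ k) * poly (Phis a n) z \<partial>\<mu>) = 0"
    using star[of k] assms[of "n - k"] by simp
  \<comment> \<open>Since Phi_n - z^n has degree below n, the pairing of z^n with Phi_n is the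
    squared norm of Phi_n.\<close>
  have "(\<integral>z. cnj (poly (Phi a n - monom 1 n) z) * poly (Phi a n) z \<partial>\<mu>) = 0" (is "?I = 0")
  proof (cases "n = 0")
    case False
    have "degree (Phi a n - monom 1 n) \<le> n" by (intro degree_diff_le) (auto simp: degree_monom_eq)
    moreover have "coeff (Phi a n - monom 1 n) n = 0" by simp
    ultimately have "degree (Phi a n - monom 1 n) < n" using False eq_zero_or_degree_less by fastforce
    with assms show ?thesis by (rule orthogonal_lower_degree)
  qed simp
  moreover have "?I = (\<integral>z. cnj (poly (Phi a n) z) * poly (Phi a n) z \<partial>\<mu>) - (\<integral>z. cnj (z ^ n) * poly (Phi a n) z \<partial>\<mu>)"
    by (subst Bochner_Integration.integral_diff[symmetric])
       (auto intro!: integrable_mu continuous_intros simp: poly_monom algebra_simps)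
  ultimately have "(\<integral>z. cnj (z ^ n) * poly (Phi a n) z \<partial>\<mu>) = of_real (\<integral>z. (cmod (poly (Phi a n) z))\<^sup>2 \<partial>\<mu>)"
    by (simp add: cnj_mult_self_integral)
  then have "cnj (\<integral>z. cnj (z ^ n) * poly (Phi a n) z \<partial>\<mu>) = of_real (\<integral>z. (cmod (poly (Phi a n) z))\<^sup>2 \<partial>\<mu>)"
    by (simp only: complex_cnj_complex_of_real)
  then show "(\<integral>z. poly (Phis a n) z \<partial>\<mu>) = of_real (\<integral>z. (cmod (poly (Phi a n) z))\<^sup>2 \<partial>\<mu>)"
    using star[of 0] by simp
qed

text \<open>\<open>alpha_seq\<close> is defined through the orthogonal polynomials, not through the
  recursion, so it cannot simply be substituted. The recursion is continued with the coefficient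
  \<open>b\<close> that orthogonality demands; uniqueness identifies the result with the monic
  orthogonal polynomial, and its value at 0 shows that \<open>b\<close> was the Verblunsky
  coefficient.\<close>

lemma Phi_orthogonal:
  "k < n \<Longrightarrow> (\<integral>z. cnj (z ^ k) * poly (Phi alpha_seq n) z \<partial>\<mu>) = 0"
proof (induction n arbitrary: k)
  case (Suc n)
  define h where "h = (\<integral>z. (cmod (poly (Phi alpha_seq n) z))\<^sup>2 \<partial>\<mu>)"
  have h: "h \<noteq> 0" using poly_norm_zero[of "Phi alpha_seq n"] by (auto simp: h_def)
  \<comment> \<open>This value makes the moment k = 0 of the next polynomial vanish, as the mean of
    \<open>Phis\<close> is \<open>h\<close>. The moments 1, ..., n vanish for every choice of the
    coefficient.\<close>
  define b where "b = cnj ((\<integral>z. z * poly (Phi alpha_seq n) z \<partial>\<mu>) / of_real h)"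
  define a where "a = alpha_seq(n := b)"
  have "\<And>m. m \<le> n \<Longrightarrow> szego_pair a m = szego_pair alpha_seq m"
  proof -
    fix m show "m \<le> n \<Longrightarrow> szego_pair a m = szego_pair alpha_seq m"
      by (induction m) (auto simp: a_def)
  qed
  then have eq: "Phi a n = Phi alpha_seq n" "Phis a n = Phis alpha_seq n" by (auto simp: Phi_def Phis_def)
  have IH: "\<And>k. k < n \<Longrightarrow> (\<integral>z. cnj (z ^ k) * poly (Phi alpha_seq n) z \<partial>\<mu>) = 0" by fact
  have orth: "(\<integral>z. cnj (z ^ k) * poly (Phi a (Suc n)) z \<partial>\<mu>) = 0" if "k < Suc n" for k
  proof -
    have "(\<integral>z. cnj (z ^ k) * poly (Phi a (Suc n)) z \<partial>\<mu>)
       = (\<integral>z. cnj (z ^ k) * (z * poly (Phi alpha_seq n) z) - cnj b * (cnj (z ^ k) * poly (Phis alpha_seq n) z) \<partial>\<mu>)"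
      by (simp add: poly_Phi_Suc eq algebra_simps) (simp add: a_def)
    also have "\<dots> = (\<integral>z. cnj (z ^ k) * (z * poly (Phi alpha_seq n) z) \<partial>\<mu>) - cnj b * (\<integral>z. cnj (z ^ k) * poly (Phis alpha_seq n) z \<partial>\<mu>)"
      by (subst Bochner_Integration.integral_diff) (auto intro!: integrable_mu continuous_intros)
    also have "\<dots> = 0"
    proof (cases k)
      case 0
      then show ?thesis using h Phis_orthogonal(2)[OF IH] by (simp add: b_def h_def)
    next
      case (Suc j)
      have "(\<integral>z. cnj (z ^ k) * (z * poly (Phi alpha_seq n) z) \<partial>\<mu>) = (\<integral>z. cnj (z ^ j) * poly (Phi alpha_seq n) z \<partial>\<mu>)"
      proof (intro Bochner_Integration.integral_cong refl)
        fix z assume "z \<in> space \<mu>"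
        then have z: "z * cnj z = 1" by (intro unit_mult_cnj) simp
        have "cnj (z ^ k) * (z * poly (Phi alpha_seq n) z) = (z * cnj z) * (cnj (z ^ j) * poly (Phi alpha_seq n) z)"
          by (simp add: Suc)
        then show "cnj (z ^ k) * (z * poly (Phi alpha_seq n) z) = cnj (z ^ j) * poly (Phi alpha_seq n) z"
          by (simp only: z mult_1_left)
      qed
      then show ?thesis using IH[of j] Phis_orthogonal(1)[OF IH, of k] that Suc by simp
    qed
    finally show ?thesis .
  qed
  \<comment> \<open>At 0 the recursion leaves only \<open>- cnj b\<close>, because
    \<open>Phis\<close> takes the value 1 there.\<close>
  have "monic_orthogonal_poly \<mu> (Suc n) = Phi a (Suc n)"
    using orth by (intro monic_orthogonal_polyI) auto
  then have "alpha_seq n = b"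
    by (simp add: alpha_seq_def verblunsky_def poly_Phi_Suc eq) (simp add: a_def)
  then have "a = alpha_seq" by (auto simp: a_def)
  then show ?case using orth Suc.prems by simp
qed simp

definition Phi_norm :: "nat \<Rightarrow> real" where "Phi_norm n = (\<integral>z. (cmod (poly (Phi alpha_seq n) z))\<^sup>2 \<partial>\<mu>)"

lemma Phi_norm_pos: "Phi_norm n > 0"
proof -
  have "Phi_norm n \<ge> 0" unfolding Phi_norm_def by simp
  moreover have "Phi_norm n \<noteq> 0" using poly_norm_zero[of "Phi alpha_seq n"] by (auto simp: Phi_norm_def)
  ultimately show ?thesis by simp
qed

lemma Phi_norm_Phis: "Phi_norm n = (\<integral>z. (cmod (poly (Phis alpha_seq n) z))\<^sup>2 \<partial>\<mu>)"
  unfolding Phi_norm_def by (intro Bochner_Integration.integral_cong refl) (simp add: cmod_Phis_circle)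

text \<open>Pythagoras for z Phi_n = Phi_{n+1} + cnj(alpha_n) Phis_n: the second summand has degree
  at most n, hence is orthogonal to Phi_{n+1}, and \<open>Phis\<close> has the norm of
  \<open>Phi\<close>.\<close>

lemma Phi_norm_Suc: "Phi_norm (Suc n) = (1 - (cmod (alpha_seq n))\<^sup>2) * Phi_norm n"
proof -
  let ?P = "\<lambda>z. poly (Phi alpha_seq (Suc n)) z" and ?Q = "\<lambda>z. poly (Phis alpha_seq n) z"
  have "(\<integral>z. cnj (?Q z) * ?P z \<partial>\<mu>) = 0"
    by (rule orthogonal_lower_degree[OF Phi_orthogonal]) (use degree_Phis[of alpha_seq n] in auto)
  then have 0: "(\<integral>z. Re (cnj (alpha_seq n) * (cnj (?P z) * ?Q z)) \<partial>\<mu>) = 0"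
  proof -
    assume "(\<integral>z. cnj (?Q z) * ?P z \<partial>\<mu>) = 0"
    then have "(\<integral>z. cnj (cnj (?Q z) * ?P z) \<partial>\<mu>) = 0" by (simp only: Bochner_Integration.integral_cnj complex_cnj_zero)
    then have "(\<integral>z. cnj (?P z) * ?Q z \<partial>\<mu>) = 0" by (simp add: mult.commute)
    moreover have "(\<integral>z. Re (cnj (alpha_seq n) * (cnj (?P z) * ?Q z)) \<partial>\<mu>) = Re (\<integral>z. cnj (alpha_seq n) * (cnj (?P z) * ?Q z) \<partial>\<mu>)"
      by (rule integral_Re) (intro integrable_mu continuous_intros)
    ultimately show ?thesis by simp
  qed
  have sq: "(cmod (p + cnj a * q))\<^sup>2 = (cmod p)\<^sup>2 + (cmod a)\<^sup>2 * (cmod q)\<^sup>2 + 2 * Re (cnj a * (cnj p * q))" for p q a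
    unfolding cmod_power2 by (simp add: power2_eq_square) (simp add: algebra_simps)
  have "Phi_norm n = (\<integral>z. (cmod (?P z))\<^sup>2 + (cmod (alpha_seq n))\<^sup>2 * (cmod (?Q z))\<^sup>2 + 2 * Re (cnj (alpha_seq n) * (cnj (?P z) * ?Q z)) \<partial>\<mu>)"
    unfolding Phi_norm_def
  proof (intro Bochner_Integration.integral_cong refl)
    fix z assume "z \<in> space \<mu>"
    then have "cmod (poly (Phi alpha_seq n) z) = cmod (z * poly (Phi alpha_seq n) z)" by (simp add: norm_mult)
    also have "\<dots> = cmod (?P z + cnj (alpha_seq n) * ?Q z)" by (simp add: poly_Phi_Suc)
    finally show "(cmod (poly (Phi alpha_seq n) z))\<^sup>2 = (cmod (?P z))\<^sup>2 + (cmod (alpha_seq n))\<^sup>2 * (cmod (?Q z))\<^sup>2 + 2 * Re (cnj (alpha_seq n) * (cnj (?P z) * ?Q z))"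
      by (simp only: sq)
  qed
  also have "\<dots> = Phi_norm (Suc n) + (cmod (alpha_seq n))\<^sup>2 * Phi_norm n"
    unfolding Phi_norm_def[of "Suc n"] Phi_norm_Phis[of n]
    by (subst Bochner_Integration.integral_add; (intro integrable_mu continuous_intros)?)
       (subst Bochner_Integration.integral_add; (intro integrable_mu continuous_intros)?; simp only: integral_mult_right_zero 0 mult_zero_right add_0_right)
  finally show ?thesis by (simp add: algebra_simps)
qed

lemma alpha_seq_less_1: "cmod (alpha_seq n) < 1"
proof -
  have "(1 - (cmod (alpha_seq n))\<^sup>2) * Phi_norm n > 0" using Phi_norm_pos[of "Suc n"] Phi_norm_Suc by simp
  then have "1 - (cmod (alpha_seq n))\<^sup>2 > 0" using Phi_norm_pos[of n] by (simp add: zero_less_mult_iff)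
  then show ?thesis using abs_square_less_1[of "cmod (alpha_seq n)"] by simp
qed

lemma Phi_norm_eq: "Phi_norm n = (\<Prod>j<n. 1 - (cmod (alpha_seq j))\<^sup>2)"
  by (induction n) (auto simp: Phi_norm_Suc Phi_norm_def[of 0] prob_space[unfolded space_mu])

lemma Phi_norm_antimono: "Phi_norm (Suc n) \<le> Phi_norm n"
  using Phi_norm_pos[of n] by (simp add: Phi_norm_Suc algebra_simps)

text \<open>Two recursion steps give z^2 Phi_n = Phi_{n+2} + cnj(alpha_{n+1}) Phis_{n+1} +
  cnj(alpha_n) z Phis_n. The first summand is orthogonal to Phi_n, and the other two are bounded by
  norms that do not exceed that of Phi_n.\<close>

lemma second_moment_bound:
  "- Re (\<integral>z. z\<^sup>2 * of_real ((cmod (poly (Phi alpha_seq n) z))\<^sup>2) \<partial>\<mu>) \<le> (cmod (alpha_seq n) + cmod (alpha_seq (Suc n))) * Phi_norm n"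
proof -
  let ?P = "\<lambda>z. poly (Phi alpha_seq n) z" and ?Q = "\<lambda>z. poly (Phis alpha_seq n) z" and ?R = "\<lambda>z. poly (Phis alpha_seq (Suc n)) z"
  have int: "integrable \<mu> (\<lambda>z. cnj (?P z) * ?R z)" "integrable \<mu> (\<lambda>z. cnj (?P z) * (z * ?Q z))"
    "integrable \<mu> (\<lambda>z. cnj (?P z) * poly (Phi alpha_seq (Suc (Suc n))) z)"
    by (intro integrable_mu continuous_intros)+
  have "z\<^sup>2 * of_real ((cmod (?P z))\<^sup>2) = cnj (?P z) * poly (Phi alpha_seq (Suc (Suc n))) z
       + cnj (alpha_seq (Suc n)) * (cnj (?P z) * ?R z) + cnj (alpha_seq n) * (cnj (?P z) * (z * ?Q z))" for z
    unfolding complex_norm_square poly_Phi_Suc by (simp add: algebra_simps power2_eq_square)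
  then have "(\<integral>z. z\<^sup>2 * of_real ((cmod (poly (Phi alpha_seq n) z))\<^sup>2) \<partial>\<mu>)
     = (\<integral>z. cnj (?P z) * poly (Phi alpha_seq (Suc (Suc n))) z \<partial>\<mu>)
      + cnj (alpha_seq (Suc n)) * (\<integral>z. cnj (?P z) * ?R z \<partial>\<mu>) + cnj (alpha_seq n) * (\<integral>z. cnj (?P z) * (z * ?Q z) \<partial>\<mu>)"
    using int by simp
  also have "(\<integral>z. cnj (?P z) * poly (Phi alpha_seq (Suc (Suc n))) z \<partial>\<mu>) = 0"
    by (rule orthogonal_lower_degree[OF Phi_orthogonal]) auto
  finally have eq: "(\<integral>z. z\<^sup>2 * of_real ((cmod (poly (Phi alpha_seq n) z))\<^sup>2) \<partial>\<mu>) =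
      cnj (alpha_seq (Suc n)) * (\<integral>z. cnj (?P z) * ?R z \<partial>\<mu>) + cnj (alpha_seq n) * (\<integral>z. cnj (?P z) * (z * ?Q z) \<partial>\<mu>)"
    by simp
  have AG: "x * y \<le> (x\<^sup>2 + y\<^sup>2) / 2" for x y :: real
    using sum_squares_bound[of x y] by (simp add: mult.assoc)
  have 1: "cmod (\<integral>z. cnj (?P z) * ?R z \<partial>\<mu>) \<le> Phi_norm n"
  proof -
    have "cmod (\<integral>z. cnj (?P z) * ?R z \<partial>\<mu>) \<le> (\<integral>z. cmod (cnj (?P z) * ?R z) \<partial>\<mu>)"
      by (rule integral_norm_bound)
    \<comment> \<open>The inequality of arithmetic and geometric means replaces Cauchy-Schwarz; it
      suffices because the squared norms decrease with n.\<close>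
    also have "\<dots> \<le> (\<integral>z. ((cmod (?P z))\<^sup>2 + (cmod (?R z))\<^sup>2) / 2 \<partial>\<mu>)"
    proof (rule integral_mono)
      show "integrable \<mu> (\<lambda>z. cmod (cnj (?P z) * ?R z))" using int(1) by (rule integrable_norm)
      show "integrable \<mu> (\<lambda>z. ((cmod (?P z))\<^sup>2 + (cmod (?R z))\<^sup>2) / 2)"
        by (intro integrable_mu continuous_intros) auto
      show "cmod (cnj (?P z) * ?R z) \<le> ((cmod (?P z))\<^sup>2 + (cmod (?R z))\<^sup>2) / 2" for z
        unfolding norm_mult complex_mod_cnj by (rule AG)
    qed
    also have "\<dots> = (Phi_norm n + Phi_norm (Suc n)) / 2"
      unfolding Phi_norm_def[of n] Phi_norm_Phis[of "Suc n"]
      by (simp, subst Bochner_Integration.integral_add) (auto intro!: integrable_mu continuous_intros)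
    also have "\<dots> \<le> Phi_norm n" using Phi_norm_antimono[of n] by simp
    finally show ?thesis .
  qed
  have 2: "cmod (\<integral>z. cnj (?P z) * (z * ?Q z) \<partial>\<mu>) \<le> Phi_norm n"
  proof -
    have "cmod (\<integral>z. cnj (?P z) * (z * ?Q z) \<partial>\<mu>) \<le> (\<integral>z. cmod (cnj (?P z) * (z * ?Q z)) \<partial>\<mu>)"
      by (rule integral_norm_bound)
    also have "\<dots> = Phi_norm n" unfolding Phi_norm_def
      by (intro Bochner_Integration.integral_cong refl) (auto simp: norm_mult cmod_Phis_circle power2_eq_square)
    finally show ?thesis .
  qed
  have "- Re (\<integral>z. z\<^sup>2 * of_real ((cmod (poly (Phi alpha_seq n) z))\<^sup>2) \<partial>\<mu>) \<le> cmod (\<integral>z. z\<^sup>2 * of_real ((cmod (poly (Phi alpha_seq n) z))\<^sup>2) \<partial>\<mu>)"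
    by (rule order_trans[OF abs_ge_minus_self abs_Re_le_cmod])
  also have "\<dots> \<le> cmod (alpha_seq (Suc n)) * Phi_norm n + cmod (alpha_seq n) * Phi_norm n"
    unfolding eq by (rule norm_triangle_le, simp only: norm_mult complex_mod_cnj)
      (intro add_mono mult_left_mono 1 2 norm_ge_zero)
  finally show ?thesis by (simp add: algebra_simps)
qed

end

section \<open>Bernstein--Szego weights\<close>

interpretation unif: prob_space unif
  using circle_prob_measure_unif by (simp add: circle_prob_measure_def)

lemma sets_unif [simp, measurable_cong]: "sets unif = sets circle_borel"
  by (simp add: unif_def)

lemma space_unif [simp]: "space unif = sphere 0 1"
  by (rule space_circle) simp

lemma integrable_unif:
  fixes f :: "complex \<Rightarrow> 'b::{banach, second_countable_topology}"
  shows "continuous_on (sphere 0 1) f \<Longrightarrow> integrable unif f"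
  by (rule integrable_circle) (auto simp: unif.finite_measure_axioms)

locale szego =
  fixes a :: "nat \<Rightarrow> complex"
  assumes a_less_1: "cmod (a n) < 1"
begin

definition norm_prod :: "nat \<Rightarrow> real" where "norm_prod n = (\<Prod>j<n. 1 - (cmod (a j))\<^sup>2)"

text \<open>On the circle \<open>Phi\<close> and \<open>Phis\<close> have the same modulus. The
  reversed polynomial is the useful one: it has no zeros in the closed disc, so its inverse and its
  logarithm are holomorphic inside.\<close>

definition bs_weight :: "nat \<Rightarrow> complex \<Rightarrow> real" where
  "bs_weight N z = norm_prod N / (cmod (poly (Phis a N) z))\<^sup>2"

lemma one_minus_pos: "1 - (cmod (a n))\<^sup>2 > 0"
  using a_less_1[of n] abs_square_less_1[of "cmod (a n)"] by simp

lemma norm_prod_pos: "norm_prod n > 0"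
  unfolding norm_prod_def by (intro prod_pos) (use one_minus_pos in auto)

lemma Phis_nz: "cmod z \<le> 1 \<Longrightarrow> poly (Phis a n) z \<noteq> 0"
  using Phis_nonzero_disc[of a z n] a_less_1 by blast

lemma bs_weight_pos: "cmod z \<le> 1 \<Longrightarrow> bs_weight N z > 0"
  unfolding bs_weight_def using norm_prod_pos Phis_nz by simp

lemma continuous_bs_weight [continuous_intros]: "continuous_on (sphere 0 1) (bs_weight N)"
  unfolding bs_weight_def by (intro continuous_intros) (auto simp: Phis_nz)

text \<open>On the circle the integrand reduces to a constant times z^(N-k) / Phis_N, which is
  holomorphic in the disc, so the mean value property evaluates it at 0.\<close>

lemma Phi_bs_weight_moment:
  assumes "k \<le> N"
  shows "(\<integral>z. cnj (z ^ k) * poly (Phi a N) z * of_real (bs_weight N z) \<partial>unif) = (if k = N then of_real (norm_prod N) else 0)"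
proof -
  define f where "f z = of_real (norm_prod N) * z ^ (N - k) / poly (Phis a N) z" for z
  have "(\<integral>z. cnj (z ^ k) * poly (Phi a N) z * of_real (bs_weight N z) \<partial>unif) = (\<integral>z. f z \<partial>unif)"
  proof (intro Bochner_Integration.integral_cong refl)
    fix z assume "z \<in> space unif"
    then have z: "cmod z = 1" by simp
    have nz: "poly (Phis a N) z \<noteq> 0" using z by (intro Phis_nz) simp
    have "cnj (z ^ k) * poly (Phi a N) z = cnj (cnj (z ^ (N - k)) * poly (Phis a N) z)"
      using Phis_circle_shift[OF z, of "N - k" N a] assms by simp
    then have 1: "cnj (z ^ k) * poly (Phi a N) z = z ^ (N - k) * cnj (poly (Phis a N) z)" by simp
    have "complex_of_real (bs_weight N z) = of_real (norm_prod N) / (poly (Phis a N) z * cnj (poly (Phis a N) z))"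
      by (simp only: bs_weight_def of_real_divide complex_norm_square)
    with nz show "cnj (z ^ k) * poly (Phi a N) z * of_real (bs_weight N z) = f z"
      unfolding 1 f_def by (simp add: field_simps)
  qed
  also have "\<dots> = f 0"
  proof (rule circle_mean_value)
    show "continuous_on (cball 0 1) f" unfolding f_def by (intro continuous_intros) (auto simp: Phis_nz)
    show "f holomorphic_on ball 0 1" unfolding f_def by (intro holomorphic_intros) (auto simp: Phis_nz)
  qed
  also have "f 0 = (if k = N then of_real (norm_prod N) else 0)" using assms by (simp add: f_def)
  finally show ?thesis .
qed

lemma bs_weight_star:
  assumes "k \<le> n"
  shows "(\<integral>z. cnj (z ^ k) * poly (Phis a n) z * of_real (bs_weight N z) \<partial>unif)
       = cnj (\<integral>z. cnj (z ^ (n - k)) * poly (Phi a n) z * of_real (bs_weight N z) \<partial>unif)"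
  unfolding Bochner_Integration.integral_cnj[symmetric]
proof (intro Bochner_Integration.integral_cong refl)
  fix z assume "z \<in> space unif"
  then have "cnj (z ^ k) * poly (Phis a n) z = cnj (cnj (z ^ (n - k)) * poly (Phi a n) z)"
    using assms by (intro Phis_circle_shift) simp_all
  then show "cnj (z ^ k) * poly (Phis a n) z * of_real (bs_weight N z)
      = cnj (cnj (z ^ (n - k)) * poly (Phi a n) z * of_real (bs_weight N z))"
    by (simp only: complex_cnj_mult[of _ "of_real _"] complex_cnj_complex_of_real)
qed

lemma szego_inverse:
  "of_real (1 - (cmod (a n))\<^sup>2) * (z * poly (Phi a n) z) = poly (Phi a (Suc n)) z + cnj (a n) * poly (Phis a (Suc n)) z"
  "of_real (1 - (cmod (a n))\<^sup>2) * poly (Phis a n) z = poly (Phis a (Suc n)) z + a n * poly (Phi a (Suc n)) z"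
  unfolding of_real_diff complex_norm_square of_real_1 poly_Phi_Suc poly_Phis_Suc by (simp_all add: algebra_simps)

text \<open>Downward induction from n = N: the Szego step is inverted by
  \<open>szego_inverse\<close>, and orthogonality descends to the lower polynomials. At n = 0 the
  second conjunct says that the weight has total mass 1.\<close>

lemma bs_weight_orthogonal:
  assumes "n \<le> N"
  shows "(\<forall>k<n. (\<integral>z. cnj (z ^ k) * poly (Phi a n) z * of_real (bs_weight N z) \<partial>unif) = 0)
       \<and> (\<integral>z. poly (Phis a n) z * of_real (bs_weight N z) \<partial>unif) = of_real (norm_prod n)"
  using assms
proof (induction rule: inc_induct)
  case base
  then show ?case using Phi_bs_weight_moment[of _ N] bs_weight_star[of 0 N N] by simp
next
  case (step n)
  define c where "c = complex_of_real (1 - (cmod (a n))\<^sup>2)"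
  have c: "c \<noteq> 0" using one_minus_pos[of n] unfolding c_def of_real_eq_0_iff by linarith
  define I where "I f = (\<integral>z. f z * of_real (bs_weight N z) \<partial>unif)" for f :: "complex \<Rightarrow> complex"
  have I_add: "I (\<lambda>z. f z + b * g z) = I f + b * I g"
    if "continuous_on (sphere 0 1) f" "continuous_on (sphere 0 1) g" for f g b
  proof -
    have "integrable unif (\<lambda>z. f z * of_real (bs_weight N z))" "integrable unif (\<lambda>z. g z * of_real (bs_weight N z))"
      by (intro integrable_unif continuous_intros that)+
    then show ?thesis unfolding I_def by (simp add: distrib_right mult.assoc)
  qed
  have I_mult: "I (\<lambda>z. b * g z) = b * I g" for g b
    unfolding I_def by (simp add: mult.assoc)
  have I_cong: "I f = I g" if "\<And>z. cmod z = 1 \<Longrightarrow> f z = g z" for f g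
    unfolding I_def by (intro Bochner_Integration.integral_cong refl) (use that in simp)
  have IH: "\<And>k. k < Suc n \<Longrightarrow> I (\<lambda>z. cnj (z ^ k) * poly (Phi a (Suc n)) z) = 0"
    "I (\<lambda>z. poly (Phis a (Suc n)) z) = of_real (norm_prod (Suc n))"
    using step.IH by (simp_all add: I_def)
  have "c * I (\<lambda>z. cnj (z ^ k) * poly (Phi a n) z) = 0" if k: "k < n" for k
  proof -
    have "c * I (\<lambda>z. cnj (z ^ k) * poly (Phi a n) z) = I (\<lambda>z. c * (cnj (z ^ k) * poly (Phi a n) z))"
      by (simp only: I_mult)
    also have "\<dots> = I (\<lambda>z. cnj (z ^ Suc k) * poly (Phi a (Suc n)) z + cnj (a n) * (cnj (z ^ Suc k) * poly (Phis a (Suc n)) z))"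
    proof (rule I_cong)
      fix z :: complex assume "cmod z = 1"
      then have z: "z * cnj z = 1" by (rule unit_mult_cnj)
      have "c * (cnj (z ^ k) * poly (Phi a n) z) = (z * cnj z) * (c * (cnj (z ^ k) * poly (Phi a n) z))"
        by (simp only: z mult_1_left)
      also have "\<dots> = cnj (z ^ Suc k) * (c * (z * poly (Phi a n) z))" by (simp add: mult_ac)
      also have "\<dots> = cnj (z ^ Suc k) * poly (Phi a (Suc n)) z + cnj (a n) * (cnj (z ^ Suc k) * poly (Phis a (Suc n)) z)"
        unfolding c_def szego_inverse by (simp add: algebra_simps)
      finally show "c * (cnj (z ^ k) * poly (Phi a n) z) = \<dots>" .
    qed
    also have "\<dots> = I (\<lambda>z. cnj (z ^ Suc k) * poly (Phi a (Suc n)) z) + cnj (a n) * I (\<lambda>z. cnj (z ^ Suc k) * poly (Phis a (Suc n)) z)"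
      by (rule I_add) (intro continuous_intros)+
    also have "I (\<lambda>z. cnj (z ^ Suc k) * poly (Phi a (Suc n)) z) = 0" using k by (intro IH) simp
    also have "I (\<lambda>z. cnj (z ^ Suc k) * poly (Phis a (Suc n)) z) = cnj (I (\<lambda>z. cnj (z ^ (Suc n - Suc k)) * poly (Phi a (Suc n)) z))"
      unfolding I_def by (rule bs_weight_star) (use k in simp)
    also have "I (\<lambda>z. cnj (z ^ (Suc n - Suc k)) * poly (Phi a (Suc n)) z) = 0" using k by (intro IH) simp
    finally show ?thesis by simp
  qed
  then have 1: "\<And>k. k < n \<Longrightarrow> I (\<lambda>z. cnj (z ^ k) * poly (Phi a n) z) = 0" using c by simp
  have "c * I (\<lambda>z. poly (Phis a n) z) = I (\<lambda>z. c * poly (Phis a n) z)"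
    by (simp only: I_mult)
  also have "\<dots> = I (\<lambda>z. poly (Phis a (Suc n)) z + a n * poly (Phi a (Suc n)) z)"
    unfolding c_def szego_inverse ..
  also have "\<dots> = I (\<lambda>z. poly (Phis a (Suc n)) z) + a n * I (\<lambda>z. poly (Phi a (Suc n)) z)"
    by (rule I_add) (intro continuous_intros)+
  also have "\<dots> = of_real (norm_prod (Suc n))" using IH(1)[of 0] IH(2) by simp
  also have "\<dots> = c * of_real (norm_prod n)" by (simp add: norm_prod_def c_def)
  finally have "I (\<lambda>z. poly (Phis a n) z) = of_real (norm_prod n)" using c by simp
  with 1 show ?case by (simp add: I_def)
qed

text \<open>The branch is taken on a disc of radius r > 1, which provides continuity up to the unit
  circle. Its second derivative at 0 is that of log p for a polynomial p with p(0) = 1, computed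
  from L' = p'/p.\<close>

lemma log_Phis:
  obtains L where "continuous_on (cball 0 1) L" "L holomorphic_on ball 0 1" "L 0 = 0"
    "\<And>z. cmod z \<le> 1 \<Longrightarrow> exp (L z) = poly (Phis a N) z"
    "(deriv ^^ 2) L 0 = 2 * coeff (Phis a N) 2 - (coeff (Phis a N) 1)\<^sup>2"
proof -
  let ?p = "Phis a N"
  have nz: "?p \<noteq> 0" using coeff_0_Phis[of a N] by auto
  define R where "R = {z. poly ?p z = 0}"
  have fin: "finite R" unfolding R_def by (rule poly_roots_finite[OF nz])
  \<comment> \<open>The element 2 keeps the minimum defined when there are no roots; any number
    above 1 would do.\<close>
  define r where "r = Min (insert 2 (cmod ` R))"
  have r1: "r > 1" unfolding r_def using fin Phis_nz[of _ N] by (subst Min_gr_iff) (auto simp: R_def not_le[symmetric])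
  have rnz: "poly ?p z \<noteq> 0" if "z \<in> ball 0 r" for z
  proof
    assume "poly ?p z = 0"
    then have "r \<le> cmod z" unfolding r_def using fin by (intro Min_le) (auto simp: R_def)
    with that show False by simp
  qed
  obtain L0 where L0: "L0 holomorphic_on ball 0 r" "\<And>z. z \<in> ball 0 r \<Longrightarrow> exp (L0 z) = poly ?p z"
    by (rule holomorphic_logarithm_exists[of "ball 0 r" "poly ?p" 0]) (use r1 rnz in \<open>auto intro!: holomorphic_intros\<close>)
  define L where "L z = L0 z - L0 0" for z
  have L: "L holomorphic_on ball 0 r" unfolding L_def by (intro holomorphic_intros L0)
  have expL: "exp (L z) = poly ?p z" if "z \<in> ball 0 r" for z
    using that L0(2)[of z] L0(2)[of 0] r1 by (simp add: L_def exp_diff)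
  have dL: "deriv L z = poly (pderiv ?p) z / poly ?p z" if z: "z \<in> ball 0 r" for z
  proof -
    have "(L has_field_derivative deriv L z) (at z)" using L z by (simp add: holomorphic_derivI)
    then have "((\<lambda>z. exp (L z)) has_field_derivative exp (L z) * deriv L z) (at z)"
      by (auto intro!: derivative_eq_intros)
    moreover have "((\<lambda>z. exp (L z)) has_field_derivative poly (pderiv ?p) z) (at z)"
      by (rule has_field_derivative_transform_within_open[OF poly_DERIV, where S="ball 0 r"]) (use z expL in auto)
    ultimately have "exp (L z) * deriv L z = poly (pderiv ?p) z" by (rule DERIV_unique)
    then show ?thesis using expL[OF z] rnz[OF z] by (simp add: field_simps)
  qed
  have c1: "poly (pderiv ?p) 0 = coeff ?p 1" and c2: "poly (pderiv (pderiv ?p)) 0 = 2 * coeff ?p 2"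
    by (simp_all add: poly_0_coeff_0 coeff_pderiv numeral_2_eq_2)
  have "((\<lambda>z. poly (pderiv ?p) z / poly ?p z) has_field_derivative 2 * coeff ?p 2 - (coeff ?p 1)\<^sup>2) (at 0)"
    by (rule derivative_eq_intros poly_DERIV refl)+ (auto simp: c1 c2 power2_eq_square)
  then have "(deriv L has_field_derivative 2 * coeff ?p 2 - (coeff ?p 1)\<^sup>2) (at 0)"
    by (rule has_field_derivative_transform_within_open[where S="ball 0 r"]) (use r1 dL in auto)
  then have "deriv (deriv L) 0 = 2 * coeff ?p 2 - (coeff ?p 1)\<^sup>2" by (rule DERIV_imp_deriv)
  then have "(deriv ^^ 2) L 0 = 2 * coeff ?p 2 - (coeff ?p 1)\<^sup>2" by (simp add: numeral_2_eq_2)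
  moreover have "L holomorphic_on ball 0 1"
    by (rule holomorphic_on_subset[OF L]) (use r1 in \<open>auto intro: subset_ball\<close>)
  moreover have "continuous_on (cball 0 1) L"
    by (rule continuous_on_subset[OF holomorphic_on_imp_continuous_on[OF L]]) (use r1 in auto)
  moreover have "L 0 = 0" by (simp add: L_def)
  ultimately show thesis using expL r1 by (intro that) auto
qed

text \<open>If \<open>c1, c2\<close> are the Taylor coefficients of \<open>Phis a N\<close>, then \<open>c2 - c1^2 / 2\<close> is that of order 2
  of its logarithm.\<close>
definition bs_entropy :: "nat \<Rightarrow> real" where
  "bs_entropy N = (\<Sum>j<N. ln (1 - (cmod (a j))\<^sup>2)) / 2 + Re (coeff (Phis a N) 2 - (coeff (Phis a N) 1)\<^sup>2 / 2) / 2"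

text \<open>With L the logarithm of \<open>Phis\<close>, the integrand is (1 - Re z^2) / 2 times l -
  2 Re L. Expanding the product, L and z^2 L have mean 0 because L(0) = 0, and only the conjugate
  square picks out a coefficient of L, that of order 2.\<close>

lemma integral_log_bs_weight: "(\<integral>z. (1 - (Re z)\<^sup>2) * ln (bs_weight N z) \<partial>unif) = bs_entropy N"
proof -
  obtain L where L: "continuous_on (cball 0 1) L" "L holomorphic_on ball 0 1" "L 0 = 0"
    "\<And>z. cmod z \<le> 1 \<Longrightarrow> exp (L z) = poly (Phis a N) z"
    "(deriv ^^ 2) L 0 = 2 * coeff (Phis a N) 2 - (coeff (Phis a N) 1)\<^sup>2"
    by (rule log_Phis[of N]) (rule that)
  have cL [continuous_intros]: "continuous_on (sphere 0 1) L" by (rule continuous_on_subset[OF L(1)]) auto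
  define l where "l = ln (norm_prod N)"
  have "(\<integral>z. (1 - (Re z)\<^sup>2) * ln (bs_weight N z) \<partial>unif)
     = (\<integral>z. Re (of_real (l / 2) - of_real (l / 2) * z\<^sup>2 - L z + z\<^sup>2 * L z / 2 + L z * cnj z ^ 2 / 2) \<partial>unif)"
  proof (intro Bochner_Integration.integral_cong refl)
    fix z assume "z \<in> space unif"
    then have z: "cmod z = 1" by simp
    have "cmod (poly (Phis a N) z) = exp (Re (L z))" using L(4)[of z] z by (metis norm_exp_eq_Re order_refl)
    then have "ln (bs_weight N z) = l - 2 * Re (L z)"
      using norm_prod_pos[of N] by (auto simp: bs_weight_def ln_div l_def ln_realpow)
    moreover have "(Im z)\<^sup>2 = 1 - (Re z)\<^sup>2" using z cmod_power2[of z] by simp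
    ultimately show "(1 - (Re z)\<^sup>2) * ln (bs_weight N z)
      = Re (of_real (l / 2) - of_real (l / 2) * z\<^sup>2 - L z + z\<^sup>2 * L z / 2 + L z * cnj z ^ 2 / 2)"
      by (simp add: power2_eq_square) (simp add: field_simps)
  qed
  also have "\<dots> = Re (\<integral>z. of_real (l / 2) - of_real (l / 2) * z\<^sup>2 - L z + z\<^sup>2 * L z / 2 + L z * cnj z ^ 2 / 2 \<partial>unif)"
    by (rule integral_Re) (intro integrable_unif continuous_intros, auto)
  also have "(\<integral>z. of_real (l / 2) - of_real (l / 2) * z\<^sup>2 - L z + z\<^sup>2 * L z / 2 + L z * cnj z ^ 2 / 2 \<partial>unif)
    = of_real (l / 2) - of_real (l / 2) * (\<integral>z. z\<^sup>2 \<partial>unif) - (\<integral>z. L z \<partial>unif) + (\<integral>z. z\<^sup>2 * L z \<partial>unif) / 2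
      + (\<integral>z. L z * cnj z ^ 2 \<partial>unif) / 2"
  proof -
    have "integrable unif (\<lambda>z. z\<^sup>2 :: complex)" "integrable unif L" "integrable unif (\<lambda>z. z\<^sup>2 * L z)"
      "integrable unif (\<lambda>z. L z * cnj z ^ 2)"
      by (intro integrable_unif continuous_intros)+
    then show ?thesis by (simp add: unif.prob_space[unfolded space_unif])
  qed
  also have "(\<integral>z. z\<^sup>2 \<partial>unif) = 0"
    by (subst circle_mean_value) (auto intro!: continuous_intros holomorphic_intros)
  also have "(\<integral>z. L z \<partial>unif) = 0"
    by (subst circle_mean_value) (auto simp: L)
  also have "(\<integral>z. z\<^sup>2 * L z \<partial>unif) = 0"
    by (subst circle_mean_value) (auto intro!: continuous_intros holomorphic_intros simp: L)
  also have "(\<integral>z. L z * cnj z ^ 2 \<partial>unif) = (2 * coeff (Phis a N) 2 - (coeff (Phis a N) 1)\<^sup>2) / 2"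
    by (subst circle_mean_coeff) (auto simp: L)
  also have "l = (\<Sum>j<N. ln (1 - (cmod (a j))\<^sup>2))"
  proof -
    have "1 - (cmod (a j))\<^sup>2 \<noteq> 0" for j using one_minus_pos[of j] by linarith
    then show ?thesis unfolding l_def norm_prod_def by (subst ln_prod) auto
  qed
  finally show ?thesis by (simp add: bs_entropy_def)
qed

end

section \<open>Moments of the measure and of its Bernstein-Szego weights\<close>

lemma moments_from_recursion:
  fixes c d :: "nat \<Rightarrow> complex"
  assumes "c 0 = d 0"
    and "\<And>n. 1 \<le> n \<Longrightarrow> n \<le> N \<Longrightarrow> (\<Sum>i\<le>n. coeff (Phi a n) i * c i) = 0"
    and "\<And>n. 1 \<le> n \<Longrightarrow> n \<le> N \<Longrightarrow> (\<Sum>i\<le>n. coeff (Phi a n) i * d i) = 0"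
  shows "n \<le> N \<Longrightarrow> c n = d n"
proof (induction n rule: less_induct)
  case (less n)
  show ?case
  proof (cases "n = 0")
    case False
    \<comment> \<open>The polynomial of degree n is monic, so its vanishing mean expresses the n-th
      moment through the lower ones.\<close>
    have *: "(\<Sum>i\<le>n. coeff (Phi a n) i * x i) = (\<Sum>i<n. coeff (Phi a n) i * x i) + x n" for x
      by (subst lessThan_Suc_atMost[symmetric]) simp
    have "(\<Sum>i<n. coeff (Phi a n) i * c i) = (\<Sum>i<n. coeff (Phi a n) i * d i)"
      using less by (intro sum.cong) auto
    then have "x n = - (\<Sum>i<n. coeff (Phi a n) i * d i)" if "x = c \<or> x = d" for x
      using assms(2,3)[of n] less.prems False that unfolding * by (auto simp: add_eq_0_iff)
    then show ?thesis by metis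
  qed (use assms(1) in simp)
qed

context circle_measure
begin

sublocale szego alpha_seq by unfold_locales (rule alpha_seq_less_1)

lemma Phi_norm_eq_norm_prod: "Phi_norm n = norm_prod n"
  by (simp add: Phi_norm_eq norm_prod_def)

text \<open>Both moment sequences solve the same triangular system, obtained by pairing the
  polynomials of degrees 1, ..., N with the constant 1, and both start with total mass 1.\<close>

lemma moment_eq:
  assumes "n \<le> N"
  shows "(\<integral>z. z ^ n * of_real (bs_weight N z) \<partial>unif) = (\<integral>z. z ^ n \<partial>\<mu>)"
proof (rule moments_from_recursion[of _ _ N alpha_seq, OF _ _ _ assms])
  show "(\<integral>z. z ^ 0 * of_real (bs_weight N z) \<partial>unif) = (\<integral>z. z ^ 0 \<partial>\<mu>)"
    using bs_weight_orthogonal[of 0 N] by (simp add: norm_prod_def prob_space[unfolded space_mu])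
next
  fix n :: nat assume n: "1 \<le> n" "n \<le> N"
  have "(\<Sum>i\<le>n. coeff (Phi alpha_seq n) i * (\<integral>z. z ^ i * of_real (bs_weight N z) \<partial>unif))
    = (\<integral>z. (\<Sum>i\<le>n. coeff (Phi alpha_seq n) i * (z ^ i * of_real (bs_weight N z))) \<partial>unif)"
    by (subst Bochner_Integration.integral_sum) (auto intro!: integrable_unif continuous_intros)
  also have "\<dots> = (\<integral>z. poly (Phi alpha_seq n) z * of_real (bs_weight N z) \<partial>unif)"
    by (simp add: poly_altdef sum_distrib_right mult.assoc)
  also have "\<dots> = 0" using bs_weight_orthogonal[OF n(2)] n by (auto dest: spec[of _ 0])
  finally show "(\<Sum>i\<le>n. coeff (Phi alpha_seq n) i * (\<integral>z. z ^ i * of_real (bs_weight N z) \<partial>unif)) = 0" .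
  have "(\<Sum>i\<le>n. coeff (Phi alpha_seq n) i * (\<integral>z. z ^ i \<partial>\<mu>)) = (\<integral>z. (\<Sum>i\<le>n. coeff (Phi alpha_seq n) i * z ^ i) \<partial>\<mu>)"
    by (subst Bochner_Integration.integral_sum) (auto intro!: integrable_mu continuous_intros)
  also have "\<dots> = (\<integral>z. poly (Phi alpha_seq n) z \<partial>\<mu>)"
    by (simp add: poly_altdef)
  also have "\<dots> = 0" using Phi_orthogonal[of 0 n] n by simp
  finally show "(\<Sum>i\<le>n. coeff (Phi alpha_seq n) i * (\<integral>z. z ^ i \<partial>\<mu>)) = 0" .
qed

lemma mixed_moment_eq:
  assumes "i \<le> N" "m \<le> N"
  shows "(\<integral>z. z ^ i * cnj z ^ m * of_real (bs_weight N z) \<partial>unif) = (\<integral>z. z ^ i * cnj z ^ m \<partial>\<mu>)"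
proof -
  have can: "z ^ i * cnj z ^ m = (if m \<le> i then z ^ (i - m) else cnj (z ^ (m - i)))" if "cmod z = 1" for z
  proof -
    have z: "z ^ k * cnj z ^ k = 1" for k using unit_mult_cnj[OF that] by (simp flip: power_mult_distrib)
    show ?thesis
    proof (cases "m \<le> i")
      case True
      have "z ^ i * cnj z ^ m = z ^ (i - m) * (z ^ m * cnj z ^ m)" using True by (simp flip: power_add mult.assoc)
      then show ?thesis using True z by simp
    next
      case False
      have "z ^ i * cnj z ^ m = (z ^ i * cnj z ^ i) * cnj z ^ (m - i)" using False by (simp flip: power_add add: mult.assoc)
      then show ?thesis using False z by simp
    qed
  qed
  show ?thesis
  proof (cases "m \<le> i")
    case True
    then have "(\<integral>z. z ^ i * cnj z ^ m * of_real (bs_weight N z) \<partial>unif) = (\<integral>z. z ^ (i - m) * of_real (bs_weight N z) \<partial>unif)"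
      by (intro Bochner_Integration.integral_cong) (auto simp: can)
    also have "\<dots> = (\<integral>z. z ^ (i - m) \<partial>\<mu>)" using assms by (intro moment_eq) simp
    also have "\<dots> = (\<integral>z. z ^ i * cnj z ^ m \<partial>\<mu>)"
      using True by (intro Bochner_Integration.integral_cong) (auto simp: can)
    finally show ?thesis .
  next
    case False
    then have "(\<integral>z. z ^ i * cnj z ^ m * of_real (bs_weight N z) \<partial>unif) = (\<integral>z. cnj (z ^ (m - i) * of_real (bs_weight N z)) \<partial>unif)"
      by (intro Bochner_Integration.integral_cong) (auto simp: can)
    also have "\<dots> = cnj (\<integral>z. z ^ (m - i) * of_real (bs_weight N z) \<partial>unif)" by (rule Bochner_Integration.integral_cnj)
    also have "(\<integral>z. z ^ (m - i) * of_real (bs_weight N z) \<partial>unif) = (\<integral>z. z ^ (m - i) \<partial>\<mu>)"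
      using assms by (intro moment_eq) simp
    also have "cnj \<dots> = (\<integral>z. cnj (z ^ (m - i)) \<partial>\<mu>)" by (rule Bochner_Integration.integral_cnj[symmetric])
    also have "\<dots> = (\<integral>z. z ^ i * cnj z ^ m \<partial>\<mu>)"
      using False by (intro Bochner_Integration.integral_cong) (auto simp: can)
    finally show ?thesis .
  qed
qed

lemma laurent_eq:
  assumes "degree p \<le> N" "m \<le> N"
  shows "(\<integral>z. poly p z * cnj z ^ m * of_real (bs_weight N z) \<partial>unif) = (\<integral>z. poly p z * cnj z ^ m \<partial>\<mu>)"
proof -
  have "(\<integral>z. poly p z * cnj z ^ m * of_real (bs_weight N z) \<partial>unif)
    = (\<integral>z. (\<Sum>i\<le>degree p. coeff p i * (z ^ i * cnj z ^ m * of_real (bs_weight N z))) \<partial>unif)"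
    by (simp add: poly_altdef sum_distrib_right mult.assoc)
  also have "\<dots> = (\<Sum>i\<le>degree p. coeff p i * (\<integral>z. z ^ i * cnj z ^ m * of_real (bs_weight N z) \<partial>unif))"
    by (subst Bochner_Integration.integral_sum) (auto intro!: integrable_unif continuous_intros)
  also have "\<dots> = (\<Sum>i\<le>degree p. coeff p i * (\<integral>z. z ^ i * cnj z ^ m \<partial>\<mu>))"
    using assms by (intro sum.cong refl) (simp add: mixed_moment_eq)
  also have "\<dots> = (\<integral>z. (\<Sum>i\<le>degree p. coeff p i * (z ^ i * cnj z ^ m)) \<partial>\<mu>)"
    by (subst Bochner_Integration.integral_sum) (auto intro!: integrable_mu continuous_intros)
  also have "\<dots> = (\<integral>z. poly p z * cnj z ^ m \<partial>\<mu>)"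
    by (simp add: poly_altdef sum_distrib_right mult.assoc)
  finally show ?thesis .
qed

end

section \<open>The entropy of the weights as a partial sum in the coefficients\<close>

context szego
begin

definition alpha :: "int \<Rightarrow> complex" where "alpha n = (if n < 0 then -1 else a (nat n))"

lemma alpha_of_nat [simp]: "alpha (int n) = a n" and alpha_m1 [simp]: "alpha (-1) = -1"
  by (simp_all add: alpha_def)

text \<open>The part of the j-th summand of the sum rule that involves only the coefficients with
  indices j and j - 1. The remaining part, \<open>diff_term\<close>, also needs index j + 1 and is
  kept apart because it enters the partial sums one step later.\<close>

definition local_term :: "nat \<Rightarrow> real" where
  "local_term j = (ln (1 - (cmod (a j))\<^sup>2) + (cmod (a j))\<^sup>2 + 1 / 2 * cmod (a j) ^ 4) / 2
     - (cmod (a j * alpha (int j - 1)))\<^sup>2 / 2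
     - ((2 * (cmod (a j))\<^sup>2 - (cmod (a j - alpha (int j - 1)))\<^sup>2)\<^sup>2
        + (2 * (cmod (alpha (int j - 1)))\<^sup>2 - (cmod (a j - alpha (int j - 1)))\<^sup>2)\<^sup>2) / 16"

definition diff_term :: "nat \<Rightarrow> real" where
  "diff_term j = (1 - (cmod (a j))\<^sup>2) * (cmod (a (Suc j) - alpha (int j - 1)))\<^sup>2"

text \<open>The telescoping remainder: the step of \<open>bs_entropy\<close> differs from the
  summands of the sum rule by an increment of this expression.\<close>

definition boundary_term :: "nat \<Rightarrow> real" where
  "boundary_term j = - ((cmod (a j))\<^sup>2 + (cmod (alpha (int j - 1)))\<^sup>2) / 4
     + (cmod (a j))\<^sup>2 * (cmod (alpha (int j - 1)))\<^sup>2 / 4 - cmod (a j) ^ 4 / 8"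

lemma coeff_Phi_0: "coeff (Phi a n) 0 = - cnj (alpha (int n - 1))"
  by (cases n) (auto simp: Phi_Suc coeff_0_Phis)

lemma coeff_Phi_1_Suc: "coeff (Phi a (Suc n)) 1 = - cnj (alpha (int n - 1)) - cnj (a n) * coeff (Phis a n) 1"
  by (simp add: Phi_Suc coeff_Phi_0)

lemma coeff_Phis_1_Suc: "coeff (Phis a (Suc n)) 1 = coeff (Phis a n) 1 + a n * cnj (alpha (int n - 1))"
  by (simp add: Phis_Suc coeff_Phi_0)

lemma coeff_Phis_2_Suc: "coeff (Phis a (Suc n)) 2 = coeff (Phis a n) 2 - a n * coeff (Phi a n) 1"
  by (simp add: Phis_Suc coeff_pCons numeral_2_eq_2)

text \<open>The Taylor coefficients of \<open>Phis\<close> depend on the whole history, but it drops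
  out: the product of \<open>c\<close> with x cnj y produced by the order-2 coefficient cancels the
  cross term of the square of the order-1 coefficient. Three consecutive coefficients
  remain.\<close>

lemma bs_entropy_step:
  "bs_entropy (Suc (Suc n)) - bs_entropy (Suc n) = ln (1 - (cmod (a (Suc n)))\<^sup>2) / 2
    + Re (of_real (1 - (cmod (a n))\<^sup>2) * (a (Suc n) * cnj (alpha (int n - 1))) - (a (Suc n) * cnj (a n))\<^sup>2 / 2) / 2"
proof -
  define x y u c c2 where "x = a (Suc n)" "y = a n" "u = alpha (int n - 1)" "c = coeff (Phis a n) 1"
    "c2 = coeff (Phis a (Suc n)) 2"
  have 1: "coeff (Phis a (Suc n)) 1 = c + y * cnj u"
    and 2: "coeff (Phis a (Suc (Suc n))) 1 = c + y * cnj u + x * cnj y"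
    and 3: "coeff (Phis a (Suc (Suc n))) 2 = c2 - x * (- cnj u - cnj y * c)"
    unfolding coeff_Phis_1_Suc coeff_Phis_2_Suc coeff_Phi_1_Suc x_y_u_c_c2_def by simp_all
  have "(c2 - x * (- cnj u - cnj y * c) - (c + y * cnj u + x * cnj y)\<^sup>2 / 2) - (c2 - (c + y * cnj u)\<^sup>2 / 2)
    = of_real (1 - (cmod y)\<^sup>2) * (x * cnj u) - (x * cnj y)\<^sup>2 / 2"
    unfolding of_real_diff complex_norm_square by (simp add: field_simps power2_eq_square)
  then have "Re ((c2 - x * (- cnj u - cnj y * c) - (c + y * cnj u + x * cnj y)\<^sup>2 / 2)) - Re (c2 - (c + y * cnj u)\<^sup>2 / 2)
    = Re (of_real (1 - (cmod y)\<^sup>2) * (x * cnj u) - (x * cnj y)\<^sup>2 / 2)"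
    by (metis minus_complex.sel(1))
  moreover have "bs_entropy (Suc (Suc n)) = ((\<Sum>j<Suc n. ln (1 - (cmod (a j))\<^sup>2)) + ln (1 - (cmod x)\<^sup>2)) / 2
      + Re (c2 - x * (- cnj u - cnj y * c) - (c + y * cnj u + x * cnj y)\<^sup>2 / 2) / 2"
    unfolding bs_entropy_def 2 3 sum.lessThan_Suc[of _ "Suc n"] x_y_u_c_c2_def(1) ..
  moreover have "bs_entropy (Suc n) = (\<Sum>j<Suc n. ln (1 - (cmod (a j))\<^sup>2)) / 2 + Re (c2 - (c + y * cnj u)\<^sup>2 / 2) / 2"
    unfolding bs_entropy_def 1 x_y_u_c_c2_def(5) ..
  ultimately show ?thesis
    unfolding x_y_u_c_c2_def(1-3) add_divide_distrib by linarith
qed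

lemma cmod_power4: "cmod w ^ 4 = ((cmod w)\<^sup>2)\<^sup>2" by simp

lemma bs_entropy_eq: "bs_entropy (Suc n) = 3 / 8 + (\<Sum>j<Suc n. local_term j) - (\<Sum>j<n. diff_term j) / 4 + boundary_term n"
proof (induction n)
  \<comment> \<open>Origin of 3/8: as the coefficient of index -1 is -1, the quartic part
    contributes the constant -1/8 and the boundary term -1/4, and these have to be
    compensated.\<close>
  case 0
  define x where "x = a 0"
  have [simp]: "coeff (Phis a 1) 2 = 0" "coeff (Phis a (Suc 0)) 2 = 0" using degree_Phis[of a 1] by (auto intro!: coeff_eq_0)
  have "coeff (Phis a 1) 1 = - x" by (simp add: Phis_Suc x_def)
  then show ?case
    by (simp add: bs_entropy_def local_term_def boundary_term_def flip: x_def)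
       (simp only: cmod_power4 cmod_power2, simp add: power2_eq_square field_simps)
next
  case (Suc n)
  define x y u where "x = a (Suc n)" "y = a n" "u = alpha (int n - 1)"
  have "bs_entropy (Suc (Suc n)) = bs_entropy (Suc n) + ln (1 - (cmod x)\<^sup>2) / 2
    + Re (of_real (1 - (cmod y)\<^sup>2) * (x * cnj u) - (x * cnj y)\<^sup>2 / 2) / 2"
    using bs_entropy_step[of n] by (simp add: x_y_u_def)
  moreover have "local_term (Suc n) = (ln (1 - (cmod x)\<^sup>2) + (cmod x)\<^sup>2 + 1 / 2 * cmod x ^ 4) / 2
     - (cmod (x * y))\<^sup>2 / 2 - ((2 * (cmod x)\<^sup>2 - (cmod (x - y))\<^sup>2)\<^sup>2 + (2 * (cmod y)\<^sup>2 - (cmod (x - y))\<^sup>2)\<^sup>2) / 16"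
    by (simp add: local_term_def x_y_u_def)
  moreover have "diff_term n = (1 - (cmod y)\<^sup>2) * (cmod (x - u))\<^sup>2" by (simp add: diff_term_def x_y_u_def)
  moreover have "boundary_term (Suc n) = - ((cmod x)\<^sup>2 + (cmod y)\<^sup>2) / 4 + (cmod x)\<^sup>2 * (cmod y)\<^sup>2 / 4 - cmod x ^ 4 / 8"
    by (simp add: boundary_term_def x_y_u_def)
  moreover have "boundary_term n = - ((cmod y)\<^sup>2 + (cmod u)\<^sup>2) / 4 + (cmod y)\<^sup>2 * (cmod u)\<^sup>2 / 4 - cmod y ^ 4 / 8"
    by (simp add: boundary_term_def x_y_u_def)
  \<comment> \<open>The logarithms have been matched already; what remains is a polynomial identity
    in the real and imaginary parts of x, y, u.\<close>
  moreover have "Re (of_real (1 - (cmod y)\<^sup>2) * (x * cnj u) - (x * cnj y)\<^sup>2 / 2) / 2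
    = ((cmod x)\<^sup>2 + 1 / 2 * cmod x ^ 4) / 2
     - (cmod (x * y))\<^sup>2 / 2 - ((2 * (cmod x)\<^sup>2 - (cmod (x - y))\<^sup>2)\<^sup>2 + (2 * (cmod y)\<^sup>2 - (cmod (x - y))\<^sup>2)\<^sup>2) / 16
     - (1 - (cmod y)\<^sup>2) * (cmod (x - u))\<^sup>2 / 4
     + (- ((cmod x)\<^sup>2 + (cmod y)\<^sup>2) / 4 + (cmod x)\<^sup>2 * (cmod y)\<^sup>2 / 4 - cmod x ^ 4 / 8)
     - (- ((cmod y)\<^sup>2 + (cmod u)\<^sup>2) / 4 + (cmod y)\<^sup>2 * (cmod u)\<^sup>2 / 4 - cmod y ^ 4 / 8)"
    unfolding cmod_power4 norm_mult power_mult_distrib cmod_power2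
    by (simp add: power2_eq_square) (simp add: field_simps)
  ultimately show ?case using Suc by (simp add: add_divide_distrib diff_divide_distrib)
qed

end

section \<open>Approximation of bounded measurable functions\<close>

text \<open>The sum counts the levels (k+1)/n that x reaches, so the quotient is x rounded down to a
  multiple of 1/n.\<close>

lemma staircase_approx:
  fixes x :: real
  assumes "0 \<le> x" "x \<le> 1" "n > 0"
  shows "\<bar>x - (\<Sum>k<n. of_bool (real k + 1 \<le> n * x)) / n\<bar> \<le> 1 / n"
proof -
  define m where "m = nat \<lfloor>n * x\<rfloor>"
  have "{k \<in> {..<n}. real k + 1 \<le> n * x} = {..<m}"
  proof -
    have "n * x \<le> n" using assms mult_left_le[of x "real n"] by simp
    then have "m \<le> n" unfolding m_def using assms by linarith
    have iff: "real k + 1 \<le> n * x \<longleftrightarrow> k < m" for k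
    proof -
      have "k < m \<longleftrightarrow> int k + 1 \<le> \<lfloor>n * x\<rfloor>" unfolding m_def by linarith
      also have "\<dots> \<longleftrightarrow> real_of_int (int k + 1) \<le> n * x" by (rule le_floor_iff)
      finally show ?thesis by simp
    qed
    show ?thesis unfolding iff using \<open>m \<le> n\<close> by auto
  qed
  then have eq: "(\<Sum>k<n. of_bool (real k + 1 \<le> n * x)) = real m"
    by (simp add: of_bool_def sum.If_cases Int_def)
  have "0 \<le> n * x" using assms by simp
  then have "real m \<le> n * x" "n * x \<le> real m + 1" unfolding m_def by linarith+
  then have "\<bar>n * x - m\<bar> / n \<le> 1 / n" by (intro divide_right_mono) auto
  moreover have "x - m / n = (n * x - m) / n" using assms by (simp add: field_simps)
  ultimately show ?thesis unfolding eq by simp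
qed

text \<open>One function has to serve two measures, later \<mu> and arc length. Regularity gives
  each measure a compact set inside A and an open set around A; Urysohn's lemma is applied to the
  union of the compact sets and the intersection of the open ones.\<close>

lemma continuous_approx_indicator:
  fixes M1 M2 :: "'a::euclidean_space measure"
  assumes M1: "finite_measure M1" "sets M1 = sets borel" and M2: "finite_measure M2" "sets M2 = sets borel"
    and A: "A \<in> sets borel" and e: "e > 0"
  obtains f :: "'a \<Rightarrow> real" where "continuous_on UNIV f" "\<And>x. 0 \<le> f x" "\<And>x. f x \<le> 1"
    "(\<integral>x. \<bar>indicator A x - f x\<bar> \<partial>M1) \<le> e" "(\<integral>x. \<bar>indicator A x - f x\<bar> \<partial>M2) \<le> e"
proof -
  have reg: "\<exists>K U. compact K \<and> K \<subseteq> A \<and> open U \<and> A \<subseteq> U \<and> measure M A < measure M K + e / 2 \<and> measure M U < measure M A + e / 2"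
    if M: "finite_measure M" "sets M = sets borel" for M :: "'a measure"
  proof -
    interpret finite_measure M by fact
    have ne: "emeasure M (space M) \<noteq> \<infinity>" by simp
    have "\<exists>K. compact K \<and> K \<subseteq> A \<and> measure M A < measure M K + e / 2"
    proof (rule ccontr)
      assume *: "\<not> ?thesis"
      have le: "measure M K \<le> measure M A - e / 2" if "compact K" "K \<subseteq> A" for K
      proof -
        have "\<not> measure M A < measure M K + e / 2" using * that by blast
        then show ?thesis by simp
      qed
      have "(SUP K \<in> {K. K \<subseteq> A \<and> compact K}. emeasure M K) \<le> ennreal (measure M A - e / 2)"
        by (intro SUP_least) (auto simp: emeasure_eq_measure intro!: ennreal_leI le)
      then have "emeasure M A \<le> ennreal (measure M A - e / 2)"
        using inner_regular[OF M(2) ne A] by simp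
      moreover have "0 \<le> measure M A - e / 2" using le[of "{}"] by simp
      ultimately have "measure M A \<le> measure M A - e / 2" by (simp add: emeasure_eq_measure)
      with e show False by simp
    qed
    moreover have "\<exists>U. open U \<and> A \<subseteq> U \<and> measure M U < measure M A + e / 2"
    proof (rule ccontr)
      assume *: "\<not> ?thesis"
      have le: "measure M A + e / 2 \<le> measure M U" if "open U" "A \<subseteq> U" for U
      proof -
        have "\<not> measure M U < measure M A + e / 2" using * that by blast
        then show ?thesis by simp
      qed
      have "ennreal (measure M A + e / 2) \<le> (INF U \<in> {U. A \<subseteq> U \<and> open U}. emeasure M U)"
        by (intro INF_greatest) (auto simp: emeasure_eq_measure intro!: ennreal_leI le)
      then have "ennreal (measure M A + e / 2) \<le> emeasure M A"
        using outer_regular[OF M(2) ne A] by simp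
      then have "measure M A + e / 2 \<le> measure M A" by (simp add: emeasure_eq_measure)
      with e show False by simp
    qed
    ultimately show ?thesis by blast
  qed
  obtain K1 U1 where 1: "compact K1" "K1 \<subseteq> A" "open U1" "A \<subseteq> U1" "measure M1 A < measure M1 K1 + e / 2" "measure M1 U1 < measure M1 A + e / 2"
    using reg[OF M1] by blast
  obtain K2 U2 where 2: "compact K2" "K2 \<subseteq> A" "open U2" "A \<subseteq> U2" "measure M2 A < measure M2 K2 + e / 2" "measure M2 U2 < measure M2 A + e / 2"
    using reg[OF M2] by blast
  define K U where "K = K1 \<union> K2" "U = U1 \<inter> U2"
  have KU: "closed K" "open U" "K \<subseteq> A" "A \<subseteq> U" using 1 2 by (auto simp: K_U_def compact_imp_closed)
  obtain f :: "'a \<Rightarrow> real" where f: "continuous_on UNIV f" "\<And>x. f x \<in> closed_segment 1 0"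
    "\<And>x. x \<in> K \<Longrightarrow> f x = 1" "\<And>x. x \<in> - U \<Longrightarrow> f x = 0"
    by (rule Urysohn[of K "- U" "1::real" 0]) (use KU in auto)
  have f01: "0 \<le> f x" "f x \<le> 1" for x using f(2)[of x] by (auto simp: closed_segment_eq_real_ivl)
  have bnd: "(\<integral>x. \<bar>indicator A x - f x\<bar> \<partial>M) \<le> e"
    if M: "finite_measure M" "sets M = sets borel" "compact K'" "K' \<subseteq> K" "open U'" "U \<subseteq> U'"
      "measure M A < measure M K' + e / 2" "measure M U' < measure M A + e / 2" for M K' U'
  proof -
    interpret finite_measure M by fact
    have [measurable]: "f \<in> borel_measurable M" "A \<in> sets M" "U' \<in> sets M" "K' \<in> sets M"
      using f(1) A M by (auto simp: M(2) compact_imp_closed intro!: borel_measurable_continuous_onI cong: measurable_cong_sets)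
    have "(\<integral>x. \<bar>indicator A x - f x\<bar> \<partial>M) \<le> (\<integral>x. indicator (U' - K') x \<partial>M)"
    proof (rule integral_mono)
      show "integrable M (\<lambda>x. \<bar>indicator A x - f x\<bar>)"
      proof (rule integrable_const_bound[of _ 1])
        have "\<bar>indicator A x - f x\<bar> \<le> 1" for x using f01[of x] by (simp add: indicator_def abs_le_iff)
        then show "AE x in M. norm \<bar>indicator A x - f x\<bar> \<le> 1" by simp
      qed auto
      show "integrable M (indicat_real (U' - K'))"
        by (rule integrable_real_indicator) (auto simp: less_top[symmetric])
      show "\<bar>indicator A x - f x\<bar> \<le> indicator (U' - K') x" for x
        using f(3,4)[of x] f01[of x] KU M(4,6) by (auto simp: indicator_def)
    qed
    also have "\<dots> = measure M U' - measure M K'"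
    proof -
      have "space M = UNIV" using sets_eq_imp_space_eq[OF M(2)] by simp
      moreover have "measure M (U' - K') = measure M U' - measure M K'"
        using M KU by (intro finite_measure_Diff) auto
      ultimately show ?thesis by simp
    qed
    also have "\<dots> \<le> e" using M(7,8) by simp
    finally show ?thesis .
  qed
  show thesis
  proof (rule that[OF f(1) f01])
    show "(\<integral>x. \<bar>indicator A x - f x\<bar> \<partial>M1) \<le> e" by (rule bnd[OF M1 1(1) _ 1(3) _ 1(5,6)]) (auto simp: K_U_def)
    show "(\<integral>x. \<bar>indicator A x - f x\<bar> \<partial>M2) \<le> e" by (rule bnd[OF M2 2(1) _ 2(3) _ 2(5,6)]) (auto simp: K_U_def)
  qed
qed

text \<open>f is cut into n superlevel sets whose indicators are approximated separately and
  averaged. Preserving the range between \<open>lo\<close> and \<open>hi\<close> matters: a positive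
  lower bound is what later controls logarithms.\<close>

lemma continuous_approx_bounded:
  fixes M1 M2 :: "'a::euclidean_space measure" and f :: "'a \<Rightarrow> real"
  assumes M1: "finite_measure M1" "sets M1 = sets borel" and M2: "finite_measure M2" "sets M2 = sets borel"
    and f: "f \<in> borel_measurable borel" "\<And>x. lo \<le> f x" "\<And>x. f x \<le> hi" and lohi: "lo < hi" and e: "e > 0"
  obtains h :: "'a \<Rightarrow> real" where "continuous_on UNIV h" "\<And>x. lo \<le> h x" "\<And>x. h x \<le> hi"
    "(\<integral>x. \<bar>f x - h x\<bar> \<partial>M1) \<le> e" "(\<integral>x. \<bar>f x - h x\<bar> \<partial>M2) \<le> e"
proof -
  define C where "C = measure M1 (space M1) + measure M2 (space M2)"
  have C: "C \<ge> 0" by (simp add: C_def)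
  define d where "d = hi - lo"
  have d: "d > 0" using lohi by (simp add: d_def)
  \<comment> \<open>The staircase error d/n, integrated over total mass at most C, takes half of e.
    The other half goes to the n indicators, each allowed e / (2 d) and weighted by d/n.\<close>
  obtain n :: nat where n: "n > 0" "d * C / n \<le> e / 2"
  proof -
    obtain n :: nat where "real n > 2 * d * C / e" using reals_Archimedean2 by blast
    then show thesis using e d C by (intro that[of "Suc n"]) (auto simp: field_simps)
  qed
  define A where "A k = {x. real k + 1 \<le> n * ((f x - lo) / d)}" for k
  have A: "A k \<in> sets borel" for k unfolding A_def using f(1) by measurable
  have "\<exists>g :: 'a \<Rightarrow> real. continuous_on UNIV g \<and> (\<forall>x. 0 \<le> g x \<and> g x \<le> 1) \<and>
    (\<integral>x. \<bar>indicator (A k) x - g x\<bar> \<partial>M1) \<le> e / (2 * d) \<and> (\<integral>x. \<bar>indicator (A k) x - g x\<bar> \<partial>M2) \<le> e / (2 * d)" for k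
  proof -
    have "e / (2 * d) > 0" using e d by simp
    then obtain f :: "'a \<Rightarrow> real" where "continuous_on UNIV f" "\<And>x. 0 \<le> f x" "\<And>x. f x \<le> 1"
      "(\<integral>x. \<bar>indicator (A k) x - f x\<bar> \<partial>M1) \<le> e / (2 * d)" "(\<integral>x. \<bar>indicator (A k) x - f x\<bar> \<partial>M2) \<le> e / (2 * d)"
      by (rule continuous_approx_indicator[OF M1 M2 A[of k]]) (rule that)
    then show ?thesis by blast
  qed
  then have "\<exists>g. \<forall>k. continuous_on UNIV (g k :: 'a \<Rightarrow> real) \<and> (\<forall>x. 0 \<le> g k x \<and> g k x \<le> 1) \<and>
    (\<integral>x. \<bar>indicator (A k) x - g k x\<bar> \<partial>M1) \<le> e / (2 * d) \<and> (\<integral>x. \<bar>indicator (A k) x - g k x\<bar> \<partial>M2) \<le> e / (2 * d)"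
    by (intro choice allI)
  then obtain g :: "nat \<Rightarrow> 'a \<Rightarrow> real" where g: "\<And>k. continuous_on UNIV (g k)" "\<And>k x. 0 \<le> g k x" "\<And>k x. g k x \<le> 1"
    "\<And>k. (\<integral>x. \<bar>indicator (A k) x - g k x\<bar> \<partial>M1) \<le> e / (2 * d)" "\<And>k. (\<integral>x. \<bar>indicator (A k) x - g k x\<bar> \<partial>M2) \<le> e / (2 * d)"
    by blast
  define h where "h x = lo + d * ((\<Sum>k<n. g k x) / n)" for x
  have ptw: "\<bar>f x - h x\<bar> \<le> d / n + d / n * (\<Sum>k<n. \<bar>indicator (A k) x - g k x\<bar>)" for x
  proof -
    define y where "y = (f x - lo) / d"
    have y: "0 \<le> y" "y \<le> 1" using f(2,3)[of x] d by (auto simp: y_def d_def field_simps)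
    have fx: "f x = lo + d * y" using d by (simp add: y_def)
    have s: "(\<Sum>k<n. of_bool (real k + 1 \<le> n * y)) = (\<Sum>k<n. indicator (A k) x :: real)"
      by (intro sum.cong) (auto simp: A_def y_def indicator_def)
    have "\<bar>y - (\<Sum>k<n. g k x) / n\<bar> \<le> \<bar>y - (\<Sum>k<n. indicator (A k) x) / n\<bar> + \<bar>(\<Sum>k<n. indicator (A k) x - g k x) / n\<bar>"
      by (simp add: sum_subtractf diff_divide_distrib)
    also have "\<dots> \<le> 1 / n + (\<Sum>k<n. \<bar>indicator (A k) x - g k x\<bar>) / n"
      using staircase_approx[OF y n(1)] unfolding s
      by (intro add_mono) (auto intro!: divide_right_mono)
    finally have "d * \<bar>y - (\<Sum>k<n. g k x) / n\<bar> \<le> d * (1 / n + (\<Sum>k<n. \<bar>indicator (A k) x - g k x\<bar>) / n)"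
      using d by (intro mult_left_mono) auto
    moreover have "\<bar>f x - h x\<bar> = d * \<bar>y - (\<Sum>k<n. g k x) / n\<bar>"
    proof -
      have "f x - h x = d * (y - (\<Sum>k<n. g k x) / n)" unfolding fx h_def by (simp add: algebra_simps)
      then show ?thesis using d by (simp add: abs_mult)
    qed
    ultimately show ?thesis by (simp add: algebra_simps)
  qed
  have ch: "continuous_on UNIV h" unfolding h_def by (intro continuous_intros g) (use n in auto)
  have "0 \<le> (\<Sum>k<n. g k x) / n" "(\<Sum>k<n. g k x) / n \<le> 1" for x
    using sum_mono[of "{..<n}" "\<lambda>k. g k x" "\<lambda>_. 1"] g n by (auto intro!: sum_nonneg divide_nonneg_nonneg simp: field_simps)
  then have "0 \<le> d * ((\<Sum>k<n. g k x) / n)" "d * ((\<Sum>k<n. g k x) / n) \<le> d * 1" for x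
    using d by (auto intro!: mult_nonneg_nonneg mult_left_mono simp del: times_divide_eq_right mult_1_right)
  then have "0 \<le> h x - lo" "h x - lo \<le> d" for x
    by (simp_all only: h_def add_diff_cancel_left' mult_1_right)
  then have h: "lo \<le> h x" "h x \<le> hi" for x
    by (simp_all add: d_def)
  have bnd: "(\<integral>x. \<bar>f x - h x\<bar> \<partial>M) \<le> e"
    if M: "finite_measure M" "sets M = sets borel" "measure M (space M) \<le> C"
      "\<And>k. (\<integral>x. \<bar>indicator (A k) x - g k x\<bar> \<partial>M) \<le> e / (2 * d)" for M
  proof -
    interpret finite_measure M by fact
    have [measurable]: "f \<in> borel_measurable M" "h \<in> borel_measurable M" "A k \<in> sets M" "g k \<in> borel_measurable M" for k
      using ch g(1) A f(1) M(2) by (auto intro!: borel_measurable_continuous_onI cong: measurable_cong_sets)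
    have i1: "integrable M (\<lambda>x. \<bar>indicator (A k) x - g k x\<bar>)" for k
    proof (rule integrable_const_bound[of _ 1])
      have "\<bar>indicator (A k) x - g k x\<bar> \<le> 1" for x using g(2,3)[of k x] by (simp add: indicator_def abs_le_iff)
      then show "AE x in M. norm \<bar>indicator (A k) x - g k x\<bar> \<le> 1" by simp
    qed auto
    have "(\<integral>x. \<bar>f x - h x\<bar> \<partial>M) \<le> (\<integral>x. d / n + d / n * (\<Sum>k<n. \<bar>indicator (A k) x - g k x\<bar>) \<partial>M)"
    proof (rule integral_mono)
      show "integrable M (\<lambda>x. \<bar>f x - h x\<bar>)"
      proof (rule integrable_const_bound[of _ d])
        have "\<bar>f x - h x\<bar> \<le> d" for x using f(2,3)[of x] h[of x] by (simp add: d_def abs_le_iff)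
        then show "AE x in M. norm \<bar>f x - h x\<bar> \<le> d" by simp
      qed auto
    qed (use ptw i1 in auto)
    also have "\<dots> = d / n * measure M (space M) + d / n * (\<Sum>k<n. (\<integral>x. \<bar>indicator (A k) x - g k x\<bar> \<partial>M))"
      using i1 by simp
    also have "\<dots> \<le> d / n * C + d / n * (\<Sum>k<n. e / (2 * d))"
      using M d by (intro add_mono mult_left_mono sum_mono) auto
    also have "\<dots> \<le> e" using n d by (simp add: field_simps)
    finally show ?thesis .
  qed
  show thesis
    by (rule that[OF ch h]; rule bnd) (use M1 M2 g in \<open>auto simp: C_def\<close>)
qed

text \<open>Stone-Weierstrass supplies real polynomials in Re z and Im z, whereas the moment
  identities concern powers of z. On the circle \<open>cnj z\<close> is 1/z, so the form p(z)
  cnj(z)^m encodes a Laurent polynomial.\<close>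

lemma laurent_of_real_polynomial:
  fixes f :: "complex \<Rightarrow> real"
  assumes "real_polynomial_function f"
  shows "\<exists>p m. \<forall>z. cmod z = 1 \<longrightarrow> of_real (f z) = poly p z * cnj z ^ m"
  using assms
proof induction
  case (linear f)
  have f: "f z = Re z * f 1 + Im z * f \<i>" for z
  proof -
    have "z = Re z *\<^sub>R 1 + Im z *\<^sub>R \<i>" by (simp add: complex_eq_iff)
    then have "f z = f (Re z *\<^sub>R 1 + Im z *\<^sub>R \<i>)" by simp
    also have "\<dots> = Re z * f 1 + Im z * f \<i>"
      by (simp only: linear_add[OF bounded_linear.linear[OF linear]] linear_cmul[OF bounded_linear.linear[OF linear]] real_scaleR_def)
    finally show ?thesis .
  qed
  let ?p = "[:of_real (f 1) / 2 + \<i> * of_real (f \<i>) / 2, 0, of_real (f 1) / 2 - \<i> * of_real (f \<i>) / 2:]"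
  have "of_real (f z) = poly ?p z * cnj z ^ 1" if "cmod z = 1" for z
  proof -
    have "poly ?p z * cnj z ^ 1 = (of_real (f 1) / 2 + \<i> * of_real (f \<i>) / 2) * cnj z
      + (of_real (f 1) / 2 - \<i> * of_real (f \<i>) / 2) * z * (z * cnj z)"
      by (simp add: algebra_simps)
    also have "\<dots> = of_real (f z)"
      unfolding unit_mult_cnj[OF that] f[of z] by (simp add: complex_eq_iff)
    finally show ?thesis by simp
  qed
  then show ?case by blast
next
  case (const c)
  show ?case by (intro exI[of _ "[:of_real c:]"] exI[of _ 0]) simp
next
  case (add f g)
  then obtain p m q n where p: "\<And>z. cmod z = 1 \<Longrightarrow> of_real (f z) = poly p z * cnj z ^ m"
    and q: "\<And>z. cmod z = 1 \<Longrightarrow> of_real (g z) = poly q z * cnj z ^ n" by blast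
  have "of_real (f z + g z) = poly (p * monom 1 n + q * monom 1 m) z * cnj z ^ (m + n)" if "cmod z = 1" for z
  proof -
    have u: "z ^ k * cnj z ^ k = 1" for k using unit_mult_cnj[OF that] by (simp flip: power_mult_distrib)
    have "poly (p * monom 1 n + q * monom 1 m) z * cnj z ^ (m + n)
      = poly p z * cnj z ^ m * (z ^ n * cnj z ^ n) + poly q z * cnj z ^ n * (z ^ m * cnj z ^ m)"
      by (simp add: poly_monom power_add algebra_simps)
    then show ?thesis unfolding u using p[OF that] q[OF that] by simp
  qed
  then show ?case by blast
next
  case (mult f g)
  then obtain p m q n where p: "\<And>z. cmod z = 1 \<Longrightarrow> of_real (f z) = poly p z * cnj z ^ m"
    and q: "\<And>z. cmod z = 1 \<Longrightarrow> of_real (g z) = poly q z * cnj z ^ n" by blast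
  have "of_real (f z * g z) = poly (p * q) z * cnj z ^ (m + n)" if "cmod z = 1" for z
    using p[OF that] q[OF that] by (simp add: power_add)
  then show ?case by blast
qed

lemma unit_weight: "cmod z = 1 \<Longrightarrow> 0 \<le> 1 - (Re z)\<^sup>2 \<and> 1 - (Re z)\<^sup>2 \<le> 1"
proof -
  assume "cmod z = 1"
  then have "(Re z)\<^sup>2 + (Im z)\<^sup>2 = 1" using cmod_power2[of z] by simp
  then show ?thesis using zero_le_power2[of "Im z"] zero_le_power2[of "Re z"] by linarith
qed

lemma integral_weight_unif: "(\<integral>z. 1 - (Re z)\<^sup>2 \<partial>unif) = 1 / 2"
proof -
  have "(\<integral>z. 1 - (Re z)\<^sup>2 \<partial>unif) = (\<integral>z. Re ((1 - z\<^sup>2) / 2) \<partial>unif)"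
  proof (intro Bochner_Integration.integral_cong refl)
    fix z assume "z \<in> space unif"
    then have "(Im z)\<^sup>2 = 1 - (Re z)\<^sup>2" using cmod_power2[of z] by simp
    then show "1 - (Re z)\<^sup>2 = Re ((1 - z\<^sup>2) / 2)" by (simp add: Re_power2)
  qed
  also have "\<dots> = Re (\<integral>z. (1 - z\<^sup>2) / 2 \<partial>unif)"
    by (rule integral_Re) (intro integrable_unif continuous_intros, auto)
  also have "(\<integral>z. (1 - z\<^sup>2) / 2 \<partial>unif) = 1 / 2"
    by (subst circle_mean_value) (auto intro!: continuous_intros holomorphic_intros)
  finally show ?thesis by simp
qed

section \<open>Bounds on the entropy of late weights by polynomial, continuous and measurable test
  functions\<close>

context circle_measure
begin

lemma bs_entropy_le_polynomial:
  assumes t: "real_polynomial_function t" "\<And>z. cmod z = 1 \<Longrightarrow> t z > 0"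
  shows "\<exists>N0. \<forall>N\<ge>N0. bs_entropy N \<le> (\<integral>z. (1 - (Re z)\<^sup>2) * t z \<partial>\<mu>) - 1 / 2 - (\<integral>z. (1 - (Re z)\<^sup>2) * ln (t z) \<partial>unif)"
proof -
  have ct [continuous_intros]: "continuous_on (sphere 0 1) t"
    using t(1) by (metis continuous_at_imp_continuous_on continuous_real_polymonial_function)
  \<comment> \<open>The factor 1 - cos^2 is absorbed into the Laurent polynomial, so that the
    weighted integrals of \<open>t\<close> against the late weights and against \<mu> agree
    exactly.\<close>
  have "real_polynomial_function (\<lambda>z. (1 + (-1) * (Re z * Re z)) * t z)"
    by (intro real_polynomial_function.intros bounded_linear_Re t)
  then obtain p m where pm: "\<And>z. cmod z = 1 \<Longrightarrow> of_real ((1 + (-1) * (Re z * Re z)) * t z) = poly p z * cnj z ^ m"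
    using laurent_of_real_polynomial by blast
  then have pm: "\<And>z. cmod z = 1 \<Longrightarrow> of_real ((1 - (Re z)\<^sup>2) * t z) = poly p z * cnj z ^ m"
    by (simp add: power2_eq_square)
  have "bs_entropy N \<le> (\<integral>z. (1 - (Re z)\<^sup>2) * t z \<partial>\<mu>) - 1 / 2 - (\<integral>z. (1 - (Re z)\<^sup>2) * ln (t z) \<partial>unif)"
    if N: "N \<ge> max (degree p) m" for N
  proof -
    have "complex_of_real (\<integral>z. (1 - (Re z)\<^sup>2) * t z * bs_weight N z \<partial>unif) = (\<integral>z. poly p z * cnj z ^ m * of_real (bs_weight N z) \<partial>unif)"
      unfolding integral_complex_of_real[symmetric]
      by (intro Bochner_Integration.integral_cong refl) (simp add: pm[symmetric])
    also have "\<dots> = (\<integral>z. poly p z * cnj z ^ m \<partial>\<mu>)"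
      using N by (intro laurent_eq) auto
    also have "\<dots> = complex_of_real (\<integral>z. (1 - (Re z)\<^sup>2) * t z \<partial>\<mu>)"
      unfolding integral_complex_of_real[symmetric]
      by (intro Bochner_Integration.integral_cong refl) (simp add: pm[symmetric])
    finally have mom: "(\<integral>z. (1 - (Re z)\<^sup>2) * t z * bs_weight N z \<partial>unif) = (\<integral>z. (1 - (Re z)\<^sup>2) * t z \<partial>\<mu>)"
      by (simp only: of_real_eq_iff)
    have int: "integrable unif (\<lambda>z. (1 - (Re z)\<^sup>2) * t z * bs_weight N z)" "integrable unif (\<lambda>z. 1 - (Re z)\<^sup>2)"
      "integrable unif (\<lambda>z. (1 - (Re z)\<^sup>2) * ln (t z))" "integrable unif (\<lambda>z. (1 - (Re z)\<^sup>2) * ln (bs_weight N z))"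
    proof -
      have "\<forall>z\<in>sphere 0 1. t z \<noteq> 0" "\<forall>z\<in>sphere 0 1. bs_weight N z \<noteq> 0"
        using t(2) bs_weight_pos[of _ N] by (force simp: less_imp_neq[symmetric])+
      then show "integrable unif (\<lambda>z. (1 - (Re z)\<^sup>2) * t z * bs_weight N z)" "integrable unif (\<lambda>z. 1 - (Re z)\<^sup>2)"
        "integrable unif (\<lambda>z. (1 - (Re z)\<^sup>2) * ln (t z))" "integrable unif (\<lambda>z. (1 - (Re z)\<^sup>2) * ln (bs_weight N z))"
        by (intro integrable_unif continuous_intros; simp)+
    qed
    have "bs_entropy N = (\<integral>z. (1 - (Re z)\<^sup>2) * ln (bs_weight N z) \<partial>unif)" by (simp add: integral_log_bs_weight)
    also have "\<dots> \<le> (\<integral>z. (1 - (Re z)\<^sup>2) * t z * bs_weight N z - (1 - (Re z)\<^sup>2) - (1 - (Re z)\<^sup>2) * ln (t z) \<partial>unif)"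
    proof (rule integral_mono)
      fix z assume "z \<in> space unif"
      then have z: "cmod z = 1" by simp
      have "ln (t z * bs_weight N z) \<le> t z * bs_weight N z - 1" using t(2)[OF z] bs_weight_pos[of z N] z by (intro ln_le_minus_one) simp
      then have "ln (bs_weight N z) \<le> t z * bs_weight N z - 1 - ln (t z)" using t(2)[OF z] bs_weight_pos[of z N] z by (simp add: ln_mult)
      then have "(1 - (Re z)\<^sup>2) * ln (bs_weight N z) \<le> (1 - (Re z)\<^sup>2) * (t z * bs_weight N z - 1 - ln (t z))"
        using unit_weight[OF z] by (intro mult_left_mono) auto
      then show "(1 - (Re z)\<^sup>2) * ln (bs_weight N z) \<le> (1 - (Re z)\<^sup>2) * t z * bs_weight N z - (1 - (Re z)\<^sup>2) - (1 - (Re z)\<^sup>2) * ln (t z)"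
        by (simp add: algebra_simps)
    qed (use int in auto)
    also have "\<dots> = (\<integral>z. (1 - (Re z)\<^sup>2) * t z \<partial>\<mu>) - 1 / 2 - (\<integral>z. (1 - (Re z)\<^sup>2) * ln (t z) \<partial>unif)"
      unfolding mom[symmetric] integral_weight_unif[symmetric] using int by (subst Bochner_Integration.integral_diff; simp)
    finally show ?thesis .
  qed
  then show ?thesis by blast
qed

lemma bs_entropy_le_continuous:
  assumes h: "continuous_on (sphere 0 1) h" "\<And>z. cmod z = 1 \<Longrightarrow> h z > 0" and e: "e > 0"
  shows "\<exists>N0. \<forall>N\<ge>N0. bs_entropy N \<le> (\<integral>z. (1 - (Re z)\<^sup>2) * h z \<partial>\<mu>) - 1 / 2 - (\<integral>z. (1 - (Re z)\<^sup>2) * ln (h z) \<partial>unif) + e"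
proof -
  note h(1) [continuous_intros]
  \<comment> \<open>Approximating h + e/2 within e/2 places \<open>t\<close> strictly between h and
    h + e. It is then positive, and its logarithm dominates that of h, so only the \<mu>-integral
    costs an error.\<close>
  have "continuous_on (sphere 0 1) (\<lambda>z. h z + e / 2)" by (intro continuous_intros) auto
  then obtain t where t: "real_polynomial_function t" "\<And>z. z \<in> sphere 0 1 \<Longrightarrow> \<bar>h z + e / 2 - t z\<bar> < e / 2"
    using Stone_Weierstrass_real_polynomial_function[of "sphere 0 1" "\<lambda>z. h z + e / 2" "e / 2"] e by auto
  have ct [continuous_intros]: "continuous_on (sphere 0 1) t"
    using t(1) by (metis continuous_at_imp_continuous_on continuous_real_polymonial_function)
  have th: "h z < t z" "t z < h z + e" if "cmod z = 1" for z
  proof -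
    have "\<bar>h z + e / 2 - t z\<bar> < e / 2" using t(2) that by simp
    then show "h z < t z" "t z < h z + e" by linarith+
  qed
  have tpos: "t z > 0" if "cmod z = 1" for z using th[OF that] h(2)[OF that] by simp
  have "(\<integral>z. (1 - (Re z)\<^sup>2) * t z \<partial>\<mu>) \<le> (\<integral>z. (1 - (Re z)\<^sup>2) * h z + e \<partial>\<mu>)"
  proof (rule integral_mono)
    fix z assume "z \<in> space \<mu>"
    then have z: "cmod z = 1" by simp
    have "(1 - (Re z)\<^sup>2) * t z \<le> (1 - (Re z)\<^sup>2) * (h z + e)" using th[OF z] unit_weight[OF z] by (intro mult_left_mono) auto
    also have "\<dots> \<le> (1 - (Re z)\<^sup>2) * h z + 1 * e" using unit_weight[OF z] e by (simp add: distrib_left mult_left_le_one_le)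
    finally show "(1 - (Re z)\<^sup>2) * t z \<le> (1 - (Re z)\<^sup>2) * h z + e" by simp
  qed (intro integrable_mu continuous_intros)+
  also have "\<dots> = (\<integral>z. (1 - (Re z)\<^sup>2) * h z \<partial>\<mu>) + e"
    by (subst Bochner_Integration.integral_add) (auto intro!: integrable_mu continuous_intros simp: prob_space[unfolded space_mu])
  finally have 1: "(\<integral>z. (1 - (Re z)\<^sup>2) * t z \<partial>\<mu>) \<le> (\<integral>z. (1 - (Re z)\<^sup>2) * h z \<partial>\<mu>) + e" .
  have nz: "\<forall>z\<in>sphere 0 1. t z \<noteq> 0" "\<forall>z\<in>sphere 0 1. h z \<noteq> 0"
    using tpos h(2) by (force simp: less_imp_neq[symmetric])+
  have 2: "(\<integral>z. (1 - (Re z)\<^sup>2) * ln (h z) \<partial>unif) \<le> (\<integral>z. (1 - (Re z)\<^sup>2) * ln (t z) \<partial>unif)"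
  proof (rule integral_mono)
    fix z assume "z \<in> space unif"
    then have z: "cmod z = 1" by simp
    show "(1 - (Re z)\<^sup>2) * ln (h z) \<le> (1 - (Re z)\<^sup>2) * ln (t z)"
      using th[OF z] h(2)[OF z] unit_weight[OF z] by (intro mult_left_mono) auto
  qed (intro integrable_unif continuous_intros; use nz in simp)+
  from bs_entropy_le_polynomial[OF t(1) tpos] obtain N0 where
    "\<forall>N\<ge>N0. bs_entropy N \<le> (\<integral>z. (1 - (Re z)\<^sup>2) * t z \<partial>\<mu>) - 1 / 2 - (\<integral>z. (1 - (Re z)\<^sup>2) * ln (t z) \<partial>unif)" by blast
  with 1 2 show ?thesis by (intro exI[of _ N0]) force
qed

lemma bs_entropy_le_measurable:
  fixes f :: "complex \<Rightarrow> real"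
  assumes f: "f \<in> borel_measurable borel" "\<And>z. lo \<le> f z" "\<And>z. f z \<le> hi" and lo: "lo > 0" "lo < hi" and e: "e > 0"
  shows "\<exists>N0. \<forall>N\<ge>N0. bs_entropy N \<le> (\<integral>z. (1 - (Re z)\<^sup>2) * f z \<partial>\<mu>) - 1 / 2 - (\<integral>z. (1 - (Re z)\<^sup>2) * ln (f z) \<partial>unif) + e"
proof -
  \<comment> \<open>The total e is split in three: d bounds the error in the \<mu>-integral, d / lo
    the error in the logarithmic integral, as ln f - ln h <= |f - h| / lo, and the last third is the
    error for the continuous function.\<close>
  define d where "d = min (e / 3) (lo * e / 3)"
  have d: "d > 0" "d \<le> e / 3" "d / lo \<le> e / 3" using e lo by (auto simp: d_def min_def field_simps)
  \<comment> \<open>Both measures are pushed forward to the whole plane, where the approximation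
    lemma for Borel measures on a Euclidean space applies.\<close>
  define M1 M2 where "M1 = distr \<mu> borel (\<lambda>z. z)" "M2 = distr unif borel (\<lambda>z. z)"
  have id1 [measurable]: "(\<lambda>z. z) \<in> \<mu> \<rightarrow>\<^sub>M borel" and id2 [measurable]: "(\<lambda>z. z) \<in> unif \<rightarrow>\<^sub>M borel"
    by (auto intro!: continuous_on_circle_measurable)
  have M: "finite_measure M1" "sets M1 = sets borel" "finite_measure M2" "sets M2 = sets borel"
    unfolding M1_M2_def by (auto intro!: finite_measure.finite_measure_distr finite_measure_axioms unif.finite_measure_axioms)
  obtain h :: "complex \<Rightarrow> real" where h: "continuous_on UNIV h" "\<And>x. lo \<le> h x" "\<And>x. h x \<le> hi"
    "(\<integral>x. \<bar>f x - h x\<bar> \<partial>M1) \<le> d" "(\<integral>x. \<bar>f x - h x\<bar> \<partial>M2) \<le> d"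
    by (rule continuous_approx_bounded[OF M f lo(2) d(1)]) (rule that)
  have hm [measurable]: "h \<in> borel_measurable borel" using h(1) by (rule borel_measurable_continuous_onI)
  note f(1) [measurable]
  have d1: "(\<integral>x. \<bar>f x - h x\<bar> \<partial>\<mu>) \<le> d" and d2: "(\<integral>x. \<bar>f x - h x\<bar> \<partial>unif) \<le> d"
    using h(4,5) unfolding M1_M2_def by (simp_all add: integral_distr)
  have fm: "f \<in> borel_measurable \<mu>" "f \<in> borel_measurable unif" "h \<in> borel_measurable \<mu>" "h \<in> borel_measurable unif"
    using measurable_compose[OF id1 f(1)] measurable_compose[OF id2 f(1)] measurable_compose[OF id1 hm] measurable_compose[OF id2 hm] by simp_all
  have rm: "Re \<in> borel_measurable \<mu>" "Re \<in> borel_measurable unif" by (auto intro!: continuous_on_circle_measurable continuous_intros)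
  note [measurable] = fm rm
  have fpos: "f z > 0" "h z > 0" for z using f(2)[of z] h(2)[of z] lo by auto
  have lnb: "\<bar>ln x\<bar> \<le> \<bar>ln lo\<bar> + \<bar>ln hi\<bar>" if "lo \<le> x" "x \<le> hi" for x
  proof -
    have "ln lo \<le> ln x" "ln x \<le> ln hi" using that lo by auto
    then show ?thesis by linarith
  qed
  have ch: "continuous_on (sphere 0 1) h" using h(1) continuous_on_subset by blast
  obtain N0 where N0: "\<forall>N\<ge>N0. bs_entropy N \<le> (\<integral>z. (1 - (Re z)\<^sup>2) * h z \<partial>\<mu>) - 1 / 2 - (\<integral>z. (1 - (Re z)\<^sup>2) * ln (h z) \<partial>unif) + e / 3"
    using bs_entropy_le_continuous[OF ch fpos(2), of "e / 3"] e by auto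
  have w1: "\<bar>1 - (Re z)\<^sup>2\<bar> \<le> 1" if "cmod z = 1" for z using unit_weight[OF that] by simp
  have bound: "\<bar>(1 - (Re z)\<^sup>2) * x\<bar> \<le> B" if "cmod z = 1" "\<bar>x\<bar> \<le> B" for z x B
    using mult_mono[OF w1[OF that(1)] that(2)] by (simp add: abs_mult)
  have i1: "integrable \<mu> (\<lambda>z. (1 - (Re z)\<^sup>2) * x z)" "integrable unif (\<lambda>z. (1 - (Re z)\<^sup>2) * x z)"
    if "\<And>z. \<bar>x z\<bar> \<le> B" "x \<in> borel_measurable \<mu>" "x \<in> borel_measurable unif" for x B
  proof -
    note [measurable] = that(2,3)
    show "integrable \<mu> (\<lambda>z. (1 - (Re z)\<^sup>2) * x z)"
      by (rule integrable_const_bound[of _ B]) (use bound that(1) in \<open>auto intro!: AE_I2\<close>)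
    show "integrable unif (\<lambda>z. (1 - (Re z)\<^sup>2) * x z)"
      by (rule unif.integrable_const_bound[of _ B]) (use bound that(1) in \<open>auto intro!: AE_I2\<close>)
  qed
  have fh: "\<bar>f z\<bar> \<le> hi" "\<bar>h z\<bar> \<le> hi" "\<bar>f z - h z\<bar> \<le> hi" for z
    using f(2,3)[of z] h(2,3)[of z] lo by (auto simp: abs_le_iff)
  have id: "integrable \<mu> (\<lambda>z. \<bar>f z - h z\<bar>)" "integrable unif (\<lambda>z. \<bar>f z - h z\<bar>)"
    using fh(3) by (auto intro!: integrable_const_bound[of _ hi] unif.integrable_const_bound[of _ hi] AE_I2)
  have if1: "integrable \<mu> (\<lambda>z. (1 - (Re z)\<^sup>2) * f z)" and ih1: "integrable \<mu> (\<lambda>z. (1 - (Re z)\<^sup>2) * h z)"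
    by (rule i1(1); (rule fh)?; simp)+
  have if2: "integrable unif (\<lambda>z. (1 - (Re z)\<^sup>2) * ln (f z))"
    by (rule i1(2)[of _ "\<bar>ln lo\<bar> + \<bar>ln hi\<bar>"]) (use f lnb in auto)
  have ih2: "integrable unif (\<lambda>z. (1 - (Re z)\<^sup>2) * ln (h z))"
    by (rule i1(2)[of _ "\<bar>ln lo\<bar> + \<bar>ln hi\<bar>"]) (use h lnb in auto)
  have "(\<integral>z. (1 - (Re z)\<^sup>2) * h z \<partial>\<mu>) \<le> (\<integral>z. (1 - (Re z)\<^sup>2) * f z + \<bar>f z - h z\<bar> \<partial>\<mu>)"
  proof (rule integral_mono)
    fix z assume "z \<in> space \<mu>"
    then have z: "cmod z = 1" by simp
    have "(1 - (Re z)\<^sup>2) * (h z - f z) \<le> \<bar>f z - h z\<bar>" using bound[OF z, of "h z - f z" "\<bar>f z - h z\<bar>"] by (simp add: abs_minus_commute)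
    then show "(1 - (Re z)\<^sup>2) * h z \<le> (1 - (Re z)\<^sup>2) * f z + \<bar>f z - h z\<bar>" by (simp add: right_diff_distrib)
  qed (use if1 ih1 id in auto)
  also have "\<dots> = (\<integral>z. (1 - (Re z)\<^sup>2) * f z \<partial>\<mu>) + (\<integral>z. \<bar>f z - h z\<bar> \<partial>\<mu>)" using if1 id by simp
  finally have 1: "(\<integral>z. (1 - (Re z)\<^sup>2) * h z \<partial>\<mu>) \<le> (\<integral>z. (1 - (Re z)\<^sup>2) * f z \<partial>\<mu>) + e / 3" using d1 d by simp
  have "(\<integral>z. (1 - (Re z)\<^sup>2) * ln (f z) \<partial>unif) \<le> (\<integral>z. (1 - (Re z)\<^sup>2) * ln (h z) + \<bar>f z - h z\<bar> / lo \<partial>unif)"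
  proof (rule integral_mono)
    fix z assume "z \<in> space unif"
    then have z: "cmod z = 1" by simp
    have "ln (f z) - ln (h z) = ln (f z / h z)" using fpos[of z] by (simp add: ln_div)
    also have "\<dots> \<le> f z / h z - 1" using fpos[of z] by (intro ln_le_minus_one) simp
    also have "\<dots> = (f z - h z) / h z" using fpos[of z] by (simp add: field_simps)
    also have "\<dots> \<le> \<bar>f z - h z\<bar> / lo" using h(2)[of z] lo by (intro frac_le) auto
    finally have le: "ln (f z) - ln (h z) \<le> \<bar>f z - h z\<bar> / lo" .
    have "(1 - (Re z)\<^sup>2) * (ln (f z) - ln (h z)) \<le> (1 - (Re z)\<^sup>2) * (\<bar>f z - h z\<bar> / lo)"
      using le unit_weight[OF z] by (intro mult_left_mono) auto
    also have "\<dots> \<le> 1 * (\<bar>f z - h z\<bar> / lo)" using unit_weight[OF z] lo by (intro mult_right_mono) auto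
    finally show "(1 - (Re z)\<^sup>2) * ln (f z) \<le> (1 - (Re z)\<^sup>2) * ln (h z) + \<bar>f z - h z\<bar> / lo" by (simp add: right_diff_distrib)
  qed (use if2 ih2 id in auto)
  also have "\<dots> = (\<integral>z. (1 - (Re z)\<^sup>2) * ln (h z) \<partial>unif) + (\<integral>z. \<bar>f z - h z\<bar> \<partial>unif) / lo" using ih2 id by simp
  also have "(\<integral>z. \<bar>f z - h z\<bar> \<partial>unif) / lo \<le> d / lo" using d2 lo by (intro divide_right_mono) auto
  finally have 2: "(\<integral>z. (1 - (Re z)\<^sup>2) * ln (f z) \<partial>unif) \<le> (\<integral>z. (1 - (Re z)\<^sup>2) * ln (h z) \<partial>unif) + e / 3" using d(3) by linarith
  from 1 2 N0 show ?thesis by (intro exI[of _ N0]) force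
qed

end

section \<open>Integrals with values in the extended reals\<close>

lemma ereal_integral_le:
  assumes h: "integrable M h" and le: "AE x in M. f x \<le> ereal (h x)"
  shows "ereal_integral M f \<le> ereal (\<integral>x. h x \<partial>M)"
proof -
  have fin: "(\<integral>\<^sup>+x. ennreal (h x) \<partial>M) < \<infinity>" "(\<integral>\<^sup>+x. ennreal (- h x) \<partial>M) < \<infinity>"
    using h by (auto simp: real_integrable_def less_top)
  have "(\<integral>\<^sup>+x. e2ennreal (f x) \<partial>M) \<le> (\<integral>\<^sup>+x. ennreal (h x) \<partial>M)"
    using le by (intro nn_integral_mono_AE) (auto elim!: eventually_mono dest: e2ennreal_mono)
  moreover have "(\<integral>\<^sup>+x. ennreal (- h x) \<partial>M) \<le> (\<integral>\<^sup>+x. e2ennreal (- f x) \<partial>M)"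
  proof (intro nn_integral_mono_AE eventually_mono[OF le])
    fix x assume "f x \<le> ereal (h x)"
    then have "ereal (- h x) \<le> - f x" by (simp flip: uminus_ereal.simps(1))
    from e2ennreal_mono[OF this] show "ennreal (- h x) \<le> e2ennreal (- f x)" by simp
  qed
  ultimately have "ereal_integral M f \<le> enn2ereal (\<integral>\<^sup>+x. ennreal (h x) \<partial>M) - enn2ereal (\<integral>\<^sup>+x. ennreal (- h x) \<partial>M)"
    unfolding ereal_integral_def by (intro ereal_minus_mono) (auto simp: less_eq_ennreal.rep_eq)
  also have "\<dots> = ereal (\<integral>x. h x \<partial>M)"
    unfolding real_lebesgue_integral_def[OF h] using fin
    by (cases "\<integral>\<^sup>+x. ennreal (h x) \<partial>M"; cases "\<integral>\<^sup>+x. ennreal (- h x) \<partial>M") auto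
  finally show ?thesis .
qed

lemma ereal_integral_eq_integral:
  assumes h: "integrable M h" and eq: "AE x in M. f x = ereal (h x)"
  shows "ereal_integral M f = ereal (\<integral>x. h x \<partial>M)"
proof -
  have fin: "(\<integral>\<^sup>+x. ennreal (h x) \<partial>M) < \<infinity>" "(\<integral>\<^sup>+x. ennreal (- h x) \<partial>M) < \<infinity>"
    using h by (auto simp: real_integrable_def less_top)
  have "(\<integral>\<^sup>+x. e2ennreal (f x) \<partial>M) = (\<integral>\<^sup>+x. ennreal (h x) \<partial>M)"
    "(\<integral>\<^sup>+x. e2ennreal (- f x) \<partial>M) = (\<integral>\<^sup>+x. ennreal (- h x) \<partial>M)"
    using eq by (auto intro!: nn_integral_cong_AE elim!: eventually_mono)
  then show ?thesis
    unfolding ereal_integral_def real_lebesgue_integral_def[OF h] using fin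
    by (cases "\<integral>\<^sup>+x. ennreal (h x) \<partial>M"; cases "\<integral>\<^sup>+x. ennreal (- h x) \<partial>M") auto
qed

lemma nn_integral_add_measures:
  assumes sets: "sets M1 = sets M" "sets M2 = sets M"
    and em: "\<And>A. A \<in> sets M \<Longrightarrow> emeasure M A = emeasure M1 A + emeasure M2 A"
    and f: "f \<in> borel_measurable M"
  shows "(\<integral>\<^sup>+x. f x \<partial>M) = (\<integral>\<^sup>+x. f x \<partial>M1) + (\<integral>\<^sup>+x. f x \<partial>M2)"
  using f
proof induction
  case (cong f g)
  have "space M1 = space M" "space M2 = space M" using sets by (auto dest: sets_eq_imp_space_eq)
  then have "(\<integral>\<^sup>+x. f x \<partial>M) = (\<integral>\<^sup>+x. g x \<partial>M)" "(\<integral>\<^sup>+x. f x \<partial>M1) = (\<integral>\<^sup>+x. g x \<partial>M1)" "(\<integral>\<^sup>+x. f x \<partial>M2) = (\<integral>\<^sup>+x. g x \<partial>M2)"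
    using cong(3) by (auto intro!: nn_integral_cong)
  then show ?case using cong(4) by simp
next
  case (set A)
  then show ?case using em sets by simp
next
  case (mult u c)
  then have "u \<in> borel_measurable M1" "u \<in> borel_measurable M2" using sets by (auto cong: measurable_cong_sets)
  then show ?case using mult by (simp add: nn_integral_cmult distrib_left)
next
  case (add u v)
  then have "u \<in> borel_measurable M1" "u \<in> borel_measurable M2" "v \<in> borel_measurable M1" "v \<in> borel_measurable M2"
    using sets by (auto cong: measurable_cong_sets)
  then show ?case using add by (simp add: nn_integral_add ac_simps)
next
  case (seq U)
  then have m: "\<And>i. U i \<in> borel_measurable M1" "\<And>i. U i \<in> borel_measurable M2"
    using sets by (auto cong: measurable_cong_sets)
  have inc: "incseq (\<lambda>i. \<integral>\<^sup>+x. U i x \<partial>M1)" "incseq (\<lambda>i. \<integral>\<^sup>+x. U i x \<partial>M2)"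
    using seq by (auto intro!: incseq_nn_integral)
  show ?case
    unfolding SUP_apply using seq m inc
    by (simp add: nn_integral_monotone_convergence_SUP ennreal_SUP_add)
qed

text \<open>Monotone convergence for the decreasing family \<open>g ln (v + 1/(n+1))\<close>, in a form that allows
  the limit to have integral \<open>-\<infinity>\<close>.\<close>
lemma ereal_integral_log_approx:
  fixes g v :: "'a \<Rightarrow> real"
  assumes [measurable]: "g \<in> borel_measurable M" "v \<in> borel_measurable M"
    and g: "\<And>x. 0 \<le> g x" and v: "\<And>x. 0 \<le> v x"
    and int: "\<And>n. integrable M (\<lambda>x. g x * ln (v x + 1 / real (Suc n)))"
    and S: "ereal_integral M (\<lambda>x. ereal (g x) * ereal_log (v x)) < ereal K"
  shows "\<exists>n. (\<integral>x. g x * ln (v x + 1 / real (Suc n)) \<partial>M) < K"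
proof (rule ccontr)
  assume "\<not> ?thesis"
  then have ge: "\<And>n. K \<le> (\<integral>x. g x * ln (v x + 1 / real (Suc n)) \<partial>M)" by (auto simp: not_less)
  define f where "f n x = g x * ln (v x + 1 / real (Suc n))" for n x
  define f' where "f' x = g x * ln (v x)" for x
  \<comment> \<open>The pointwise limit of f 0 - f n. It is infinite where v = 0 and g > 0, that is,
    where the true integrand is -infinity while \<open>f'\<close> has the default value 0 because
    \<open>ln 0 = 0\<close>. Fatou's lemma bounds the integral of L, so this set is null.\<close>
  define L where "L x = (if v x > 0 \<or> g x = 0 then ennreal (f 0 x - f' x) else \<infinity>)" for x
  have [measurable]: "f n \<in> borel_measurable M" "f' \<in> borel_measurable M" "L \<in> borel_measurable M" for n
    unfolding f_def f'_def L_def by measurable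
  have lim: "(\<lambda>n. ennreal (f 0 x - f n x)) \<longlonglongrightarrow> L x" for x
  proof (cases "v x > 0 \<or> g x = 0")
    case True
    have "(\<lambda>n. f n x) \<longlonglongrightarrow> f' x"
    proof (cases "g x = 0")
      case False
      then have "v x > 0" using True by simp
      moreover have "(\<lambda>n. v x + 1 / real (Suc n)) \<longlonglongrightarrow> v x + 0"
        by (intro tendsto_intros LIMSEQ_Suc[OF lim_1_over_n])
      ultimately show ?thesis unfolding f_def f'_def by (intro tendsto_intros) auto
    qed (simp add: f_def f'_def)
    then have "(\<lambda>n. ennreal (f 0 x - f n x)) \<longlonglongrightarrow> ennreal (f 0 x - f' x)" by (intro tendsto_intros)
    then show ?thesis using True by (simp add: L_def)
  next
    case False
    then have 0: "v x = 0" "g x > 0" using v[of x] g[of x] by auto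
    have "f 0 x - f n x = g x * ln (real (Suc n))" for n
      using 0 by (simp add: f_def ln_div)
    moreover have "filterlim (\<lambda>n. g x * ln (real (Suc n))) at_top sequentially"
      using 0(2) by (intro filterlim_tendsto_pos_mult_at_top[OF tendsto_const]
          filterlim_compose[OF ln_at_top] filterlim_compose[OF filterlim_real_sequentially] filterlim_Suc) auto
    ultimately have "filterlim (\<lambda>n. f 0 x - f n x) at_top sequentially" by simp
    then have "(\<lambda>n. ennreal (f 0 x - f n x)) \<longlonglongrightarrow> top" by (rule ennreal_tendsto_top_eq_at_top[THEN iffD2])
    then show ?thesis using False by (simp add: L_def)
  qed
  have mono: "f n x \<le> f 0 x" for n x
  proof -
    have "ln (v x + 1 / real (Suc n)) \<le> ln (v x + 1)"
      using v[of x] by (subst ln_le_cancel_iff) (auto simp: add_nonneg_pos)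
    then show ?thesis using g[of x] by (auto simp: f_def intro!: mult_left_mono)
  qed
  have gef: "K \<le> (\<integral>x. f n x \<partial>M)" for n using ge[of n] unfolding f_def .
  have intf: "integrable M (f n)" for n using int[of n] unfolding f_def .
  have le: "(\<integral>\<^sup>+x. ennreal (f 0 x - f n x) \<partial>M) \<le> ennreal ((\<integral>x. f 0 x \<partial>M) - K)" for n
  proof -
    have "(\<integral>\<^sup>+x. ennreal (f 0 x - f n x) \<partial>M) = ennreal (\<integral>x. f 0 x - f n x \<partial>M)"
      using mono by (intro nn_integral_eq_integral intf Bochner_Integration.integrable_diff) auto
    also have "\<dots> = ennreal ((\<integral>x. f 0 x \<partial>M) - (\<integral>x. f n x \<partial>M))"
      using intf by simp
    also have "\<dots> \<le> ennreal ((\<integral>x. f 0 x \<partial>M) - K)" using gef[of n] by (intro ennreal_leI) simp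
    finally show ?thesis .
  qed
  have "(\<integral>\<^sup>+x. L x \<partial>M) = (\<integral>\<^sup>+x. liminf (\<lambda>n. ennreal (f 0 x - f n x)) \<partial>M)"
    by (intro nn_integral_cong lim_imp_Liminf[symmetric] lim trivial_limit_sequentially)
  also have "\<dots> \<le> liminf (\<lambda>n. \<integral>\<^sup>+x. ennreal (f 0 x - f n x) \<partial>M)"
    by (rule nn_integral_liminf) measurable
  also have "\<dots> \<le> ennreal ((\<integral>x. f 0 x \<partial>M) - K)"
    using le by (intro Liminf_le) auto
  finally have L: "(\<integral>\<^sup>+x. L x \<partial>M) \<le> ennreal ((\<integral>x. f 0 x \<partial>M) - K)" .
  then have "AE x in M. L x \<noteq> \<infinity>"
    by (intro nn_integral_PInf_AE) (auto simp: top_unique)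
  then have ae: "AE x in M. v x > 0 \<or> g x = 0" by eventually_elim (auto simp: L_def split: if_splits)
  have f'0: "f' x \<le> f 0 x" if "v x > 0 \<or> g x = 0" for x
    using that g[of x] by (cases "g x = 0") (auto simp: f_def f'_def intro!: mult_left_mono)
  have intd: "(\<integral>\<^sup>+x. ennreal (f 0 x - f' x) \<partial>M) = (\<integral>\<^sup>+x. L x \<partial>M)"
    using ae by (intro nn_integral_cong_AE) (auto elim!: eventually_mono simp: L_def)
  have id: "integrable M (\<lambda>x. f 0 x - f' x)"
    using ae L by (intro integrableI_nonneg) (auto elim!: eventually_mono intro: f'0 simp: intd le_less_trans[OF _ ennreal_less_top])
  have "integrable M (\<lambda>x. f 0 x - (f 0 x - f' x))" by (rule Bochner_Integration.integrable_diff[OF intf id])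
  moreover have "(\<lambda>x. f 0 x - (f 0 x - f' x)) = f'" by auto
  ultimately have if': "integrable M f'" by (simp only:)
  have "ennreal (\<integral>x. f 0 x - f' x \<partial>M) = (\<integral>\<^sup>+x. L x \<partial>M)"
    unfolding intd[symmetric] using ae by (intro nn_integral_eq_integral[symmetric] id) (auto elim!: eventually_mono intro: f'0)
  also note L
  finally have "(\<integral>x. f 0 x - f' x \<partial>M) \<le> (\<integral>x. f 0 x \<partial>M) - K"
    using gef[of 0] by (subst (asm) ennreal_le_iff) auto
  then have "K \<le> (\<integral>x. f' x \<partial>M)" using intf[of 0] if' by simp
  moreover have "ereal_integral M (\<lambda>x. ereal (g x) * ereal_log (v x)) = ereal (\<integral>x. f' x \<partial>M)"
    using ae by (intro ereal_integral_eq_integral if') (auto elim!: eventually_mono simp: ereal_log_def f'_def)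
  ultimately show False using S by simp
qed

section \<open>Two-sided bounds for the weighted entropy\<close>

lemma Arg2pi_measurable [measurable]: "Arg2pi \<in> borel_measurable borel"
  by (rule borel_measurableI_greater) (auto intro!: borel_open open_Arg2pi2pi_gt)

lemma Arg2pi_cis: "0 \<le> \<theta> \<Longrightarrow> \<theta> < 2 * pi \<Longrightarrow> Arg2pi (cis \<theta>) = \<theta>"
  by (rule Arg2pi_unique[of 1]) (auto simp: cis_conv_exp)

text \<open>Only the endpoint 2 pi is sent elsewhere, namely to 0. The inverse makes it possible to
  regard the density as a function on the circle.\<close>

lemma AE_Arg2pi_cis: "AE \<theta> in angle_measure. Arg2pi (cis \<theta>) = \<theta>"
proof -
  have "AE \<theta> in angle_measure. \<theta> \<noteq> 2 * pi"
    by (rule lborel_AE_angle) (rule AE_lborel_singleton)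
  then show ?thesis using AE_angle_measure by eventually_elim (auto intro!: Arg2pi_cis)
qed

locale circle_measure_decomposition = circle_measure +
  fixes w :: "real \<Rightarrow> real" and \<mu>s :: "complex measure"
  assumes decomposition: "lebesgue_decomposition \<mu> w \<mu>s"
begin

text \<open>The values of \<open>w\<close> outside \<open>[0, 2 pi]\<close> may be negative.\<close>
definition v :: "real \<Rightarrow> real" where "v \<theta> = max 0 (w \<theta>)"

lemma v_measurable [measurable]: "v \<in> borel_measurable borel"
  using decomposition unfolding v_def lebesgue_decomposition_def by auto

lemma v_nonneg: "0 \<le> v \<theta>" by (simp add: v_def)

lemma v_eq_w: "AE \<theta> in angle_measure. v \<theta> = w \<theta>"
  using AE_angle_measure by eventually_elim (use decomposition in \<open>auto simp: v_def lebesgue_decomposition_def\<close>)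

lemma sets_mus [simp, measurable_cong]: "sets \<mu>s = sets circle_borel"
  using decomposition by (simp add: lebesgue_decomposition_def)

lemma nn_integral_decomposition:
  assumes f: "f \<in> borel_measurable circle_borel"
  shows "(\<integral>\<^sup>+z. f z \<partial>\<mu>) = (\<integral>\<^sup>+\<theta>. ennreal (v \<theta>) * f (cis \<theta>) \<partial>angle_measure) + (\<integral>\<^sup>+z. f z \<partial>\<mu>s)"
proof -
  have [measurable]: "w \<in> borel_measurable borel" using decomposition by (simp add: lebesgue_decomposition_def)
  let ?M = "distr (density angle_measure (\<lambda>\<theta>. ennreal (w \<theta>))) circle_borel cis"
  note f [measurable]
  have "(\<integral>\<^sup>+z. f z \<partial>\<mu>) = (\<integral>\<^sup>+z. f z \<partial>?M) + (\<integral>\<^sup>+z. f z \<partial>\<mu>s)"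
    by (rule nn_integral_add_measures) (use decomposition in \<open>auto simp: lebesgue_decomposition_def\<close>)
  also have "(\<integral>\<^sup>+z. f z \<partial>?M) = (\<integral>\<^sup>+\<theta>. ennreal (w \<theta>) * f (cis \<theta>) \<partial>angle_measure)"
    by (subst nn_integral_distr; (subst nn_integral_density)?; simp)
  also have "\<dots> = (\<integral>\<^sup>+\<theta>. ennreal (v \<theta>) * f (cis \<theta>) \<partial>angle_measure)"
    using v_eq_w by (intro nn_integral_cong_AE) (auto elim!: eventually_mono)
  finally show ?thesis .
qed

lemma nn_integral_v_le:
  "(\<integral>\<^sup>+\<theta>. ennreal (v \<theta>) \<partial>angle_measure) \<le> 1" and mus_le: "emeasure \<mu>s (space \<mu>s) \<le> 1"
proof -
  have "(\<integral>\<^sup>+\<theta>. ennreal (v \<theta>) \<partial>angle_measure) + emeasure \<mu>s (space \<mu>s) = 1"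
    using nn_integral_decomposition[of "\<lambda>_. 1"] emeasure_space_1 by simp
  then show "(\<integral>\<^sup>+\<theta>. ennreal (v \<theta>) \<partial>angle_measure) \<le> 1" "emeasure \<mu>s (space \<mu>s) \<le> 1"
    by (metis le_iff_add add.commute)+
qed

lemma integrable_v: "integrable angle_measure v"
  using nn_integral_v_le v_nonneg by (intro integrableI_nonneg) (auto intro: le_less_trans)

definition weighted_entropy :: ereal where
  "weighted_entropy = ereal_integral angle_measure (\<lambda>\<theta>. ereal (1 - (cos \<theta>)\<^sup>2) * ereal_log (v \<theta>))"

lemma sin_weight: "0 \<le> 1 - (cos \<theta>)\<^sup>2" "1 - (cos \<theta>)\<^sup>2 \<le> 1" for \<theta> :: real
  using unit_weight[of "cis \<theta>"] by auto

lemma integral_weight_angle: "(\<integral>\<theta>. 1 - (cos \<theta>)\<^sup>2 \<partial>angle_measure) = 1 / 2"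
proof -
  have "continuous_on (sphere 0 1) (\<lambda>z. 1 - (Re z)\<^sup>2)" by (intro continuous_intros)
  from integral_unif[OF this] show ?thesis by (simp add: integral_weight_unif)
qed

lemma integrable_cis:
  fixes f :: "complex \<Rightarrow> real"
  assumes "continuous_on (sphere 0 1) f"
  shows "integrable angle_measure (\<lambda>\<theta>. f (cis \<theta>))"
proof -
  have "integrable (distr angle_measure circle_borel cis) f"
    using integrable_unif[OF assms] by (simp add: unif_def)
  then show ?thesis by (subst (asm) integrable_distr_eq) (auto intro: continuous_on_circle_measurable assms)
qed

lemma integrable_log:
  assumes "d > 0"
  shows "integrable angle_measure (\<lambda>\<theta>. (1 - (cos \<theta>)\<^sup>2) * ln (v \<theta> + d))"
proof (rule Bochner_Integration.integrable_bound)
  show "integrable angle_measure (\<lambda>\<theta>. \<bar>ln d\<bar> + v \<theta> + d)" using integrable_v by auto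
  have "\<bar>(1 - (cos \<theta>)\<^sup>2) * ln (v \<theta> + d)\<bar> \<le> \<bar>ln d\<bar> + v \<theta> + d" for \<theta>
  proof -
    have "ln d \<le> ln (v \<theta> + d)" using assms v_nonneg[of \<theta>] by (subst ln_le_cancel_iff) auto
    moreover have "ln (v \<theta> + d) \<le> v \<theta> + d - 1" using assms v_nonneg[of \<theta>] by (intro ln_le_minus_one) auto
    ultimately have "\<bar>ln (v \<theta> + d)\<bar> \<le> \<bar>ln d\<bar> + v \<theta> + d" using assms v_nonneg[of \<theta>] by linarith
    moreover have "\<bar>(1 - (cos \<theta>)\<^sup>2) * ln (v \<theta> + d)\<bar> \<le> 1 * \<bar>ln (v \<theta> + d)\<bar>"
      unfolding abs_mult using sin_weight[of \<theta>] by (intro mult_right_mono) auto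
    ultimately show ?thesis by simp
  qed
  then show "AE \<theta> in angle_measure. norm ((1 - (cos \<theta>)\<^sup>2) * ln (v \<theta> + d)) \<le> norm (\<bar>ln d\<bar> + v \<theta> + d)"
    by (intro always_eventually) (auto intro: order_trans[OF _ abs_ge_self])
qed auto

text \<open>The majorant \<open>h\<close> consists of log w_N plus w / w_N - 1, with the weight 1 -
  cos^2. The integral of the weighted quotient is at most 1/2 plus half the bound on the matrix
  element of z^2, and the 1/2 cancels against the mean of the weight.\<close>

lemma weighted_entropy_le: "weighted_entropy \<le> ereal (bs_entropy N + (cmod (alpha_seq N) + cmod (alpha_seq (Suc N))) / 2)"
proof -
  define h where "h \<theta> = (1 - (cos \<theta>)\<^sup>2) * ln (bs_weight N (cis \<theta>)) + (1 - (cos \<theta>)\<^sup>2) * (v \<theta> / bs_weight N (cis \<theta>)) - (1 - (cos \<theta>)\<^sup>2)" for \<theta>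
  have bpos: "bs_weight N (cis \<theta>) > 0" for \<theta> by (rule bs_weight_pos) simp
  have bnz: "\<forall>z\<in>sphere 0 1. bs_weight N z \<noteq> 0" using bs_weight_pos[of _ N] by (force simp: less_imp_neq[symmetric])
  define q where "q z = (1 - (Re z)\<^sup>2) / bs_weight N z" for z
  have cq: "continuous_on (sphere 0 1) q" unfolding q_def by (intro continuous_intros bnz)
  have q0: "q z \<ge> 0" if "cmod z = 1" for z using unit_weight[OF that] bs_weight_pos[of z N] that by (simp add: q_def)
  have qmu: "(\<integral>z. q z \<partial>\<mu>) \<le> (1 + cmod (alpha_seq N) + cmod (alpha_seq (Suc N))) / 2"
  proof -
    have "(\<integral>z. q z \<partial>\<mu>) = (\<integral>z. ((cmod (poly (Phi alpha_seq N) z))\<^sup>2 - Re (z\<^sup>2 * of_real ((cmod (poly (Phi alpha_seq N) z))\<^sup>2))) / (2 * norm_prod N) \<partial>\<mu>)"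
    proof (intro Bochner_Integration.integral_cong refl)
      fix z assume "z \<in> space \<mu>"
      then have z: "cmod z = 1" by simp
      then have "(Im z)\<^sup>2 = 1 - (Re z)\<^sup>2" using cmod_power2[of z] by simp
      then have "Re (z\<^sup>2) = 2 * (Re z)\<^sup>2 - 1" by (simp add: Re_power2)
      then have "Re (z\<^sup>2 * of_real ((cmod (poly (Phi alpha_seq N) z))\<^sup>2)) = (2 * (Re z)\<^sup>2 - 1) * (cmod (poly (Phi alpha_seq N) z))\<^sup>2"
        by (simp only: Re_complex_of_real Im_complex_of_real times_complex.sel mult_zero_right diff_zero)
      moreover have "q z = (1 - (Re z)\<^sup>2) * (cmod (poly (Phi alpha_seq N) z))\<^sup>2 / norm_prod N"
        using z by (simp add: q_def bs_weight_def cmod_Phis_circle)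
      ultimately show "q z = ((cmod (poly (Phi alpha_seq N) z))\<^sup>2 - Re (z\<^sup>2 * of_real ((cmod (poly (Phi alpha_seq N) z))\<^sup>2))) / (2 * norm_prod N)"
        using norm_prod_pos[of N] by (simp add: field_simps)
    qed
    also have "\<dots> = (Phi_norm N - (\<integral>z. Re (z\<^sup>2 * of_real ((cmod (poly (Phi alpha_seq N) z))\<^sup>2)) \<partial>\<mu>)) / (2 * norm_prod N)"
    proof -
      have "integrable \<mu> (\<lambda>z. (cmod (poly (Phi alpha_seq N) z))\<^sup>2)" "integrable \<mu> (\<lambda>z. Re (z\<^sup>2 * of_real ((cmod (poly (Phi alpha_seq N) z))\<^sup>2)))"
        by (intro integrable_mu continuous_intros)+
      then show ?thesis unfolding Phi_norm_def by (simp only: integral_divide_zero Bochner_Integration.integral_diff)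
    qed
    also have "(\<integral>z. Re (z\<^sup>2 * of_real ((cmod (poly (Phi alpha_seq N) z))\<^sup>2)) \<partial>\<mu>) = Re (\<integral>z. z\<^sup>2 * of_real ((cmod (poly (Phi alpha_seq N) z))\<^sup>2) \<partial>\<mu>)"
      by (rule integral_Re) (intro integrable_mu continuous_intros)
    also have "(Phi_norm N - Re (\<integral>z. z\<^sup>2 * of_real ((cmod (poly (Phi alpha_seq N) z))\<^sup>2) \<partial>\<mu>)) / (2 * norm_prod N)
      \<le> (Phi_norm N + (cmod (alpha_seq N) + cmod (alpha_seq (Suc N))) * Phi_norm N) / (2 * norm_prod N)"
      using second_moment_bound[of N] norm_prod_pos[of N] by (intro divide_right_mono) auto
    also have "\<dots> = (1 + cmod (alpha_seq N) + cmod (alpha_seq (Suc N))) / 2"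
      using norm_prod_pos[of N] by (simp add: Phi_norm_eq_norm_prod field_simps)
    finally show ?thesis .
  qed
  have nnq: "(\<integral>\<^sup>+\<theta>. ennreal (v \<theta> * q (cis \<theta>)) \<partial>angle_measure) \<le> ennreal ((1 + cmod (alpha_seq N) + cmod (alpha_seq (Suc N))) / 2)"
  proof -
    have "(\<integral>\<^sup>+\<theta>. ennreal (v \<theta> * q (cis \<theta>)) \<partial>angle_measure) = (\<integral>\<^sup>+\<theta>. ennreal (v \<theta>) * ennreal (q (cis \<theta>)) \<partial>angle_measure)"
      using v_nonneg q0 by (simp add: ennreal_mult)
    \<comment> \<open>The singular part is dropped here, which is harmless for an upper bound since
      q >= 0.\<close>
    also have "\<dots> \<le> (\<integral>\<^sup>+z. ennreal (q z) \<partial>\<mu>)"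
      using continuous_on_circle_measurable[OF refl cq]
      by (subst nn_integral_decomposition[of "\<lambda>z. ennreal (q z)"]) auto
    also have "\<dots> = ennreal (\<integral>z. q z \<partial>\<mu>)"
      using q0 by (intro nn_integral_eq_integral integrable_mu cq AE_I2) auto
    also have "\<dots> \<le> ennreal ((1 + cmod (alpha_seq N) + cmod (alpha_seq (Suc N))) / 2)" using qmu by (rule ennreal_leI)
    finally show ?thesis .
  qed
  have qm: "(\<lambda>\<theta>. q (cis \<theta>)) \<in> borel_measurable borel"
    by (rule measurable_compose[OF cis_measurable continuous_on_circle_measurable[OF refl cq]])
  have iq: "integrable angle_measure (\<lambda>\<theta>. v \<theta> * q (cis \<theta>))"
    using nnq v_nonneg q0 qm by (intro integrableI_nonneg) (auto intro: le_less_trans)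
  have vq: "(\<integral>\<theta>. v \<theta> * q (cis \<theta>) \<partial>angle_measure) \<le> (1 + cmod (alpha_seq N) + cmod (alpha_seq (Suc N))) / 2"
  proof -
    have "ennreal (\<integral>\<theta>. v \<theta> * q (cis \<theta>) \<partial>angle_measure) \<le> ennreal ((1 + cmod (alpha_seq N) + cmod (alpha_seq (Suc N))) / 2)"
      using nnq v_nonneg q0 by (subst nn_integral_eq_integral[OF iq, symmetric]) auto
    then show ?thesis by (subst (asm) ennreal_le_iff) auto
  qed
  have cb: "continuous_on (sphere 0 1) (\<lambda>z. (1 - (Re z)\<^sup>2) * ln (bs_weight N z))" by (intro continuous_intros bnz)
  have cw: "continuous_on (sphere 0 1) (\<lambda>z. 1 - (Re z)\<^sup>2)" by (intro continuous_intros)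
  have ib: "integrable angle_measure (\<lambda>\<theta>. (1 - (cos \<theta>)\<^sup>2) * ln (bs_weight N (cis \<theta>)))"
    using integrable_cis[OF cb] by simp
  have iw: "integrable angle_measure (\<lambda>\<theta>. 1 - (cos \<theta>)\<^sup>2)"
    using integrable_cis[OF cw] by simp
  have h_eq: "h = (\<lambda>\<theta>. (1 - (cos \<theta>)\<^sup>2) * ln (bs_weight N (cis \<theta>)) + v \<theta> * q (cis \<theta>) - (1 - (cos \<theta>)\<^sup>2))"
    by (auto simp: h_def q_def)
  have ih: "integrable angle_measure h" unfolding h_eq using ib iq iw by auto
  have "weighted_entropy \<le> ereal (\<integral>\<theta>. h \<theta> \<partial>angle_measure)"
    unfolding weighted_entropy_def
  proof (intro ereal_integral_le ih AE_I2)
    fix \<theta> :: real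
    show "ereal (1 - (cos \<theta>)\<^sup>2) * ereal_log (v \<theta>) \<le> ereal (h \<theta>)"
    proof (cases "v \<theta> > 0")
      case True
      have "ln (v \<theta> / bs_weight N (cis \<theta>)) \<le> v \<theta> / bs_weight N (cis \<theta>) - 1" using True bpos[of \<theta>] by (intro ln_le_minus_one) simp
      then have "ln (v \<theta>) \<le> ln (bs_weight N (cis \<theta>)) + v \<theta> / bs_weight N (cis \<theta>) - 1" using True bpos[of \<theta>] by (simp add: ln_div)
      then have "(1 - (cos \<theta>)\<^sup>2) * ln (v \<theta>) \<le> (1 - (cos \<theta>)\<^sup>2) * (ln (bs_weight N (cis \<theta>)) + v \<theta> / bs_weight N (cis \<theta>) - 1)"
        using sin_weight[of \<theta>] by (intro mult_left_mono)
      also have "\<dots> = h \<theta>" by (simp add: h_def algebra_simps)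
      finally show ?thesis using True by (simp add: ereal_log_def)
    next
      case False
      \<comment> \<open>The left side is -infinity where the weight is positive; at the zeros of the
        weight it is 0 times -infinity, which is 0 in \<open>ereal\<close>, and \<open>h\<close> is
        0 as well.\<close>
      then have "v \<theta> = 0" using v_nonneg[of \<theta>] by simp
      then show ?thesis using sin_weight[of \<theta>]
        by (cases "1 - (cos \<theta>)\<^sup>2 = 0") (auto simp: ereal_log_def h_def)
    qed
  qed
  also have "(\<integral>\<theta>. h \<theta> \<partial>angle_measure) = (\<integral>\<theta>. (1 - (cos \<theta>)\<^sup>2) * ln (bs_weight N (cis \<theta>)) \<partial>angle_measure)
      + (\<integral>\<theta>. v \<theta> * q (cis \<theta>) \<partial>angle_measure) - 1 / 2"
    unfolding h_eq integral_weight_angle[symmetric] using ib iq iw by simp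
  also have "(\<integral>\<theta>. (1 - (cos \<theta>)\<^sup>2) * ln (bs_weight N (cis \<theta>)) \<partial>angle_measure) = bs_entropy N"
    using integral_unif[OF cb] integral_log_bs_weight[of N] by simp
  also have "ereal (bs_entropy N + (\<integral>\<theta>. v \<theta> * q (cis \<theta>) \<partial>angle_measure) - 1 / 2) \<le> ereal (bs_entropy N + (cmod (alpha_seq N) + cmod (alpha_seq (Suc N))) / 2)"
    using vq by (simp add: add_divide_distrib)
  finally show ?thesis .
qed

lemma bs_entropy_eventually_le_regularized:
  assumes d: "d > 0" and e: "e > 0"
  shows "\<exists>N0. \<forall>N\<ge>N0. bs_entropy N \<le> (\<integral>\<theta>. (1 - (cos \<theta>)\<^sup>2) * ln (v \<theta> + d) \<partial>angle_measure) + e"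
proof -
  obtain X where X: "X \<in> sets circle_borel" "emeasure unif X = 0" "emeasure \<mu>s (sphere 0 1 - X) = 0"
    using decomposition unfolding lebesgue_decomposition_def unif_def by blast
  have Xb [measurable]: "X \<in> sets borel" using X(1) by (subst (asm) sets_restrict_space_iff) auto
  \<comment> \<open>The bound e/3 pays for two errors of size \<open>lo\<close>, one from the
    truncation below and one from the singular part, and leaves a third of e for the approximation.
    The bound 1 / (2 d) ensures lo < hi.\<close>
  define lo hi where "lo = min (e / 3) (1 / (2 * d))" "hi = 1 / d"
  have lo: "lo > 0" "lo < hi" "lo \<le> e / 3" using d e by (auto simp: lo_hi_def min_less_iff_disj field_simps)
  \<comment> \<open>Minimising t w - log t pointwise suggests t = 1/w; the shift by d keeps it
    bounded and the maximum with \<open>lo\<close> keeps it away from 0 where w is large. On X,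
    which is null for arc length and carries the singular part, the value \<open>lo\<close> makes
    the singular contribution at most \<open>lo\<close>.\<close>
  define f where "f z = (if z \<in> X then lo else max lo (1 / (v (Arg2pi z) + d)))" for z
  have fm [measurable]: "f \<in> borel_measurable borel" unfolding f_def by measurable
  have fb: "lo \<le> f z" "f z \<le> hi" for z
  proof -
    have "1 / (v (Arg2pi z) + d) \<le> 1 / d" using d v_nonneg by (intro divide_left_mono) (auto intro!: mult_pos_pos add_nonneg_pos)
    then show "lo \<le> f z" "f z \<le> hi" using lo by (auto simp: f_def lo_hi_def)
  qed
  have fc: "f \<in> borel_measurable circle_borel" using fm by (rule measurable_restrict_space1)
  have gc: "(\<lambda>z. 1 - (Re z)\<^sup>2) \<in> borel_measurable circle_borel"
    by (rule continuous_on_circle_measurable) (auto intro!: continuous_intros)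
  note [measurable] = fc gc
  have gfc: "(\<lambda>z. (1 - (Re z)\<^sup>2) * f z) \<in> borel_measurable circle_borel" by measurable
  have gf: "0 \<le> (1 - (Re z)\<^sup>2) * f z" "(1 - (Re z)\<^sup>2) * f z \<le> f z" if "cmod z = 1" for z
    using unit_weight[OF that] fb[of z] lo mult_right_mono[of "1 - (Re z)\<^sup>2" 1 "f z"] by auto
  have ae: "AE \<theta> in angle_measure. cis \<theta> \<notin> X \<and> Arg2pi (cis \<theta>) = \<theta>"
  proof -
    have "AE z in unif. z \<notin> X" using X by (intro AE_not_in null_setsI) auto
    then have "AE \<theta> in angle_measure. cis \<theta> \<notin> X" unfolding unif_def by (rule AE_distrD[rotated]) simp
    with AE_Arg2pi_cis show ?thesis by eventually_elim auto
  qed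
  have v1: "(\<integral>\<theta>. v \<theta> \<partial>angle_measure) \<le> 1"
  proof -
    have "ennreal (\<integral>\<theta>. v \<theta> \<partial>angle_measure) \<le> ennreal 1"
      using nn_integral_v_le(1) by (subst nn_integral_eq_integral[OF integrable_v, symmetric]) (auto simp: v_nonneg)
    then show ?thesis by (subst (asm) ennreal_le_iff) auto
  qed
  have iw: "integrable angle_measure (\<lambda>\<theta>. 1 - (cos \<theta>)\<^sup>2)"
  proof -
    have "continuous_on (sphere 0 1) (\<lambda>z. 1 - (Re z)\<^sup>2)" by (intro continuous_intros)
    from integrable_cis[OF this] show ?thesis by simp
  qed
  have "(\<integral>\<^sup>+z. ennreal ((1 - (Re z)\<^sup>2) * f z) \<partial>\<mu>) \<le> ennreal (1 / 2 + lo) + ennreal lo"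
  proof (subst nn_integral_decomposition, use gfc in measurable, intro add_mono)
    have "(\<integral>\<^sup>+\<theta>. ennreal (v \<theta>) * ennreal ((1 - (Re (cis \<theta>))\<^sup>2) * f (cis \<theta>)) \<partial>angle_measure)
       \<le> (\<integral>\<^sup>+\<theta>. ennreal ((1 - (cos \<theta>)\<^sup>2) + lo * v \<theta>) \<partial>angle_measure)"
    proof (intro nn_integral_mono_AE eventually_mono[OF ae])
      fix \<theta> assume \<theta>: "cis \<theta> \<notin> X \<and> Arg2pi (cis \<theta>) = \<theta>"
      then have "f (cis \<theta>) \<le> lo + 1 / (v \<theta> + d)" using lo d v_nonneg[of \<theta>] by (auto simp: f_def)
      then have "v \<theta> * f (cis \<theta>) \<le> v \<theta> * (lo + 1 / (v \<theta> + d))" using v_nonneg by (intro mult_left_mono)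
      also have "\<dots> = lo * v \<theta> + v \<theta> / (v \<theta> + d)" by (simp add: algebra_simps)
      also have "v \<theta> / (v \<theta> + d) \<le> 1" using v_nonneg[of \<theta>] d by simp
      finally have "(1 - (cos \<theta>)\<^sup>2) * (v \<theta> * f (cis \<theta>)) \<le> (1 - (cos \<theta>)\<^sup>2) * (lo * v \<theta> + 1)"
        using sin_weight[of \<theta>] by (intro mult_left_mono) auto
      also have "\<dots> \<le> (1 - (cos \<theta>)\<^sup>2) + 1 * (lo * v \<theta>)"
        using sin_weight[of \<theta>] lo v_nonneg[of \<theta>] mult_right_mono[of "1 - (cos \<theta>)\<^sup>2" 1 "lo * v \<theta>"] by (simp add: algebra_simps)
      finally have "v \<theta> * ((1 - (cos \<theta>)\<^sup>2) * f (cis \<theta>)) \<le> (1 - (cos \<theta>)\<^sup>2) + lo * v \<theta>" by (simp add: algebra_simps)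
      moreover have "ennreal (v \<theta>) * ennreal ((1 - (Re (cis \<theta>))\<^sup>2) * f (cis \<theta>)) = ennreal (v \<theta> * ((1 - (cos \<theta>)\<^sup>2) * f (cis \<theta>)))"
        using gf[of "cis \<theta>"] v_nonneg by (simp add: ennreal_mult)
      ultimately show "ennreal (v \<theta>) * ennreal ((1 - (Re (cis \<theta>))\<^sup>2) * f (cis \<theta>)) \<le> ennreal ((1 - (cos \<theta>)\<^sup>2) + lo * v \<theta>)"
        by (simp add: ennreal_leI)
    qed
    also have "\<dots> = ennreal (\<integral>\<theta>. (1 - (cos \<theta>)\<^sup>2) + lo * v \<theta> \<partial>angle_measure)"
      using iw integrable_v sin_weight v_nonneg lo by (intro nn_integral_eq_integral) auto
    also have "(\<integral>\<theta>. (1 - (cos \<theta>)\<^sup>2) + lo * v \<theta> \<partial>angle_measure) = 1 / 2 + lo * (\<integral>\<theta>. v \<theta> \<partial>angle_measure)"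
      unfolding integral_weight_angle[symmetric] using iw integrable_v by simp
    also have "ennreal \<dots> \<le> ennreal (1 / 2 + lo)" using mult_left_mono[OF v1, of lo] lo by (intro ennreal_leI) simp
    finally show "(\<integral>\<^sup>+\<theta>. ennreal (v \<theta>) * ennreal ((1 - (Re (cis \<theta>))\<^sup>2) * f (cis \<theta>)) \<partial>angle_measure) \<le> ennreal (1 / 2 + lo)" .
  next
    have ms: "space \<mu>s = sphere 0 1" by (rule space_circle) simp
    have "AE z in \<mu>s. z \<notin> sphere 0 1 - X"
      using X by (intro AE_not_in null_setsI) (auto simp: sets_restrict_space)
    with AE_space have "AE z in \<mu>s. z \<in> X \<and> cmod z = 1" by eventually_elim (auto simp: ms)
    then have "(\<integral>\<^sup>+z. ennreal ((1 - (Re z)\<^sup>2) * f z) \<partial>\<mu>s) \<le> (\<integral>\<^sup>+z. ennreal lo \<partial>\<mu>s)"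
    proof (intro nn_integral_mono_AE, eventually_elim)
      case (elim z)
      then have "f z = lo" by (simp add: f_def)
      then show ?case using gf(2)[of z] elim by (intro ennreal_leI) simp
    qed
    also have "\<dots> \<le> ennreal lo" using mus_le mult_left_mono[of "emeasure \<mu>s (space \<mu>s)" 1 "ennreal lo"] by simp
    finally show "(\<integral>\<^sup>+z. ennreal ((1 - (Re z)\<^sup>2) * f z) \<partial>\<mu>s) \<le> ennreal lo" .
  qed
  also have "\<dots> = ennreal (1 / 2 + 2 * lo)" using lo by (simp flip: ennreal_plus)
  finally have nn: "(\<integral>\<^sup>+z. ennreal ((1 - (Re z)\<^sup>2) * f z) \<partial>\<mu>) \<le> ennreal (1 / 2 + 2 * lo)" .
  have "integrable \<mu> (\<lambda>z. (1 - (Re z)\<^sup>2) * f z)"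
    using gfc by (intro integrableI_nonneg AE_I2 gf le_less_trans[OF nn]) auto
  then have "ennreal (\<integral>z. (1 - (Re z)\<^sup>2) * f z \<partial>\<mu>) \<le> ennreal (1 / 2 + 2 * lo)"
    using nn by (subst nn_integral_eq_integral[symmetric]) (auto intro!: AE_I2 gf)
  then have 1: "(\<integral>z. (1 - (Re z)\<^sup>2) * f z \<partial>\<mu>) \<le> 1 / 2 + 2 * lo"
    using lo by (subst (asm) ennreal_le_iff) auto
  have "(\<integral>\<theta>. - ((1 - (cos \<theta>)\<^sup>2) * ln (f (cis \<theta>))) \<partial>angle_measure) \<le> (\<integral>\<theta>. (1 - (cos \<theta>)\<^sup>2) * ln (v \<theta> + d) \<partial>angle_measure)"
  proof (rule integral_mono_AE)
    show "integrable angle_measure (\<lambda>\<theta>. - ((1 - (cos \<theta>)\<^sup>2) * ln (f (cis \<theta>))))"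
    proof (rule angle.integrable_const_bound[of _ "\<bar>ln lo\<bar> + \<bar>ln hi\<bar>"])
      have "\<bar>(1 - (cos \<theta>)\<^sup>2) * ln (f (cis \<theta>))\<bar> \<le> \<bar>ln lo\<bar> + \<bar>ln hi\<bar>" for \<theta>
      proof -
        have "ln lo \<le> ln (f (cis \<theta>))" "ln (f (cis \<theta>)) \<le> ln hi" using fb[of "cis \<theta>"] lo by auto
        then have "\<bar>ln (f (cis \<theta>))\<bar> \<le> \<bar>ln lo\<bar> + \<bar>ln hi\<bar>" by linarith
        moreover have "\<bar>(1 - (cos \<theta>)\<^sup>2) * ln (f (cis \<theta>))\<bar> \<le> 1 * \<bar>ln (f (cis \<theta>))\<bar>"
          unfolding abs_mult using sin_weight[of \<theta>] by (intro mult_right_mono) auto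
        ultimately show ?thesis by simp
      qed
      then show "AE \<theta> in angle_measure. norm (- ((1 - (cos \<theta>)\<^sup>2) * ln (f (cis \<theta>)))) \<le> \<bar>ln lo\<bar> + \<bar>ln hi\<bar>" by simp
      have "(\<lambda>\<theta>. f (cis \<theta>)) \<in> borel_measurable borel" using measurable_compose[OF cis_measurable fc] .
      then show "(\<lambda>\<theta>. - ((1 - (cos \<theta>)\<^sup>2) * ln (f (cis \<theta>)))) \<in> borel_measurable angle_measure" by measurable
    qed
    show "integrable angle_measure (\<lambda>\<theta>. (1 - (cos \<theta>)\<^sup>2) * ln (v \<theta> + d))" by (rule integrable_log[OF d])
    show "AE \<theta> in angle_measure. - ((1 - (cos \<theta>)\<^sup>2) * ln (f (cis \<theta>))) \<le> (1 - (cos \<theta>)\<^sup>2) * ln (v \<theta> + d)"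
      using ae
    proof eventually_elim
      case (elim \<theta>)
      have p: "v \<theta> + d > 0" using v_nonneg[of \<theta>] d by simp
      have "1 / (v \<theta> + d) \<le> f (cis \<theta>)" using elim by (simp add: f_def)
      then have "ln (1 / (v \<theta> + d)) \<le> ln (f (cis \<theta>))" using p fb[of "cis \<theta>"] lo by (subst ln_le_cancel_iff) auto
      then have "- ln (f (cis \<theta>)) \<le> ln (v \<theta> + d)" using p by (simp add: ln_div)
      then have "(1 - (cos \<theta>)\<^sup>2) * (- ln (f (cis \<theta>))) \<le> (1 - (cos \<theta>)\<^sup>2) * ln (v \<theta> + d)"
        using sin_weight[of \<theta>] by (intro mult_left_mono) auto
      then show ?case by simp
    qed
  qed
  moreover have "(\<integral>z. (1 - (Re z)\<^sup>2) * ln (f z) \<partial>unif) = (\<integral>\<theta>. (1 - (cos \<theta>)\<^sup>2) * ln (f (cis \<theta>)) \<partial>angle_measure)"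
    unfolding unif_def by (subst integral_distr) auto
  ultimately have 2: "- (\<integral>z. (1 - (Re z)\<^sup>2) * ln (f z) \<partial>unif) \<le> (\<integral>\<theta>. (1 - (cos \<theta>)\<^sup>2) * ln (v \<theta> + d) \<partial>angle_measure)"
    by simp
  obtain N0 where "\<forall>N\<ge>N0. bs_entropy N \<le> (\<integral>z. (1 - (Re z)\<^sup>2) * f z \<partial>\<mu>) - 1 / 2 - (\<integral>z. (1 - (Re z)\<^sup>2) * ln (f z) \<partial>unif) + e / 3"
    using bs_entropy_le_measurable[OF fm fb lo(1,2), of "e / 3"] e by auto
  with 1 2 lo(3) show ?thesis by (intro exI[of _ N0]) force
qed

text \<open>Some regularised integral already lies below K, and the gap serves as the permitted
  error.\<close>

lemma bs_entropy_eventually_le: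
  assumes "weighted_entropy < ereal K"
  shows "\<exists>N0. \<forall>N\<ge>N0. bs_entropy N \<le> K"
proof -
  have "\<exists>n. (\<integral>\<theta>. (1 - (cos \<theta>)\<^sup>2) * ln (v \<theta> + 1 / real (Suc n)) \<partial>angle_measure) < K"
    using assms unfolding weighted_entropy_def
    by (intro ereal_integral_log_approx sin_weight v_nonneg integrable_log) auto
  then obtain n where n: "(\<integral>\<theta>. (1 - (cos \<theta>)\<^sup>2) * ln (v \<theta> + 1 / real (Suc n)) \<partial>angle_measure) < K" ..
  then have "K - (\<integral>\<theta>. (1 - (cos \<theta>)\<^sup>2) * ln (v \<theta> + 1 / real (Suc n)) \<partial>angle_measure) > 0" by simp
  from bs_entropy_eventually_le_regularized[OF _ this, of "1 / real (Suc n)"] show ?thesis by simp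
qed

end

section \<open>Passage to the limit\<close>

text \<open>Without the cubic term the statement would only give the sign of the logarithmic
  bracket. With it, the bracket at x = |a|^2 controls |a|^6, which forces the coefficients to 0 when
  the series converges.\<close>

lemma log_remainder_le:
  fixes x :: real
  assumes "0 \<le> x" "x < 1"
  shows "ln (1 - x) + x + x\<^sup>2 / 2 + x ^ 3 / 3 \<le> 0"
proof -
  define h where "h x = ln (1 - x) + x + x\<^sup>2 / 2 + x ^ 3 / 3" for x :: real
  have "h x \<le> h 0"
  proof (rule DERIV_nonpos_imp_nonincreasing[OF assms(1)])
    fix y assume y: "0 \<le> y" "y \<le> x"
    have "(h has_real_derivative - (1 / (1 - y)) + 1 + y + y\<^sup>2) (at y)"
      unfolding h_def using y assms by (auto intro!: derivative_eq_intros simp: power2_eq_square)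
    moreover have "- (1 / (1 - y)) + 1 + y + y\<^sup>2 \<le> 0"
    proof -
      have "- (1 / (1 - y)) + 1 + y + y\<^sup>2 = - (y ^ 3 / (1 - y))"
        using y assms by (simp add: field_simps power2_eq_square power3_eq_cube)
      then show ?thesis using y assms by simp
    qed
    ultimately show "\<exists>D. (h has_real_derivative D) (at y) \<and> D \<le> 0" by blast
  qed
  then show ?thesis by (simp add: h_def)
qed

text \<open>A crude constant is enough: at x = |a|^2 the right side is a multiple of |a|^4, the
  quantity whose sum is known to converge where this is used.\<close>

lemma log_remainder_ge:
  fixes x :: real
  assumes "0 \<le> x" "x \<le> 1 / 2"
  shows "- (ln (1 - x) + x + x\<^sup>2 / 2) \<le> 2 * x\<^sup>2"
  using ln_one_minus_pos_lower_bound[OF assms] zero_le_power2[of x] by linarith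

text \<open>The two brackets are 2 Re(x cnj y) + (|x|^2 - |y|^2) and 2 Re(x cnj y) - (|x|^2 -
  |y|^2), so the mixed terms of the squares cancel.\<close>

lemma quartic_identity:
  "(2 * (cmod x)\<^sup>2 - (cmod (x - y))\<^sup>2)\<^sup>2 + (2 * (cmod y)\<^sup>2 - (cmod (x - y))\<^sup>2)\<^sup>2
    = 2 * ((cmod x)\<^sup>2 - (cmod y)\<^sup>2)\<^sup>2 + 8 * (Re (x * cnj y))\<^sup>2"
  unfolding cmod_power2 by (simp add: power2_eq_square) (simp add: algebra_simps)

lemma suminf_ereal_of_summable:
  fixes f :: "nat \<Rightarrow> real"
  assumes "summable f"
  shows "(\<Sum>n. ereal (f n)) = ereal (\<Sum>n. f n)"
  using assms by (simp add: sums_ereal sums_unique[symmetric] summable_sums)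

lemma partial_sums_tendsto_infinity:
  fixes f :: "nat \<Rightarrow> real"
  assumes "\<And>n. 0 \<le> f n" "\<not> summable f"
  shows "filterlim (\<lambda>n. \<Sum>j<n. f j) at_top sequentially"
proof -
  have "\<exists>n. (\<Sum>j<n. f j) > B" for B
  proof (rule ccontr)
    assume "\<not> ?thesis"
    then have "\<And>n. (\<Sum>j<n. f j) \<le> B" by (auto simp: not_less)
    then have "summable f" using assms(1) by (intro summableI_nonneg_bounded)
    with assms(2) show False by simp
  qed
  then show ?thesis
    unfolding filterlim_at_top eventually_sequentially
    by (meson assms(1) less_imp_le order_trans sum_mono2 finite_lessThan lessThan_subset_iff)
qed

lemma suminf_ereal_not_summable:
  fixes f :: "nat \<Rightarrow> real"
  assumes "\<And>n. 0 \<le> f n" "\<not> summable f"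
  shows "(\<Sum>n. ereal (f n)) = \<infinity>" "(\<Sum>n. ereal (- f n)) = - \<infinity>"
proof -
  have *: "(\<lambda>n. ereal (\<Sum>j<n. f j)) \<longlonglongrightarrow> \<infinity>"
    using partial_sums_tendsto_infinity[OF assms] by (simp add: tendsto_PInfty_eq_at_top)
  then have "(\<lambda>n. ereal (f n)) sums \<infinity>" by (simp add: sums_def)
  then show "(\<Sum>n. ereal (f n)) = \<infinity>" by (rule sums_unique[symmetric])
  have "(\<lambda>n. - ereal (\<Sum>j<n. f j)) \<longlonglongrightarrow> - \<infinity>" using * by (rule tendsto_uminus_ereal)
  then have "(\<lambda>n. ereal (- f n)) sums (- \<infinity>)" by (simp add: sums_def sum_negf)
  then show "(\<Sum>n. ereal (- f n)) = - \<infinity>" by (rule sums_unique[symmetric])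
qed

section \<open>Convergence of the four series and the value of the right-hand side\<close>

context szego
begin

definition log_term :: "nat \<Rightarrow> real" where
  "log_term j = ln (1 - (cmod (a j))\<^sup>2) + (cmod (a j))\<^sup>2 + 1 / 2 * cmod (a j) ^ 4"

definition product_term :: "nat \<Rightarrow> real" where "product_term j = (cmod (a j * alpha (int j - 1)))\<^sup>2"

definition quartic_term :: "nat \<Rightarrow> real" where
  "quartic_term j = (2 * (cmod (a j))\<^sup>2 - (cmod (a j - alpha (int j - 1)))\<^sup>2)\<^sup>2
        + (2 * (cmod (alpha (int j - 1)))\<^sup>2 - (cmod (a j - alpha (int j - 1)))\<^sup>2)\<^sup>2"

text \<open>Minus the j-th summand of the whole right-hand side. All four contributions are
  nonnegative, so no cancellation can hide the divergence of one of the series.\<close>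

definition defect :: "nat \<Rightarrow> real" where "defect j = - log_term j / 2 + product_term j / 2 + diff_term j / 4 + quartic_term j / 16"

lemma local_term_eq: "local_term j = log_term j / 2 - product_term j / 2 - quartic_term j / 16"
  by (simp add: local_term_def log_term_def product_term_def quartic_term_def)

lemma a_sq_bounds: "0 \<le> (cmod (a j))\<^sup>2" "(cmod (a j))\<^sup>2 < 1"
  using one_minus_pos[of j] by auto

lemma log_term_le: "log_term j \<le> - ((cmod (a j))\<^sup>2 ^ 3 / 3)"
  using log_remainder_le[OF a_sq_bounds[of j]] by (simp add: log_term_def)

lemma signs: "log_term j \<le> 0" "0 \<le> product_term j" "0 \<le> diff_term j" "0 \<le> quartic_term j"
proof -
  have "0 \<le> (cmod (a j))\<^sup>2 ^ 3 / 3" by simp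
  then show "log_term j \<le> 0" using log_term_le[of j] by linarith
  show "0 \<le> diff_term j" unfolding diff_term_def using one_minus_pos[of j] by (intro mult_nonneg_nonneg) auto
qed (auto simp: product_term_def quartic_term_def)

lemma defect_nonneg: "0 \<le> defect j"
  using signs[of j] by (simp add: defect_def)

text \<open>The weight of order n + 1 knows the coefficients up to index n only, so at index n the
  difference term is still absent and just the local part appears.\<close>

lemma bs_entropy_defect: "bs_entropy (Suc n) = 3 / 8 - (\<Sum>j<n. defect j) + local_term n + boundary_term n"
  unfolding bs_entropy_eq by (simp add: defect_def local_term_eq sum.distrib sum_subtractf sum_negf add_divide_distrib flip: sum_divide_distrib)

lemma local_term_le_0: "local_term j \<le> 0"
  using signs[of j] by (simp add: local_term_eq)

lemma alpha_le_1: "cmod (alpha n) \<le> 1"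
  using a_less_1[of "nat n"] by (auto simp: alpha_def less_imp_le)

text \<open>Needed when the series diverge and the coefficients may not tend to 0: the only positive
  contribution is a product of squared moduli at most 1, divided by 4.\<close>

lemma boundary_term_le: "boundary_term n \<le> 1 / 4"
proof -
  define M where "M = (cmod (a n))\<^sup>2 * (cmod (alpha (int n - 1)))\<^sup>2"
  have "M \<le> 1 * 1" unfolding M_def
    using a_less_1[of n] alpha_le_1[of "int n - 1"] by (intro mult_mono) (auto simp: abs_square_le_1 less_imp_le)
  moreover have "boundary_term n = - (cmod (a n))\<^sup>2 / 4 - (cmod (alpha (int n - 1)))\<^sup>2 / 4 + M / 4 - cmod (a n) ^ 4 / 8"
    by (simp add: boundary_term_def M_def)
  moreover have "0 \<le> (cmod (a n))\<^sup>2 / 4" "0 \<le> (cmod (alpha (int n - 1)))\<^sup>2 / 4" "0 \<le> cmod (a n) ^ 4 / 8" by auto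
  ultimately show ?thesis by linarith
qed

lemma summable_defect_iff: "summable defect \<longleftrightarrow> summable log_term \<and> summable product_term \<and> summable diff_term \<and> summable quartic_term"
proof
  assume defect: "summable defect"
  have le: "norm (- log_term j / 2) \<le> defect j" "norm (product_term j / 2) \<le> defect j" "norm (diff_term j / 4) \<le> defect j" "norm (quartic_term j / 16) \<le> defect j" for j
    using signs[of j] by (simp_all add: defect_def)
  have "summable (\<lambda>j. - log_term j / 2)" "summable (\<lambda>j. product_term j / 2)" "summable (\<lambda>j. diff_term j / 4)" "summable (\<lambda>j. quartic_term j / 16)"
    by (rule summable_comparison_test'[OF defect, of 0], rule le)+
  then show "summable log_term \<and> summable product_term \<and> summable diff_term \<and> summable quartic_term"
    using summable_mult[of "\<lambda>j. - log_term j / 2" "-2"] summable_mult[of "\<lambda>j. product_term j / 2" 2]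
      summable_mult[of "\<lambda>j. diff_term j / 4" 4] summable_mult[of "\<lambda>j. quartic_term j / 16" 16] by simp
next
  assume "summable log_term \<and> summable product_term \<and> summable diff_term \<and> summable quartic_term"
  then have "summable (\<lambda>j. (-1/2) * log_term j + (1/2) * product_term j + (1/4) * diff_term j + (1/16) * quartic_term j)"
    by (intro summable_add summable_mult) auto
  then show "summable defect" by (simp add: defect_def[abs_def])
qed

lemma a_tendsto_0:
  assumes "summable defect"
  shows "a \<longlonglongrightarrow> 0"
proof -
  have "summable log_term" using assms summable_defect_iff by blast
  then have lim: "(\<lambda>j. - 3 * log_term j) \<longlonglongrightarrow> - 3 * 0" by (intro tendsto_intros summable_LIMSEQ_zero)
  have "(cmod (a j))\<^sup>2 ^ 3 \<le> - 3 * log_term j" for j using log_term_le[of j] by linarith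
  then have "\<forall>\<^sub>F j in sequentially. (cmod (a j))\<^sup>2 ^ 3 \<le> - 3 * log_term j" by simp
  moreover have "\<forall>\<^sub>F j in sequentially. 0 \<le> (cmod (a j))\<^sup>2 ^ 3" by simp
  ultimately have "(\<lambda>j. (cmod (a j))\<^sup>2 ^ 3) \<longlonglongrightarrow> 0"
    using lim tendsto_sandwich[of "\<lambda>_. 0" "\<lambda>j. (cmod (a j))\<^sup>2 ^ 3" sequentially "\<lambda>j. - 3 * log_term j" 0] by simp
  then have "(\<lambda>j. cmod (a j) ^ 6) \<longlonglongrightarrow> 0" by (simp flip: power_mult)
  then have "(\<lambda>j. root 6 (cmod (a j) ^ 6)) \<longlonglongrightarrow> root 6 0" by (intro tendsto_intros)
  then have "(\<lambda>j. cmod (a j)) \<longlonglongrightarrow> 0" by (simp add: real_root_power_cancel)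
  then show ?thesis by (rule tendsto_norm_zero_cancel)
qed

lemma bs_entropy_tendsto:
  assumes defect: "summable defect"
  shows "(\<lambda>n. bs_entropy (Suc n)) \<longlonglongrightarrow> 3 / 8 - suminf defect"
proof -
  have a0: "a \<longlonglongrightarrow> 0" by (rule a_tendsto_0[OF defect])
  have e0: "(\<lambda>n. alpha (int n - 1)) \<longlonglongrightarrow> 0"
    by (rule LIMSEQ_imp_Suc) (use a0 in simp)
  have "(\<lambda>n. boundary_term n) \<longlonglongrightarrow> - ((cmod 0)\<^sup>2 + (cmod 0)\<^sup>2) / 4 + (cmod 0)\<^sup>2 * (cmod 0)\<^sup>2 / 4 - cmod 0 ^ 4 / 8"
    unfolding boundary_term_def by (intro tendsto_intros a0 e0) auto
  then have E0: "boundary_term \<longlonglongrightarrow> 0" by simp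
  have "summable log_term" "summable product_term" "summable quartic_term" using defect summable_defect_iff by auto
  then have "(\<lambda>n. log_term n / 2 - product_term n / 2 - quartic_term n / 16) \<longlonglongrightarrow> 0 / 2 - 0 / 2 - 0 / 16"
    by (intro tendsto_intros summable_LIMSEQ_zero) auto
  then have T0: "local_term \<longlonglongrightarrow> 0" by (simp add: local_term_eq[abs_def])
  have "(\<lambda>n. 3 / 8 - (\<Sum>j<n. defect j) + local_term n + boundary_term n) \<longlonglongrightarrow> 3 / 8 - suminf defect + 0 + 0"
    by (intro tendsto_intros T0 E0 summable_LIMSEQ[OF defect])
  then show ?thesis by (simp add: bs_entropy_defect)
qed

definition rhs :: ereal where
  "rhs = ereal (3 / 8) + ereal (1 / 2) * (\<Sum>j. ereal (log_term j)) - ereal (1 / 2) * (\<Sum>j. ereal (product_term j))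
     - ereal (1 / 4) * (\<Sum>j. ereal (diff_term j)) - ereal (1 / 16) * (\<Sum>j. ereal (quartic_term j))"

lemma rhs_summable:
  assumes defect: "summable defect"
  shows "rhs = ereal (3 / 8 - suminf defect)"
proof -
  have s: "summable log_term" "summable product_term" "summable diff_term" "summable quartic_term" using defect summable_defect_iff by auto
  have "defect sums (- suminf log_term / 2 + suminf product_term / 2 + suminf diff_term / 4 + suminf quartic_term / 16)"
    unfolding defect_def[abs_def] by (intro sums_add sums_divide sums_minus summable_sums s)
  then have "suminf defect = - suminf log_term / 2 + suminf product_term / 2 + suminf diff_term / 4 + suminf quartic_term / 16"
    by (rule sums_unique[symmetric])
  then have "3 / 8 + 1 / 2 * suminf log_term - 1 / 2 * suminf product_term - 1 / 4 * suminf diff_term - 1 / 16 * suminf quartic_term = 3 / 8 - suminf defect"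
    by linarith
  then show ?thesis
    unfolding rhs_def suminf_ereal_of_summable[OF s(1)] suminf_ereal_of_summable[OF s(2)]
      suminf_ereal_of_summable[OF s(3)] suminf_ereal_of_summable[OF s(4)]
    by (simp only: times_ereal.simps plus_ereal.simps ereal_minus(1))
qed

text \<open>The logarithmic sum cannot be +infinity and the subtracted sums cannot be -infinity, so
  no undefined difference arises and one divergent series decides the value.\<close>

lemma rhs_not_summable:
  assumes defect: "\<not> summable defect"
  shows "rhs = - \<infinity>"
proof -
  have log_term: "(\<Sum>j. ereal (log_term j)) \<noteq> \<infinity> \<and> (\<not> summable log_term \<longrightarrow> (\<Sum>j. ereal (log_term j)) = - \<infinity>)"
  proof (cases "summable log_term")
    case True
    then show ?thesis by (simp add: suminf_ereal_of_summable)
  next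
    case False
    then have "\<not> summable (\<lambda>j. - log_term j)" by (simp add: summable_minus_iff)
    then show ?thesis using suminf_ereal_not_summable(2)[of "\<lambda>j. - log_term j"] signs(1) by simp
  qed
  have nn: "(\<Sum>j. ereal (f j)) \<noteq> - \<infinity> \<and> (\<not> summable f \<longrightarrow> (\<Sum>j. ereal (f j)) = \<infinity>)" if "\<And>j. 0 \<le> f j" for f :: "nat \<Rightarrow> real"
    using suminf_ereal_of_summable[of f] suminf_ereal_not_summable(1)[of f] that by (cases "summable f") auto
  note product_term = nn[of product_term, OF signs(2)] and diff_term = nn[of diff_term, OF signs(3)] and quartic_term = nn[of quartic_term, OF signs(4)]
  have "\<not> summable log_term \<or> \<not> summable product_term \<or> \<not> summable diff_term \<or> \<not> summable quartic_term" using defect summable_defect_iff by blast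
  then show ?thesis unfolding rhs_def using log_term product_term diff_term quartic_term
    by (cases "\<Sum>j. ereal (log_term j)"; cases "\<Sum>j. ereal (product_term j)"; cases "\<Sum>j. ereal (diff_term j)"; cases "\<Sum>j. ereal (quartic_term j)") auto
qed

lemma quartic_term_eq: "quartic_term j = 2 * ((cmod (a j))\<^sup>2 - (cmod (alpha (int j - 1)))\<^sup>2)\<^sup>2 + 8 * (Re (a j * cnj (alpha (int j - 1))))\<^sup>2"
  unfolding quartic_term_def by (rule quartic_identity)

lemma summable_defect_iff_conditions:
  "summable defect \<longleftrightarrow> summable (\<lambda>n. (cmod (a (n + 2) - a n))\<^sup>2 + cmod (a n) ^ 4)"
proof
  assume defect: "summable defect"
  then have s: "summable log_term" "summable product_term" "summable diff_term" "summable quartic_term" using summable_defect_iff by auto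
  have "(\<lambda>j. (cmod (a j))\<^sup>2) \<longlonglongrightarrow> (cmod 0)\<^sup>2" by (intro tendsto_intros a_tendsto_0 defect)
  then have "\<forall>\<^sub>F j in sequentially. (cmod (a j))\<^sup>2 < 1 / 2" by (rule order_tendstoD) simp
  then obtain n0 where n0: "\<And>j. j \<ge> n0 \<Longrightarrow> (cmod (a j))\<^sup>2 < 1 / 2" by (auto simp: eventually_sequentially)
  \<comment> \<open>The shift lines the difference term up with indices n + 2 and n; the factor 2
    compensates 1 - |a_{n+1}|^2, which is eventually above 1/2.\<close>
  have "summable (\<lambda>n. 2 * diff_term (Suc n))" using s(3) by (intro summable_mult) (simp add: summable_Suc_iff)
  then have 1: "summable (\<lambda>n. (cmod (a (n + 2) - a n))\<^sup>2)"
  proof (rule summable_comparison_test'[of _ n0])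
    fix n assume "n \<ge> n0"
    then have "(cmod (a (Suc n)))\<^sup>2 < 1 / 2" by (intro n0) simp
    then have "1 * (cmod (a (Suc (Suc n)) - a n))\<^sup>2 \<le> (2 * (1 - (cmod (a (Suc n)))\<^sup>2)) * (cmod (a (Suc (Suc n)) - a n))\<^sup>2"
      by (intro mult_right_mono) auto
    then show "norm ((cmod (a (n + 2) - a n))\<^sup>2) \<le> 2 * diff_term (Suc n)" by (simp add: diff_term_def algebra_simps)
  qed
  have "summable (\<lambda>n. quartic_term n / 2 + 2 * product_term n)" using s by (intro summable_add summable_mult summable_divide)
  then have 2: "summable (\<lambda>n. cmod (a n) ^ 4)"
  proof (rule summable_comparison_test'[of _ 0])
    fix n :: nat
    define p q where "p = (cmod (a n))\<^sup>2" "q = (cmod (alpha (int n - 1)))\<^sup>2"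
    \<comment> \<open>The quartic term controls the difference of the squared moduli and the product
      term their product; together they control each fourth power.\<close>
    have "p\<^sup>2 + q\<^sup>2 = (p - q)\<^sup>2 + 2 * (p * q)" by (simp add: power2_eq_square algebra_simps)
    moreover have "product_term n = p * q" by (simp add: product_term_def p_q_def norm_mult power_mult_distrib)
    moreover have "quartic_term n \<ge> 2 * (p - q)\<^sup>2" unfolding quartic_term_eq p_q_def by simp
    moreover have "0 \<le> q\<^sup>2" by simp
    ultimately have "p\<^sup>2 \<le> quartic_term n / 2 + 2 * product_term n" by linarith
    then show "norm (cmod (a n) ^ 4) \<le> quartic_term n / 2 + 2 * product_term n" by (simp add: p_q_def)
  qed
  from 1 2 show "summable (\<lambda>n. (cmod (a (n + 2) - a n))\<^sup>2 + cmod (a n) ^ 4)" by (rule summable_add)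
next
  assume s: "summable (\<lambda>n. (cmod (a (n + 2) - a n))\<^sup>2 + cmod (a n) ^ 4)"
  have s1: "summable (\<lambda>n. (cmod (a (n + 2) - a n))\<^sup>2)" and s2: "summable (\<lambda>n. cmod (a n) ^ 4)"
    by (rule summable_comparison_test'[OF s, of 0]; simp)+
  have "(\<lambda>n. root 4 (cmod (a n) ^ 4)) \<longlonglongrightarrow> root 4 0" by (intro tendsto_intros summable_LIMSEQ_zero s2)
  then have "(\<lambda>n. cmod (a n)) \<longlonglongrightarrow> 0" by (simp add: real_root_power_cancel)
  then have "(\<lambda>n. (cmod (a n))\<^sup>2) \<longlonglongrightarrow> 0\<^sup>2" by (intro tendsto_intros)
  then have "\<forall>\<^sub>F j in sequentially. (cmod (a j))\<^sup>2 < 1 / 2" by (rule order_tendstoD) simp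
  then obtain n0 where n0: "\<And>j. j \<ge> n0 \<Longrightarrow> (cmod (a j))\<^sup>2 < 1 / 2" by (auto simp: eventually_sequentially)
  have sX: "summable log_term"
  proof (rule summable_comparison_test'[OF summable_mult[OF s2, of 2], of n0])
    fix n assume "n \<ge> n0"
    then have "- log_term n \<le> 2 * ((cmod (a n))\<^sup>2)\<^sup>2"
      using log_remainder_ge[of "(cmod (a n))\<^sup>2"] n0[of n] by (simp add: log_term_def)
    then show "norm (log_term n) \<le> 2 * cmod (a n) ^ 4" using signs(1)[of n] by (simp add:)
  qed
  have s3: "summable (\<lambda>n. cmod (a (Suc n)) ^ 4 + cmod (a n) ^ 4)"
    using s2 by (intro summable_add) (simp_all add: summable_Suc_iff[of "\<lambda>n. cmod (a n) ^ 4"])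
  have bnd: "(cmod x)\<^sup>2 * (cmod y)\<^sup>2 \<le> cmod x ^ 4 + cmod y ^ 4" for x y
  proof -
    have "2 * ((cmod x)\<^sup>2 * (cmod y)\<^sup>2) \<le> ((cmod x)\<^sup>2)\<^sup>2 + ((cmod y)\<^sup>2)\<^sup>2"
      using sum_squares_bound[of "(cmod x)\<^sup>2" "(cmod y)\<^sup>2"] by (simp only: mult.assoc)
    moreover have "0 \<le> (cmod x)\<^sup>2 * (cmod y)\<^sup>2" by simp
    ultimately show ?thesis unfolding cmod_power4 by linarith
  qed
  \<comment> \<open>The shift by one leaves out index 0, whose neighbour is the conventional
    coefficient -1; a single summand does not affect convergence.\<close>
  have "summable (\<lambda>n. product_term (Suc n))"
    by (rule summable_comparison_test'[OF s3, of 0])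
       (use bnd in \<open>simp add: product_term_def norm_mult power_mult_distrib\<close>)
  then have sY: "summable product_term" by (simp add: summable_Suc_iff)
  have "summable (\<lambda>n. diff_term (Suc n))"
  proof (rule summable_comparison_test'[OF s1, of 0])
    fix n :: nat
    have "(1 - (cmod (a (Suc n)))\<^sup>2) * (cmod (a (Suc (Suc n)) - a n))\<^sup>2 \<le> 1 * (cmod (a (Suc (Suc n)) - a n))\<^sup>2"
      by (intro mult_right_mono) auto
    then show "norm (diff_term (Suc n)) \<le> (cmod (a (n + 2) - a n))\<^sup>2" using signs(3)[of "Suc n"] by (simp add: diff_term_def)
  qed
  then have sU: "summable diff_term" by (simp add: summable_Suc_iff)
  have "summable (\<lambda>n. quartic_term (Suc n))"
  \<comment> \<open>The constant 10 is 2 + 8, the factors in \<open>quartic_term_eq\<close>, since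
    (p - q)^2 and the squared real part are both at most p^2 + q^2.\<close>
  proof (rule summable_comparison_test'[OF summable_mult[OF s3, of 10], of 0])
    fix n :: nat
    define p q r where "p = (cmod (a (Suc n)))\<^sup>2" "q = (cmod (a n))\<^sup>2" "r = (Re (a (Suc n) * cnj (a n)))\<^sup>2"
    have "\<bar>Re (a (Suc n) * cnj (a n))\<bar>\<^sup>2 \<le> (cmod (a (Suc n) * cnj (a n)))\<^sup>2"
      by (intro power_mono abs_Re_le_cmod) simp
    then have "r \<le> (cmod (a (Suc n) * cnj (a n)))\<^sup>2"
      unfolding p_q_r_def power2_abs .
    then have r: "r \<le> p\<^sup>2 + q\<^sup>2"
      using bnd[of "a (Suc n)" "a n"] by (simp add: p_q_r_def norm_mult power_mult_distrib)
    have "(p - q)\<^sup>2 \<le> p\<^sup>2 + q\<^sup>2" by (simp add: power2_diff p_q_r_def)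
    with r have "2 * (p - q)\<^sup>2 + 8 * r \<le> 10 * (p\<^sup>2 + q\<^sup>2)" by simp
    moreover have "quartic_term (Suc n) = 2 * (p - q)\<^sup>2 + 8 * r" by (simp add: quartic_term_eq p_q_r_def)
    ultimately show "norm (quartic_term (Suc n)) \<le> 10 * (cmod (a (Suc n)) ^ 4 + cmod (a n) ^ 4)"
      using signs(4)[of "Suc n"] by (simp add: p_q_r_def)
  qed
  then have sQ: "summable quartic_term" by (simp add: summable_Suc_iff)
  show "summable defect" using sX sY sU sQ summable_defect_iff by blast
qed

end

section \<open>Comparison of the entropy of the measure with the limit of the entropies of the
  weights\<close>

context circle_measure_decomposition
begin

lemma weighted_entropy_not_summable:
  assumes "\<not> summable defect"
  shows "weighted_entropy = - \<infinity>"
proof -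
  have "weighted_entropy \<le> ereal B" for B
  proof -
    \<comment> \<open>The number 2 exceeds 3/8 + 1/4 + 1: the constant of the sum rule, the bound on
      the boundary term, and the bound on half the sum of two moduli below 1.\<close>
    obtain n where n: "(\<Sum>j<n. defect j) > 2 - B"
      using partial_sums_tendsto_infinity[OF defect_nonneg assms]
      unfolding filterlim_at_top_dense by (auto simp: eventually_sequentially)
    have "bs_entropy (Suc n) \<le> 3 / 8 - (\<Sum>j<n. defect j) + 1 / 4" unfolding bs_entropy_defect using local_term_le_0[of n] boundary_term_le[of n] by linarith
    then have "bs_entropy (Suc n) + (cmod (alpha_seq (Suc n)) + cmod (alpha_seq (Suc (Suc n)))) / 2 \<le> B"
      using n alpha_seq_less_1[of "Suc n"] alpha_seq_less_1[of "Suc (Suc n)"] unfolding add_divide_distrib by linarith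
    then show ?thesis using weighted_entropy_le[of "Suc n"] by (meson ereal_less_eq(3) order_trans)
  qed
  then show ?thesis by (rule ereal_bot)
qed

lemma weighted_entropy_summable:
  assumes defect: "summable defect"
  shows "weighted_entropy = ereal (3 / 8 - suminf defect)"
proof (rule antisym)
  have "(\<lambda>n. bs_entropy (Suc n) + (cmod (alpha_seq (Suc n)) + cmod (alpha_seq (Suc (Suc n)))) / 2) \<longlonglongrightarrow> (3 / 8 - suminf defect) + (cmod 0 + cmod 0) / 2"
    by (intro tendsto_intros bs_entropy_tendsto[OF defect] LIMSEQ_Suc[OF a_tendsto_0[OF defect]] LIMSEQ_Suc[OF LIMSEQ_Suc[OF a_tendsto_0[OF defect]]]) auto
  then have "(\<lambda>n. ereal (bs_entropy (Suc n) + (cmod (alpha_seq (Suc n)) + cmod (alpha_seq (Suc (Suc n)))) / 2)) \<longlonglongrightarrow> ereal (3 / 8 - suminf defect)"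
    by simp
  then show "weighted_entropy \<le> ereal (3 / 8 - suminf defect)" by (rule LIMSEQ_le_const) (use weighted_entropy_le in blast)
  show "ereal (3 / 8 - suminf defect) \<le> weighted_entropy"
  proof (rule ccontr)
    assume "\<not> ?thesis"
    then have "weighted_entropy < ereal (3 / 8 - suminf defect)" by simp
    \<comment> \<open>A real number strictly in between bounds the late entropies, and hence their
      limit, which already lies above it. The choice also covers an entropy equal to
      -infinity.\<close>
    then obtain K where K: "weighted_entropy < ereal K" "K < 3 / 8 - suminf defect" using ereal_dense2 by force
    from bs_entropy_eventually_le[OF K(1)] obtain N0 where "\<forall>N\<ge>N0. bs_entropy N \<le> K" ..
    then have "\<exists>N. \<forall>n\<ge>N. bs_entropy (Suc n) \<le> K" by (intro exI[of _ N0]) auto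
    then have "3 / 8 - suminf defect \<le> K" by (rule LIMSEQ_le_const2[OF bs_entropy_tendsto[OF defect]])
    with K show False by simp
  qed
qed

lemma weighted_entropy_eq: "weighted_entropy = rhs" and weighted_entropy_finite: "weighted_entropy > - \<infinity> \<longleftrightarrow> summable defect"
  using weighted_entropy_summable weighted_entropy_not_summable rhs_summable rhs_not_summable by (cases "summable defect"; simp)+

end

theorem theorem4p7:
  fixes \<mu> \<mu>s :: "complex measure" and w :: "real \<Rightarrow> real"
    and \<alpha> :: "int \<Rightarrow> complex" and \<rho> :: "int \<Rightarrow> real"
  assumes \<mu>: "circle_prob_measure \<mu>"
    and supp: "infinite (measure_support \<mu>)"
    and w: "lebesgue_decomposition \<mu> w \<mu>s"
    and \<alpha>: "\<alpha> = verblunsky \<mu>"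
    and \<rho>: "\<And>j. \<rho> j = sqrt (1 - (cmod (\<alpha> j))\<^sup>2)"
  shows "(ereal_integral angle_measure (\<lambda>\<theta>. ereal (1 - (cos \<theta>)\<^sup>2) * ereal_log (w \<theta>)) > -\<infinity>
            \<longleftrightarrow> summable (\<lambda>n::nat. (cmod (\<alpha> (int n + 2) - \<alpha> (int n)))\<^sup>2 + cmod (\<alpha> (int n)) ^ 4))
       \<and> ereal_integral angle_measure (\<lambda>\<theta>. ereal (1 - (cos \<theta>)\<^sup>2) * ereal_log (w \<theta>))
         = ereal (3 / 8)
           + ereal (1 / 2) * (\<Sum>j::nat. ereal (ln (1 - (cmod (\<alpha> (int j)))\<^sup>2)
                 + (cmod (\<alpha> (int j)))\<^sup>2 + 1 / 2 * cmod (\<alpha> (int j)) ^ 4))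
           - ereal (1 / 2) * (\<Sum>j::nat. ereal ((cmod (\<alpha> (int j) * \<alpha> (int j - 1)))\<^sup>2))
           - ereal (1 / 4) * (\<Sum>j::nat. ereal ((\<rho> (int j))\<^sup>2
                 * (cmod (\<alpha> (int j + 1) - \<alpha> (int j - 1)))\<^sup>2))
           - ereal (1 / 16) * (\<Sum>j::nat. ereal (
                 (2 * (cmod (\<alpha> (int j)))\<^sup>2 - (cmod (\<alpha> (int j) - \<alpha> (int j - 1)))\<^sup>2)\<^sup>2
               + (2 * (cmod (\<alpha> (int j - 1)))\<^sup>2 - (cmod (\<alpha> (int j) - \<alpha> (int j - 1)))\<^sup>2)\<^sup>2))"
proof -
  interpret circle_measure_decomposition \<mu> w \<mu>s
    using \<mu> supp w by unfold_locales
  \<comment> \<open>The two extensions to negative indices agree everywhere, as both are constantly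
    -1 there.\<close>
  have alpha: "\<alpha> = alpha" by (rule ext) (auto simp: \<alpha> alpha_def alpha_seq_def verblunsky_def)
  have a: "\<alpha> (int n) = alpha_seq n" "\<alpha> (int n + 1) = alpha_seq (Suc n)" "\<alpha> (int n + 2) = alpha_seq (n + 2)" for n
    by (simp_all add: \<alpha> alpha_seq_def algebra_simps)
  have \<rho>2: "(\<rho> (int j))\<^sup>2 = 1 - (cmod (alpha_seq j))\<^sup>2" for j
    using one_minus_pos[of j] by (simp add: \<rho> a)
  \<comment> \<open>Passing from \<open>w\<close> to its nonnegative version changes the integrand
    on a null set only, and the extended integral is built from two nonnegative ones.\<close>
  have weighted_entropy: "ereal_integral angle_measure (\<lambda>\<theta>. ereal (1 - (cos \<theta>)\<^sup>2) * ereal_log (w \<theta>)) = weighted_entropy"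
    unfolding weighted_entropy_def ereal_integral_def using v_eq_w
    by (intro arg_cong2[where f="\<lambda>x y. enn2ereal x - enn2ereal y"] nn_integral_cong_AE) (auto elim!: eventually_mono)
  show ?thesis
    unfolding weighted_entropy weighted_entropy_finite summable_defect_iff_conditions a \<rho>2 using weighted_entropy_eq
    unfolding rhs_def log_term_def product_term_def diff_term_def quartic_term_def alpha[symmetric] by simp
qed

end
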